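(* Let $X=\{x_1,\ldots,x_n\}$ and $Y=\{y_1,\ldots,y_m\}$ be two alphabets of commuting indeterminates (with $n,m$ possibly different). For nonempty $S\subseteq[n]$ and $T\subseteq[m]$ put $X_S=\sum_{i\in S}x_i$ and $Y_T=\sum_{i\in T}y_i$. For positive integers $j,k$ define \[ \mathcal{P}_{j,k}(X,Y)=\prod_{S\subseteq[n],\,|S|=j}\ \prod_{T\subseteq[m],\,|T|=k}(X_S+Y_T). \] Then $\mathcal{P}_{j,k}(X,Y)$ is Schur-positive: there exist nonnegative integers $a_{\lambda\mu}$ such that \[ \mathcal{P}_{j,k}(X,Y)=\sum_{\lambda,\mu}a_{\lambda\mu}\, s_\lambda(x_1,\ldots,x_n)\, s_\mu(y_1,\ldots,y_m). \]
   Context: $s_\lambda(x_1,\ldots,x_n)$ and $s_\mu(y_1,\ldots,y_m)$ denote Schur polynomials in the indicated variables, indexed by partitions $\lambda$, $\mu$. *)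

theory Defs
  imports "HOL-Library.Poly_Mapping" "HOL-Library.FuncSet"
begin

text \<open>
  Integer polynomials in the variables \<open>x\<^sub>i\<close> (index \<open>Inl i\<close>) and \<open>y\<^sub>i\<close> (index \<open>Inr i\<close>):
  finitely supported functions from exponent vectors to coefficients, with the
  convolution product of \<^theory>\<open>HOL-Library.Poly_Mapping\<close>. Variables are numbered from 1.
\<close>

type_synonym xy_poly = "((nat + nat) \<Rightarrow>\<^sub>0 nat) \<Rightarrow>\<^sub>0 int"

definition X_var :: "nat \<Rightarrow> xy_poly" where
  "X_var i = Poly_Mapping.single (Poly_Mapping.single (Inl i) 1) 1"

definition Y_var :: "nat \<Rightarrow> xy_poly" where
  "Y_var i = Poly_Mapping.single (Poly_Mapping.single (Inr i) 1) 1"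

definition boolean_product_poly :: "nat \<Rightarrow> nat \<Rightarrow> nat \<Rightarrow> nat \<Rightarrow> xy_poly" where
  "boolean_product_poly n m j k =
     (\<Prod>S | S \<subseteq> {1..n} \<and> card S = j. \<Prod>T | T \<subseteq> {1..m} \<and> card T = k.
        (\<Sum>i\<in>S. X_var i) + (\<Sum>i\<in>T. Y_var i))"

definition is_partition :: "nat list \<Rightarrow> bool" where
  "is_partition lam \<longleftrightarrow> sorted_wrt (\<ge>) lam \<and> 0 \<notin> set lam"

text \<open>Cells are (row, column) pairs in English notation, both counted from 0.\<close>

definition young_diagram :: "nat list \<Rightarrow> (nat \<times> nat) set" where
  "young_diagram lam = {(r, c). r < length lam \<and> c < lam ! r}"

text \<open>
  The extensional function space pins a filling to \<open>undefined\<close> outside the diagram,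
  so that distinct elements are distinct tableaux.
\<close>

definition ssyt :: "nat \<Rightarrow> nat list \<Rightarrow> (nat \<times> nat \<Rightarrow> nat) set" where
  "ssyt n lam = {F \<in> young_diagram lam \<rightarrow>\<^sub>E {1..n}.
     (\<forall>r c. (r, Suc c) \<in> young_diagram lam \<longrightarrow> F (r, c) \<le> F (r, Suc c)) \<and>
     (\<forall>r c. (Suc r, c) \<in> young_diagram lam \<longrightarrow> F (r, c) < F (Suc r, c))}"

text \<open>
  \<open>schur_poly n lam z\<close> is the Schur polynomial of shape \<open>lam\<close> at \<open>z 1, \<dots>, z n\<close>; it vanishes when \<open>lam\<close> has
  more than \<open>n\<close> parts, and is 1 for the empty partition.
\<close>

definition schur_poly :: "nat \<Rightarrow> nat list \<Rightarrow> (nat \<Rightarrow> 'a::comm_semiring_1) \<Rightarrow> 'a" where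
  "schur_poly n lam z = (\<Sum>F\<in>ssyt n lam. \<Prod>cell\<in>young_diagram lam. z (F cell))"

end

theory Submission
  imports Defs "HOL-Combinatorics.Permutations" "HOL-Library.Multiset" "Jordan_Normal_Form.Schur_Decomposition"
begin

text \<open>
  Symmetric polynomials are functions of the eigenvalues of a matrix. For matrices \<open>A\<close>, \<open>B\<close> with
  eigenvalues \<open>x\<close>, \<open>y\<close>, the boolean product is the determinant of \<open>\<Lambda>\<^sup>j A \<otimes> 1 + 1 \<otimes> \<Lambda>\<^sup>k B\<close>, where
  \<open>\<Lambda>\<^sup>j A\<close> is the derivation induced on the exterior power. The entries of this matrix are linear in \<open>A\<close> and
  \<open>B\<close> and of Gram type: the unit matrix at \<open>(a, b)\<close> contributes \<open>\<Sum>q. \<beta> I q a * \<beta> J q b\<close>. Hence full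
  polarization of the determinant is a positive kernel.

  For a diagram \<open>D\<close>, polarize a function of \<open>A\<close> and pair it on both sides with a vector that is
  antisymmetric along the columns of \<open>D\<close> and whose labels are the row numbers of \<open>D\<close>. A product of
  complete symmetric functions pairs to zero as soon as every matching of its blocks with the cells puts two
  cells of some column into one block, and a product of elementary ones as soon as some label must repeat
  in a block. Through the two Jacobi-Trudi identities these conditions say that the Schur function of
  shape \<open>E\<close> can pair nontrivially with \<open>D\<close> only if \<open>E\<close> is below \<open>D\<close> in dominance order for rows and for
  columns, so \<open>E = D\<close>. The pairing thus isolates one Schur coefficient, up to a positive factor, and on a
  positive kernel it is a sum of squares.
\<close>

section \<open>Determinants over a finite index set\<close>

text \<open>With \<open>x\<close> and \<open>y\<close> as Chern roots, the product is the top Chern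
  class of a tensor product of exterior powers, whose Schur positivity is classically a statement
  about ample bundles. A linear-algebra substitute for that geometry is built here. The obstacle is
  to read off a Schur coefficient by a functional that is a quadratic form. Diagonal matrices offer
  only unit matrices with equal left and right labels; an antisymmetric vector can be paired on both
  sides only if the labels \<open>t\<close> and \<open>t'\<close> vary independently. Hence
  symmetric functions are extended to all matrices, and exterior powers give an extension of the
  boolean product that is polynomial in the entries. The functional is tested at pairs of diagrams
  with as many cells in total as the determinant has rows, so that polarization matches rows with
  cells bijectively. The fixed total also repairs a defect: each pairing controls only shapes with
  at most as many cells as its own diagram, but if one component of a pair is too large, the other
  is too small.\<close>

definition fdet :: "'i set \<Rightarrow> ('i \<Rightarrow> 'i \<Rightarrow> 'a) \<Rightarrow> 'a::comm_ring_1" where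
  "fdet I M = (\<Sum>p | p permutes I. of_int (sign p) * (\<Prod>i\<in>I. M i (p i)))"

lemma fdet_cong:
  assumes "\<And>i j. i \<in> I \<Longrightarrow> j \<in> I \<Longrightarrow> M i j = M' i j"
  shows "fdet I M = fdet I M'"
  unfolding fdet_def
  by (intro sum.cong refl arg_cong2[where f = "(*)"] prod.cong) (auto simp: assms permutes_in_image)

text \<open>The involution \<open>p \<mapsto> p \<circ> (a b)\<close>; no division by two is needed in an arbitrary ring.\<close>

lemma fdet_equal_rows:
  assumes "finite I" "a \<in> I" "b \<in> I" "a \<noteq> b" and eq: "\<And>j. j \<in> I \<Longrightarrow> M a j = M b j"
  shows "fdet I M = 0"
proof -
  let ?P = "{p. p permutes I}"
  let ?h = "\<lambda>p. p \<circ> transpose a b"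
  let ?f = "\<lambda>p. of_int (sign p) * (\<Prod>i\<in>I. M i (p i))"
  let ?E = "{p\<in>?P. sign p = 1}" and ?O = "{p\<in>?P. sign p = -1}"
  have tr: "transpose a b permutes I" using assms by (simp add: permutes_swap_id)
  have perm: "permutation p" if "p permutes I" for p
    using that \<open>finite I\<close> permutation_permutes by blast
  have sg: "sign (?h p) = - sign p" if "p permutes I" for p
    using sign_compose[OF perm[OF that] perm[OF tr]] \<open>a \<noteq> b\<close> by (simp add: sign_swap_id)
  have pr: "(\<Prod>i\<in>I. M i (?h p i)) = (\<Prod>i\<in>I. M i (p i))" if p: "p permutes I" for p
  proof -
    have "(\<Prod>i\<in>I. M i (p i)) = (\<Prod>i\<in>I. M (transpose a b i) (p (transpose a b i)))"
      using prod.permute[OF tr, of "\<lambda>i. M i (p i)"] by (simp add: o_def)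
    also have "\<dots> = (\<Prod>i\<in>I. M i (?h p i))"
      using assms p by (intro prod.cong) (auto simp: transpose_def permutes_in_image)
    finally show ?thesis by simp
  qed
  have bij: "bij_betw ?h ?E ?O"
  proof (rule bij_betw_byWitness[where f' = ?h])
    show "\<forall>p\<in>?E. ?h (?h p) = p" "\<forall>p\<in>?O. ?h (?h p) = p" by (auto simp: o_assoc[symmetric])
    show "?h ` ?E \<subseteq> ?O" "?h ` ?O \<subseteq> ?E"
      using sg permutes_compose[OF tr] by auto
  qed
  have fin: "finite ?P" using \<open>finite I\<close> by (rule finite_permutations)
  have un: "?P = ?E \<union> ?O" by (auto intro: sign_cases)
  have "fdet I M = sum ?f ?E + sum ?f ?O"
    unfolding fdet_def by (subst un, rule sum.union_disjoint) (use fin in auto)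
  also have "sum ?f ?O = (\<Sum>p\<in>?E. ?f (?h p))"
    by (rule sum.reindex_bij_betw[OF bij, symmetric])
  also have "\<dots> = (\<Sum>p\<in>?E. - ?f p)"
    by (rule sum.cong) (auto simp: sg pr[unfolded o_def] pr)
  finally show ?thesis by (simp add: sum_negf)
qed

lemma fdet_zero_row:
  assumes "finite I" "a \<in> I" and "\<And>j. j \<in> I \<Longrightarrow> M a j = 0"
  shows "fdet I M = 0"
  unfolding fdet_def
proof (rule sum.neutral, safe)
  fix p assume "p permutes I"
  then have "(\<Prod>i\<in>I. M i (p i)) = 0"
    using assms by (intro prod_zero) (auto simp: permutes_in_image intro!: bexI[of _ a])
  then show "of_int (sign p) * (\<Prod>i\<in>I. M i (p i)) = 0" by simp
qed

lemma fdet_permute_rows: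
  assumes "finite I" and q: "q permutes I"
  shows "fdet I (\<lambda>i. M (q i)) = of_int (sign q) * fdet I M"
proof -
  have perm: "permutation p" if "p permutes I" for p
    using that \<open>finite I\<close> permutation_permutes by blast
  have "fdet I (\<lambda>i. M (q i)) = (\<Sum>p | p permutes I. of_int (sign (p \<circ> q)) * (\<Prod>i\<in>I. M (q i) ((p \<circ> q) i)))"
    unfolding fdet_def by (rule sum_permutations_compose_right[OF q])
  also have "\<dots> = (\<Sum>p | p permutes I. of_int (sign q) * (of_int (sign p) * (\<Prod>i\<in>I. M i (p i))))"
  proof (rule sum.cong[OF refl])
    fix p assume "p \<in> {p. p permutes I}"
    then have p: "p permutes I" by simp
    have "(\<Prod>i\<in>I. M (q i) ((p \<circ> q) i)) = (\<Prod>i\<in>I. M i (p i))"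
      using prod.permute[OF q, of "\<lambda>i. M i (p i)"] by (simp add: o_def)
    then show "of_int (sign (p \<circ> q)) * (\<Prod>i\<in>I. M (q i) ((p \<circ> q) i)) =
        of_int (sign q) * (of_int (sign p) * (\<Prod>i\<in>I. M i (p i)))"
      by (simp add: sign_compose[OF perm[OF p] perm[OF q]] mult_ac)
  qed
  finally show ?thesis by (simp add: fdet_def sum_distrib_left)
qed

lemma permutes_if_inj_PiE:
  assumes "finite I" "f \<in> I \<rightarrow>\<^sub>E I" "inj_on f I"
  shows "(\<lambda>i. if i \<in> I then f i else i) permutes I"
proof (rule bij_imp_permutes)
  have "f ` I = I" using assms by (intro endo_inj_surj) auto
  then show "bij_betw (\<lambda>i. if i \<in> I then f i else i) I I"
    using assms(3) by (simp add: bij_betw_def inj_on_def)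
qed simp

text \<open>Permutations are the identity outside \<open>I\<close>, while members of the extensional
  function space are \<open>undefined\<close> there; restriction translates between the two
  conventions.\<close>

lemma bij_betw_permutes_PiE:
  assumes "finite I"
  shows "bij_betw (\<lambda>p. restrict p I) {p. p permutes I} {f \<in> I \<rightarrow>\<^sub>E I. inj_on f I}"
proof (rule bij_betw_byWitness[where f' = "\<lambda>f i. if i \<in> I then f i else i"])
  show "\<forall>p\<in>{p. p permutes I}. (\<lambda>i. if i \<in> I then restrict p I i else i) = p"
    by (auto simp: permutes_not_in fun_eq_iff)
  show "\<forall>f\<in>{f \<in> I \<rightarrow>\<^sub>E I. inj_on f I}. restrict (\<lambda>i. if i \<in> I then f i else i) I = f"
    by (auto simp: fun_eq_iff PiE_iff extensional_def)
  show "(\<lambda>p. restrict p I) ` {p. p permutes I} \<subseteq> {f \<in> I \<rightarrow>\<^sub>E I. inj_on f I}"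
    by (auto simp: permutes_in_image permutes_inj_on inj_on_restrict_eq)
  show "(\<lambda>f i. if i \<in> I then f i else i) ` {f \<in> I \<rightarrow>\<^sub>E I. inj_on f I} \<subseteq> {p. p permutes I}"
    using permutes_if_inj_PiE[OF assms] by auto
qed

text \<open>Multilinearity in all rows at once. The range \<open>B i\<close> may vary with the row,
  so that in the branching step of the Jacobi-Trudi proof a single sum can run over all shapes,
  given by their row lengths.\<close>

lemma fdet_sum_rows:
  assumes "finite I" and "\<And>i. i \<in> I \<Longrightarrow> finite (B i)"
  shows "fdet I (\<lambda>i j. \<Sum>b\<in>B i. c i b * R i b j) =
    (\<Sum>\<beta>\<in>PiE I B. (\<Prod>i\<in>I. c i (\<beta> i)) * fdet I (\<lambda>i j. R i (\<beta> i) j))"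
proof -
  have "fdet I (\<lambda>i j. \<Sum>b\<in>B i. c i b * R i b j) =
    (\<Sum>p | p permutes I. \<Sum>\<beta>\<in>PiE I B. of_int (sign p) * (\<Prod>i\<in>I. c i (\<beta> i) * R i (\<beta> i) (p i)))"
    unfolding fdet_def using assms by (simp add: prod_sum_PiE sum_distrib_left)
  also have "\<dots> = (\<Sum>\<beta>\<in>PiE I B. \<Sum>p | p permutes I. (\<Prod>i\<in>I. c i (\<beta> i)) * (of_int (sign p) * (\<Prod>i\<in>I. R i (\<beta> i) (p i))))"
    by (subst sum.swap) (simp add: prod.distrib mult_ac)
  finally show ?thesis by (simp add: fdet_def sum_distrib_left)
qed

text \<open>Expanding every row of the product over the rows of \<open>N\<close> leaves determinants
  of chosen rows; a repeated row gives zero, and the injective choices are permutations.\<close>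

lemma fdet_mult:
  assumes "finite I"
  shows "fdet I (\<lambda>i j. \<Sum>k\<in>I. M i k * N k j) = fdet I M * fdet I N"
proof -
  let ?g = "\<lambda>f. (\<Prod>i\<in>I. M i (f i)) * fdet I (\<lambda>i. N (f i))"
  have "fdet I (\<lambda>i j. \<Sum>k\<in>I. M i k * N k j) = (\<Sum>f\<in>I \<rightarrow>\<^sub>E I. ?g f)"
    using assms by (rule fdet_sum_rows) (use assms in auto)
  also have "\<dots> = sum ?g {f \<in> I \<rightarrow>\<^sub>E I. inj_on f I}"
  proof (rule sum.mono_neutral_right)
    show "finite (I \<rightarrow>\<^sub>E I)" using assms by (simp add: finite_PiE)
    show "\<forall>f\<in>(I \<rightarrow>\<^sub>E I) - {f \<in> I \<rightarrow>\<^sub>E I. inj_on f I}. ?g f = 0"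
    proof
      fix f assume "f \<in> (I \<rightarrow>\<^sub>E I) - {f \<in> I \<rightarrow>\<^sub>E I. inj_on f I}"
      then obtain a b where "a \<in> I" "b \<in> I" "a \<noteq> b" "f a = f b" by (auto simp: inj_on_def)
      then have "fdet I (\<lambda>i. N (f i)) = 0"
        using assms by (intro fdet_equal_rows[of I a b]) auto
      then show "?g f = 0" by simp
    qed
  qed auto
  also have "\<dots> = (\<Sum>p | p permutes I. ?g (restrict p I))"
    by (rule sum.reindex_bij_betw[OF bij_betw_permutes_PiE[OF assms], symmetric])
  also have "\<dots> = (\<Sum>p | p permutes I. (of_int (sign p) * (\<Prod>i\<in>I. M i (p i))) * fdet I N)"
  proof (rule sum.cong[OF refl])
    fix p assume "p \<in> {p. p permutes I}"
    then have p: "p permutes I" by simp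
    have "fdet I (\<lambda>i. N (restrict p I i)) = fdet I (\<lambda>i. N (p i))"
      by (rule fdet_cong) simp
    then show "?g (restrict p I) = (of_int (sign p) * (\<Prod>i\<in>I. M i (p i))) * fdet I N"
      by (simp add: fdet_permute_rows[OF assms p] mult_ac)
  qed
  finally show ?thesis by (simp add: fdet_def sum_distrib_right)
qed

lemma fdet_one:
  assumes "finite I"
  shows "fdet I (\<lambda>i j. if i = j then 1 else 0) = (1 :: 'a :: comm_ring_1)"
proof -
  have "fdet I (\<lambda>i j. if i = j then 1 else (0::'a)) =
    (\<Sum>p\<in>{id}. of_int (sign p) * (\<Prod>i\<in>I. if i = p i then 1 else 0))"
    unfolding fdet_def
  proof (rule sum.mono_neutral_right)
    show "finite {p. p permutes I}" using assms by (rule finite_permutations)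
    show "{id} \<subseteq> {p. p permutes I}" by (simp add: permutes_id)
    show "\<forall>p\<in>{p. p permutes I} - {id}. of_int (sign p) * (\<Prod>i\<in>I. if i = p i then 1 else (0::'a)) = 0"
    proof
      fix p assume p: "p \<in> {p. p permutes I} - {id}"
      then obtain i where "p i \<noteq> i" by (auto simp: fun_eq_iff)
      then have "i \<in> I" "i \<noteq> p i" using p by (auto dest: permutes_not_in)
      then show "of_int (sign p) * (\<Prod>i\<in>I. if i = p i then 1 else (0::'a)) = 0"
        using prod_zero[OF assms bexI[of "\<lambda>i. (if i = p i then 1 else (0::'a)) = 0" i]] by simp
    qed
  qed
  then show ?thesis by simp
qed

section \<open>Young diagrams and the branching rule\<close>

text \<open>All rows are changed simultaneously. In the multilinear expansion, consider the last row
  \<open>m\<close> that contributes its neighbour \<open>Suc m\<close>: either the row after it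
  contributes itself and two rows agree, or \<open>m\<close> is the last row and the neighbour is
  zero.\<close>

lemma fdet_row_op:
  assumes "\<And>j. j < N \<Longrightarrow> R N j = (0 :: 'a :: comm_ring_1)"
  shows "fdet {..<N} (\<lambda>i j. R i j - c i * R (Suc i) j) = fdet {..<N} R"
proof -
  let ?B = "\<lambda>i. {i, Suc i}"
  let ?c = "\<lambda>i b. if b = i then 1 else - c i"
  let ?g = "\<lambda>\<beta>. (\<Prod>i<N. ?c i (\<beta> i)) * fdet {..<N} (\<lambda>i. R (\<beta> i))"
  let ?id = "restrict id {..<N}"
  have "fdet {..<N} (\<lambda>i j. R i j - c i * R (Suc i) j) = fdet {..<N} (\<lambda>i j. \<Sum>b\<in>?B i. ?c i b * R b j)"
    by (rule fdet_cong) simp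
  also have "\<dots> = (\<Sum>\<beta>\<in>PiE {..<N} ?B. ?g \<beta>)"
    by (rule fdet_sum_rows) auto
  also have "\<dots> = sum ?g {?id}"
  proof (rule sum.mono_neutral_right)
    show "finite (PiE {..<N} ?B)" by (intro finite_PiE) auto
    show "{?id} \<subseteq> PiE {..<N} ?B" by auto
    show "\<forall>\<beta>\<in>PiE {..<N} ?B - {?id}. ?g \<beta> = 0"
    proof
      fix \<beta> assume \<beta>: "\<beta> \<in> PiE {..<N} ?B - {?id}"
      let ?S = "{i. i < N \<and> \<beta> i = Suc i}"
      have "?S \<noteq> {}"
      proof
        assume "?S = {}"
        then have "\<beta> = ?id" using \<beta> by (fastforce simp: fun_eq_iff PiE_iff extensional_def)
        then show False using \<beta> by simp
      qed
      then have mS: "Max ?S \<in> ?S" by (intro Max_in) auto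
      define m where "m = Max ?S"
      have m: "m < N" "\<beta> m = Suc m" using mS by (auto simp: m_def)
      have "fdet {..<N} (\<lambda>i. R (\<beta> i)) = 0"
      proof (cases "Suc m = N")
        case True
        then show ?thesis using m assms by (intro fdet_zero_row[of _ m]) auto
      next
        case False
        have "Suc m \<notin> ?S"
        proof
          assume "Suc m \<in> ?S"
          then have "Suc m \<le> m" unfolding m_def by (intro Max_ge) auto
          then show False by simp
        qed
        then have "\<beta> (Suc m) = Suc m" using \<beta> m False by (auto simp: PiE_iff)
        then show ?thesis using m False by (intro fdet_equal_rows[of _ m "Suc m"]) auto
      qed
      then show "?g \<beta> = 0" by simp
    qed
  qed
  also have "\<dots> = fdet {..<N} R" by (simp add: fdet_def)
  finally show ?thesis .
qed

section \<open>Diagrams as down-closed sets of cells\<close>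

definition ydiag :: "(nat \<times> nat) set \<Rightarrow> bool" where
  "ydiag D \<longleftrightarrow> finite D \<and> (\<forall>r c r' c'. (r, c) \<in> D \<longrightarrow> r' \<le> r \<longrightarrow> c' \<le> c \<longrightarrow> (r', c') \<in> D)"

definition row_len :: "(nat \<times> nat) set \<Rightarrow> nat \<Rightarrow> nat" where
  "row_len D r = card {c. (r, c) \<in> D}"

definition col_len :: "(nat \<times> nat) set \<Rightarrow> nat \<Rightarrow> nat" where
  "col_len D c = card {r. (r, c) \<in> D}"

lemma ydiag_finite: "ydiag D \<Longrightarrow> finite D"
  by (simp add: ydiag_def)

lemma ydiagD: "ydiag D \<Longrightarrow> (r, c) \<in> D \<Longrightarrow> r' \<le> r \<Longrightarrow> c' \<le> c \<Longrightarrow> (r', c') \<in> D"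
  unfolding ydiag_def by blast

lemma down_closed_eq_lessThan:
  fixes S :: "nat set"
  assumes "finite S" "\<And>x y. x \<in> S \<Longrightarrow> y \<le> x \<Longrightarrow> y \<in> S"
  shows "S = {..<card S}"
proof (cases "S = {}")
  case False
  then have "S = {..Max S}" using assms by (auto intro: Max_in)
  then show ?thesis by (metis card_atMost lessThan_Suc_atMost)
qed simp

lemma mem_iff_row_len: "ydiag D \<Longrightarrow> (r, c) \<in> D \<longleftrightarrow> c < row_len D r"
proof -
  assume D: "ydiag D"
  have "finite {c. (r, c) \<in> D}"
    by (rule finite_subset[of _ "snd ` D"]) (use D in \<open>force simp: ydiag_def\<close>)+
  then have "{c. (r, c) \<in> D} = {..<row_len D r}"
    unfolding row_len_def by (rule down_closed_eq_lessThan) (use ydiagD[OF D] in auto)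
  then show ?thesis by auto
qed

lemma mem_iff_col_len: "ydiag D \<Longrightarrow> (r, c) \<in> D \<longleftrightarrow> r < col_len D c"
proof -
  assume D: "ydiag D"
  have "finite {r. (r, c) \<in> D}"
    by (rule finite_subset[of _ "fst ` D"]) (use D in \<open>force simp: ydiag_def\<close>)+
  then have "{r. (r, c) \<in> D} = {..<col_len D c}"
    unfolding col_len_def by (rule down_closed_eq_lessThan) (use ydiagD[OF D] in auto)
  then show ?thesis by auto
qed

lemma row_len_antimono: "ydiag D \<Longrightarrow> i \<le> j \<Longrightarrow> row_len D j \<le> row_len D i"
  by (meson ydiagD le_refl linorder_not_less mem_iff_row_len)

lemma col_len_antimono: "ydiag D \<Longrightarrow> i \<le> j \<Longrightarrow> col_len D j \<le> col_len D i"
  by (meson ydiagD le_refl linorder_not_less mem_iff_col_len)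

lemma row_len_rows: "row_len {(r, c). r < N \<and> c < a r} i = (if i < N then a i else 0)"
  by (simp add: row_len_def)

lemma col_len_cols: "col_len {(r, c). c < N \<and> r < a c} i = (if i < N then a i else 0)"
  by (simp add: col_len_def)

lemma ydiag_rows:
  assumes "\<And>i j. i \<le> j \<Longrightarrow> j < N \<Longrightarrow> a j \<le> a i"
  shows "ydiag {(r, c). r < N \<and> c < (a r :: nat)}"
proof -
  have "{(r, c). r < N \<and> c < a r} = Sigma {..<N} (\<lambda>r. {..<a r})" by auto
  then show ?thesis using assms unfolding ydiag_def
    by (auto intro: order_less_le_trans order_le_less_trans simp del: split_paired_All)
qed

lemma ydiag_cols:
  assumes "\<And>i j. i \<le> j \<Longrightarrow> j < N \<Longrightarrow> a j \<le> a i"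
  shows "ydiag {(r, c). c < N \<and> r < (a c :: nat)}"
proof -
  have "{(r, c). c < N \<and> r < a c} = prod.swap ` Sigma {..<N} (\<lambda>r. {..<a r})" by force
  then have "finite {(r, c). c < N \<and> r < a c}" by simp
  then show ?thesis using assms unfolding ydiag_def
    by (auto intro: order_less_le_trans order_le_less_trans)
qed

lemma ydiag_eq_rows: "ydiag D \<Longrightarrow> (\<And>r. r \<ge> N \<Longrightarrow> row_len D r = 0) \<Longrightarrow> D = {(r, c). r < N \<and> c < row_len D r}"
  by (auto simp: mem_iff_row_len) (metis not_less not_less_zero)

lemma ydiag_eq_cols: "ydiag D \<Longrightarrow> (\<And>r. r \<ge> N \<Longrightarrow> col_len D r = 0) \<Longrightarrow> D = {(r, c). c < N \<and> r < col_len D c}"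
  by (auto simp: mem_iff_col_len) (metis not_less not_less_zero)

lemma card_eq_sum_row_len:
  assumes "ydiag D" "\<And>r. r \<ge> N \<Longrightarrow> row_len D r = 0"
  shows "card D = (\<Sum>r<N. row_len D r)"
proof -
  have "D = Sigma {..<N} (\<lambda>r. {..<row_len D r})" using ydiag_eq_rows[OF assms] by auto
  then have "card D = card (Sigma {..<N} (\<lambda>r. {..<row_len D r}))" by simp
  also have "\<dots> = (\<Sum>r<N. row_len D r)" by (subst card_SigmaI) auto
  finally show ?thesis .
qed

lemma card_eq_sum_col_len:
  assumes "ydiag D" "\<And>r. r \<ge> N \<Longrightarrow> col_len D r = 0"
  shows "card D = (\<Sum>r<N. col_len D r)"
proof -
  have "D = prod.swap ` Sigma {..<N} (\<lambda>r. {..<col_len D r})" using ydiag_eq_cols[OF assms] by force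
  then have "card D = card (prod.swap ` Sigma {..<N} (\<lambda>r. {..<col_len D r}))" by simp
  also have "\<dots> = (\<Sum>r<N. col_len D r)" by (subst card_image) auto
  finally show ?thesis .
qed

text \<open>
  The same tableaux as in \<open>ssyt\<close>, with the shape given as a set of block_cells, so that its rows and its
  columns enter on the same footing.
\<close>

definition tableaux :: "nat \<Rightarrow> (nat \<times> nat) set \<Rightarrow> (nat \<times> nat \<Rightarrow> nat) set" where
  "tableaux n D = {F \<in> D \<rightarrow>\<^sub>E {1..n}.
     (\<forall>r c. (r, Suc c) \<in> D \<longrightarrow> F (r, c) \<le> F (r, Suc c)) \<and>
     (\<forall>r c. (Suc r, c) \<in> D \<longrightarrow> F (r, c) < F (Suc r, c))}"

definition schur_diag :: "nat \<Rightarrow> (nat \<times> nat) set \<Rightarrow> (nat \<Rightarrow> 'a::comm_semiring_1) \<Rightarrow> 'a" where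
  "schur_diag n D z = (\<Sum>F\<in>tableaux n D. \<Prod>cell\<in>D. z (F cell))"

lemma finite_tableaux: "finite D \<Longrightarrow> finite (tableaux n D)"
  unfolding tableaux_def by (rule finite_subset[of _ "D \<rightarrow>\<^sub>E {1..n}"]) (auto intro: finite_PiE)

lemma tableaux_mono_row:
  assumes "F \<in> tableaux n D" "ydiag D" "(r, c) \<in> D" "c' \<le> c"
  shows "F (r, c') \<le> F (r, c)"
  using \<open>c' \<le> c\<close> \<open>(r, c) \<in> D\<close>
proof (induction rule: dec_induct)
  case (step c)
  then have "(r, c) \<in> D" using ydiagD[OF assms(2)] by (meson Suc_leD le_refl)
  then show ?case using step assms(1) by (auto simp: tableaux_def intro: le_trans)
qed simp

lemma tableaux_mono_col:
  assumes "F \<in> tableaux n D" "ydiag D" "(r, c) \<in> D" "r' \<le> r"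
  shows "F (r', c) + (r - r') \<le> F (r, c)"
  using \<open>r' \<le> r\<close> \<open>(r, c) \<in> D\<close>
proof (induction rule: dec_induct)
  case (step r)
  then have "(r, c) \<in> D" using ydiagD[OF assms(2)] by (meson Suc_leD le_refl)
  moreover have "F (r, c) < F (Suc r, c)" using step assms(1) by (auto simp: tableaux_def)
  ultimately show ?case using step by simp
qed simp

text \<open>The complements of horizontal strips: a removed cell is the lowest cell of its column in
  \<open>D\<close>, so at most one cell per column is removed.\<close>

definition strips :: "(nat \<times> nat) set \<Rightarrow> (nat \<times> nat) set set" where
  "strips D = {D'. D' \<subseteq> D \<and> ydiag D' \<and> (\<forall>r c. (r, c) \<in> D - D' \<longrightarrow> (Suc r, c) \<notin> D)}"

lemma finite_strips: "finite D \<Longrightarrow> finite (strips D)"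
  unfolding strips_def by (rule finite_subset[of _ "Pow D"]) auto

text \<open>In a tableau the cells holding the maximal entry \<open>Suc n\<close> form a horizontal
  strip, and what remains is a tableau with entries up to \<open>n\<close>.\<close>

lemma schur_diag_branching:
  fixes z :: "nat \<Rightarrow> 'a :: comm_semiring_1"
  assumes D: "ydiag D"
  shows "schur_diag (Suc n) D z = (\<Sum>D'\<in>strips D. z (Suc n) ^ card (D - D') * schur_diag n D' z)"
proof -
  have fD: "finite D" using D by (rule ydiag_finite)
  let ?w = "\<lambda>(D', G). z (Suc n) ^ card (D - D') * (\<Prod>p\<in>D'. z (G p))"
  let ?low = "\<lambda>F. {p \<in> D. F p \<le> n}"
  let ?to = "\<lambda>F. (?low F, restrict F (?low F))"
  \<comment> \<open>Cells of the strip are refilled with \<open>Suc n\<close>; the value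
    \<open>undefined\<close> off \<open>D\<close> keeps the result in the extensional function
    space, so that this is an exact inverse of \<open>?to\<close>.\<close>
  let ?from = "\<lambda>(D', G). \<lambda>p. if p \<in> D' then G p else if p \<in> D then Suc n else undefined"
  have low: "?low F \<in> strips D" if F: "F \<in> tableaux (Suc n) D" for F
    unfolding strips_def
  proof (intro CollectI conjI allI impI)
    show "?low F \<subseteq> D" by auto
    show "ydiag (?low F)" unfolding ydiag_def
    proof (intro conjI allI impI)
      fix r c r' c' assume a: "(r, c) \<in> ?low F" "r' \<le> r" "c' \<le> c"
      then have "(r', c) \<in> D" "(r', c') \<in> D" using ydiagD[OF D] by auto
      moreover have "F (r', c') \<le> F (r', c)" using tableaux_mono_row[OF F D] a calculation by auto
      moreover have "F (r', c) \<le> F (r, c)" using tableaux_mono_col[OF F D, of r c r'] a by auto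
      ultimately show "(r', c') \<in> ?low F" using a by auto
    qed (use fD in auto)
  next
    fix r c assume "(r, c) \<in> D - ?low F"
    then have "F (r, c) > n" by auto
    moreover have "F (Suc r, c) \<le> Suc n" if "(Suc r, c) \<in> D" 
      using F that by (auto simp: tableaux_def PiE_iff)
    ultimately show "(Suc r, c) \<notin> D" using F by (fastforce simp: tableaux_def)
  qed
  have to: "?to F \<in> Sigma (strips D) (tableaux n)" if F: "F \<in> tableaux (Suc n) D" for F
  proof -
    have y: "ydiag (?low F)" using low[OF F] by (simp add: strips_def)
    have "restrict F (?low F) \<in> tableaux n (?low F)"
      unfolding tableaux_def
    proof (intro CollectI conjI allI impI)
      show "restrict F (?low F) \<in> ?low F \<rightarrow>\<^sub>E {1..n}"
        using F by (auto simp: tableaux_def PiE_iff)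
      fix r c
      assume a: "(r, Suc c) \<in> ?low F"
      then have "(r, c) \<in> ?low F" using ydiagD[OF y, of r "Suc c" r c] by auto
      then show "restrict F (?low F) (r, c) \<le> restrict F (?low F) (r, Suc c)"
        using F a by (auto simp: tableaux_def)
    next
      fix r c
      assume a: "(Suc r, c) \<in> ?low F"
      then have "(r, c) \<in> ?low F" using ydiagD[OF y, of "Suc r" c r c] by auto
      then show "restrict F (?low F) (r, c) < restrict F (?low F) (Suc r, c)"
        using F a by (auto simp: tableaux_def)
    qed
    then show ?thesis using low[OF F] by simp
  qed
  have from1: "?from (D', G) \<in> tableaux (Suc n) D" if D': "D' \<in> strips D" and G: "G \<in> tableaux n D'" for D' G
    unfolding tableaux_def
  proof (intro CollectI conjI allI impI)
    have sub: "D' \<subseteq> D" and y: "ydiag D'" using D' by (auto simp: strips_def)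
    have Gle: "1 \<le> G p" "G p \<le> n" if "p \<in> D'" for p using G that by (auto simp: tableaux_def PiE_iff)
    show "?from (D', G) \<in> D \<rightarrow>\<^sub>E {1..Suc n}"
      using Gle sub by (auto simp: PiE_iff extensional_def le_SucI)
    fix r c
    {
      assume a: "(r, Suc c) \<in> D"
      then have b: "(r, c) \<in> D" using ydiagD[OF D] by (meson le_SucI le_refl)
      show "?from (D', G) (r, c) \<le> ?from (D', G) (r, Suc c)"
      proof (cases "(r, Suc c) \<in> D'")
        case True
        then have "(r, c) \<in> D'" using ydiagD[OF y] by (meson le_SucI le_refl)
        then show ?thesis using True G by (auto simp: tableaux_def)
      next
        case False
        then show ?thesis using a b Gle by (auto intro: le_SucI)
      qed
    next
      assume a: "(Suc r, c) \<in> D"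
      then have "(r, c) \<in> D" using ydiagD[OF D] by (meson le_SucI le_refl)
      then have b: "(r, c) \<in> D'" using a D' by (auto simp: strips_def)
      show "?from (D', G) (r, c) < ?from (D', G) (Suc r, c)"
      proof (cases "(Suc r, c) \<in> D'")
        case True
        then show ?thesis using b G by (auto simp: tableaux_def)
      next
        case False
        then show ?thesis using a b Gle(2)[OF b] by auto
      qed
    }
  qed
  have to_from: "?to (?from (D', G)) = (D', G)" if D': "D' \<in> strips D" and G: "G \<in> tableaux n D'" for D' G
  proof -
    have "D' \<subseteq> D" "\<And>p. p \<in> D' \<Longrightarrow> G p \<le> n" using D' G by (auto simp: strips_def tableaux_def PiE_iff)
    then have l: "?low (?from (D', G)) = D'" by (auto split: if_splits)
    have "restrict (?from (D', G)) D' = G" using G by (auto simp: tableaux_def PiE_iff extensional_def fun_eq_iff)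
    then show ?thesis using l by simp
  qed
  have from_to: "?from (?to F) = F" if F: "F \<in> tableaux (Suc n) D" for F
  proof
    fix p
    have E: "F \<in> D \<rightarrow>\<^sub>E {1..Suc n}" using F by (simp add: tableaux_def)
    have "p \<in> D \<Longrightarrow> F p \<le> Suc n" "p \<notin> D \<Longrightarrow> F p = undefined"
      using PiE_mem[OF E] PiE_arb[OF E] by simp_all
    then show "?from (?to F) p = F p" by auto
  qed
  have bij: "bij_betw ?to (tableaux (Suc n) D) (Sigma (strips D) (tableaux n))"
  proof (rule bij_betw_byWitness[where f' = ?from])
    show "\<forall>F\<in>tableaux (Suc n) D. ?from (?to F) = F" using from_to by blast
    show "\<forall>q\<in>Sigma (strips D) (tableaux n). ?to (?from q) = q" using to_from by blast
    show "?to ` tableaux (Suc n) D \<subseteq> Sigma (strips D) (tableaux n)" using to by blast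
    show "?from ` Sigma (strips D) (tableaux n) \<subseteq> tableaux (Suc n) D" using from1 by blast
  qed
  have wt: "(\<Prod>p\<in>D. z (F p)) = ?w (?to F)" if F: "F \<in> tableaux (Suc n) D" for F
  proof -
    have "(\<Prod>p\<in>D. z (F p)) = (\<Prod>p\<in>D - ?low F. z (F p)) * (\<Prod>p\<in>?low F. z (F p))"
      using fD by (intro prod.subset_diff) auto
    also have "(\<Prod>p\<in>D - ?low F. z (F p)) = (\<Prod>p\<in>D - ?low F. z (Suc n))"
    proof (rule prod.cong[OF refl])
      fix p assume "p \<in> D - ?low F"
      then have "F p = Suc n" using F by (auto simp: tableaux_def PiE_iff intro!: le_antisym)
      then show "z (F p) = z (Suc n)" by simp
    qed
    finally show ?thesis by simp
  qed
  have "schur_diag (Suc n) D z = (\<Sum>F\<in>tableaux (Suc n) D. ?w (?to F))"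
    unfolding schur_diag_def using wt by (rule sum.cong[OF refl])
  also have "\<dots> = sum ?w (Sigma (strips D) (tableaux n))"
    by (rule sum.reindex_bij_betw[OF bij])
  also have "\<dots> = (\<Sum>D'\<in>strips D. \<Sum>G\<in>tableaux n D'. z (Suc n) ^ card (D - D') * (\<Prod>p\<in>D'. z (G p)))"
    using fD by (subst sum.Sigma) (auto intro!: finite_strips finite_tableaux simp: strips_def intro: finite_subset)
  finally show ?thesis by (simp add: schur_diag_def sum_distrib_left)
qed

lemma schur_diag_0: "schur_diag 0 D z = (if D = {} then 1 else 0)"
proof (cases "D = {}")
  case False
  then have "tableaux 0 D = {}" by (auto simp: tableaux_def PiE_iff)
  then show ?thesis using False by (simp add: schur_diag_def)
qed (auto simp: schur_diag_def tableaux_def)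

section \<open>Jacobi-Trudi identities\<close>

definition hsym :: "nat \<Rightarrow> (nat \<Rightarrow> 'a::comm_ring_1) \<Rightarrow> nat \<Rightarrow> 'a" where
  "hsym n x k = (\<Sum>M | set_mset M \<subseteq> {1..n} \<and> size M = k. \<Prod>i\<in>#M. x i)"

definition esym :: "nat \<Rightarrow> (nat \<Rightarrow> 'a::comm_ring_1) \<Rightarrow> nat \<Rightarrow> 'a" where
  "esym n x k = (\<Sum>S | S \<subseteq> {1..n} \<and> card S = k. \<Prod>i\<in>S. x i)"

text \<open>The entries of a Jacobi-Trudi determinant have degree \<open>a i + j - i\<close> and
  must vanish when it is negative. Truncated subtraction would give degree 0 and the value 1
  instead.\<close>

definition hsym_int :: "nat \<Rightarrow> (nat \<Rightarrow> 'a::comm_ring_1) \<Rightarrow> int \<Rightarrow> 'a" where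
  "hsym_int n x k = (if k < 0 then 0 else hsym n x (nat k))"

definition esym_int :: "nat \<Rightarrow> (nat \<Rightarrow> 'a::comm_ring_1) \<Rightarrow> int \<Rightarrow> 'a" where
  "esym_int n x k = (if k < 0 then 0 else esym n x (nat k))"

lemma finite_msets_of_size: "finite A \<Longrightarrow> finite {M. set_mset M \<subseteq> A \<and> size M = k}"
proof -
  assume "finite A"
  then have "finite (mset ` {xs. set xs \<subseteq> A \<and> length xs = k})"
    by (intro finite_imageI finite_lists_length_eq)
  moreover have "{M. set_mset M \<subseteq> A \<and> size M = k} \<subseteq> mset ` {xs. set xs \<subseteq> A \<and> length xs = k}"
  proof
    fix M assume M: "M \<in> {M. set_mset M \<subseteq> A \<and> size M = k}"
    obtain xs where "mset xs = M" using ex_mset by blast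
    then show "M \<in> mset ` {xs. set xs \<subseteq> A \<and> length xs = k}" using M by (intro image_eqI[of _ _ xs]) auto
  qed
  ultimately show ?thesis by (rule finite_subset[rotated])
qed

lemma hsym_0_right [simp]: "hsym n x 0 = 1"
proof -
  have "{M. set_mset M \<subseteq> {1..n} \<and> size M = 0} = {{#}}" by auto
  then show ?thesis by (simp add: hsym_def)
qed

lemma hsym_0_left: "hsym 0 x k = (if k = 0 then 1 else 0)"
proof (cases "k = 0")
  case False
  then have "{M. set_mset M \<subseteq> {1..0::nat} \<and> size M = k} = {}" by auto
  then show ?thesis using False unfolding hsym_def by (simp only: sum.empty if_False)
qed simp

lemma hsym_Suc: "hsym (Suc n) x (Suc k) = hsym n x (Suc k) + x (Suc n) * hsym (Suc n) x k"
proof -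
  let ?A = "{M. set_mset M \<subseteq> {1..Suc n} \<and> size M = Suc k}"
  let ?B = "{M. set_mset M \<subseteq> {1..n} \<and> size M = Suc k}"
  let ?C = "{M. set_mset M \<subseteq> {1..Suc n} \<and> size M = k}"
  let ?w = "\<lambda>M. \<Prod>i\<in>#M. x i"
  have "?A = ?B \<union> add_mset (Suc n) ` ?C"
  proof (intro equalityI subsetI)
    fix M assume M: "M \<in> ?A"
    show "M \<in> ?B \<union> add_mset (Suc n) ` ?C"
    proof (cases "Suc n \<in># M")
      case True
      then obtain N where N: "M = add_mset (Suc n) N" by (metis mset_add)
      then show ?thesis using M by auto
    next
      case False
      have "set_mset M \<subseteq> {1..n}"
      proof
        fix i assume i: "i \<in># M"
        then have "i \<in> {1..Suc n}" "i \<noteq> Suc n" using M False by auto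
        then show "i \<in> {1..n}" by auto
      qed
      then show ?thesis using M by auto
    qed
  next
    fix M assume "M \<in> ?B \<union> add_mset (Suc n) ` ?C"
    then show "M \<in> ?A" by (force simp: subset_iff)
  qed
  moreover have "?B \<inter> add_mset (Suc n) ` ?C = {}" by (auto simp: subset_iff)
  ultimately have "sum ?w ?A = sum ?w ?B + sum ?w (add_mset (Suc n) ` ?C)"
    by (simp add: sum.union_disjoint finite_msets_of_size)
  also have "sum ?w (add_mset (Suc n) ` ?C) = (\<Sum>M\<in>?C. x (Suc n) * ?w M)"
    by (subst sum.reindex) (auto simp: inj_on_def)
  finally show ?thesis by (simp add: hsym_def sum_distrib_left)
qed

lemma hsym_int_Suc: "hsym_int (Suc n) x k = hsym_int n x k + x (Suc n) * hsym_int (Suc n) x (k - 1)"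
proof -
  consider "k < 0" | "k = 0" | m where "k = int (Suc m)"
    by (cases k rule: int_cases) (auto, metis gr0_conv_Suc of_nat_Suc neq0_conv)
  then show ?thesis by cases (auto simp: hsym_int_def hsym_Suc nat_add_distrib simp del: of_nat_Suc, auto simp: hsym_Suc Suc_nat_eq_nat_zadd1 hsym_int_def)
qed

text \<open>Iteration of \<open>hsym_int_Suc\<close> telescopes. With \<open>g\<close> one more than
  the gap between consecutive row lengths, the sum runs over exactly the lengths that a row may keep
  when a horizontal strip is removed.\<close>

lemma hsym_int_diff: "hsym_int (Suc n) x k - x (Suc n) ^ g * hsym_int (Suc n) x (k - int g) = (\<Sum>s<g. x (Suc n) ^ s * hsym_int n x (k - int s))"
proof (induction g)
  case (Suc g)
  have "hsym_int (Suc n) x (k - int g) = hsym_int n x (k - int g) + x (Suc n) * hsym_int (Suc n) x (k - int (Suc g))"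
    using hsym_int_Suc[of n x "k - int g"] by (simp add: algebra_simps)
  then show ?case using Suc by (simp add: algebra_simps)
qed simp

lemma esym_0_right [simp]: "esym n x 0 = 1"
proof -
  have "{S. S \<subseteq> {1..n} \<and> card S = 0} = {{}}" by (auto simp: card_eq_0_iff finite_subset)
  then show ?thesis by (simp add: esym_def)
qed

lemma esym_0_left: "esym 0 x k = (if k = 0 then 1 else 0)"
proof (cases "k = 0")
  case False
  then have "{S. S \<subseteq> {1..0::nat} \<and> card S = k} = {}" by auto
  then show ?thesis using False unfolding esym_def by (simp only: sum.empty if_False)
qed simp

text \<open>The last factor has only the first \<open>n\<close> variables, since
  \<open>Suc n\<close> cannot be chosen twice, whereas \<open>hsym_Suc\<close> keeps all of them.
  This is why the two determinants branch differently.\<close>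

lemma esym_Suc: "esym (Suc n) x (Suc k) = esym n x (Suc k) + x (Suc n) * esym n x k"
proof -
  let ?A = "{S. S \<subseteq> {1..Suc n} \<and> card S = Suc k}"
  let ?B = "{S. S \<subseteq> {1..n} \<and> card S = Suc k}"
  let ?C = "{S. S \<subseteq> {1..n} \<and> card S = k}"
  let ?w = "\<lambda>S. \<Prod>i\<in>S. x i"
  have fin: "finite S" if "S \<subseteq> {1..n}" for S :: "nat set" using that finite_subset by blast
  have nin: "Suc n \<notin> S" if "S \<subseteq> {1..n}" for S :: "nat set" using that by auto
  have "?A = ?B \<union> insert (Suc n) ` ?C"
  proof (intro equalityI subsetI)
    fix S assume S: "S \<in> ?A"
    show "S \<in> ?B \<union> insert (Suc n) ` ?C"
    proof (cases "Suc n \<in> S")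
      case True
      have "S - {Suc n} \<in> ?C" using S True finite_subset[of S "{1..Suc n}"]
        by (auto simp: card_Diff_singleton subset_iff le_Suc_eq)
      moreover have "S = insert (Suc n) (S - {Suc n})" using True by auto
      ultimately show ?thesis by blast
    next
      case False
      then show ?thesis using S by (auto simp: subset_iff le_Suc_eq)
    qed
  next
    fix S assume "S \<in> ?B \<union> insert (Suc n) ` ?C"
    then show "S \<in> ?A"
    proof
      assume "S \<in> insert (Suc n) ` ?C"
      then obtain T where T: "T \<subseteq> {1..n}" "card T = k" "S = insert (Suc n) T" by auto
      then show ?thesis using fin[OF T(1)] nin[OF T(1)] by auto
    qed auto
  qed
  moreover have "?B \<inter> insert (Suc n) ` ?C = {}" using nin by auto
  moreover have "finite ?B" "finite ?C" by (auto intro: finite_subset[of _ "Pow {1..n}"])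
  ultimately have "sum ?w ?A = sum ?w ?B + sum ?w (insert (Suc n) ` ?C)"
    by (simp add: sum.union_disjoint)
  also have "sum ?w (insert (Suc n) ` ?C) = (\<Sum>S\<in>?C. ?w (insert (Suc n) S))"
    using nin by (subst sum.reindex) (auto simp: inj_on_def, (metis insert_ident)+)
  also have "\<dots> = (\<Sum>S\<in>?C. x (Suc n) * ?w S)"
    using nin fin by (intro sum.cong) auto
  finally show ?thesis by (simp add: esym_def sum_distrib_left)
qed

lemma esym_int_Suc: "esym_int (Suc n) x k = esym_int n x k + x (Suc n) * esym_int n x (k - 1)"
proof -
  consider "k < 0" | "k = 0" | m where "k = int (Suc m)"
    by (cases k rule: int_cases) (auto, metis gr0_conv_Suc of_nat_Suc neq0_conv)
  then show ?thesis by cases (auto simp: esym_int_def esym_Suc nat_add_distrib simp del: of_nat_Suc, auto simp: esym_Suc Suc_nat_eq_nat_zadd1 esym_int_def)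
qed

text \<open>The base case of both Jacobi-Trudi identities: without variables, complete and
  elementary functions are the indicator of degree 0. The matrix is then the identity for the empty
  shape, and has a zero first row otherwise.\<close>

lemma fdet_delta_shift:
  assumes D: "ydiag D" and a: "\<And>i. i \<ge> N \<Longrightarrow> a i = (0::nat)" 
    and emp: "D = {} \<longleftrightarrow> a 0 = 0" and anti: "\<And>i j. i \<le> j \<Longrightarrow> a j \<le> a i"
    and f: "\<And>k. f k = (if k = (0::int) then 1 else (0::'a::comm_ring_1))"
  shows "fdet {..<N} (\<lambda>i j. f (int (a i) + int j - int i)) = (if D = {} then 1 else 0)"
proof (cases "D = {}")
  case True
  then have "a i = 0" for i using emp anti[of 0 i] by simp
  then have "fdet {..<N} (\<lambda>i j. f (int (a i) + int j - int i)) = fdet {..<N} (\<lambda>i j. if i = j then 1 else 0)"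
    by (intro fdet_cong) (auto simp: f)
  then show ?thesis using True by (simp add: fdet_one)
next
  case False
  then have pos: "a 0 > 0" using emp by simp
  then have "N > 0" using a[of 0] by (cases N) auto
  then have "fdet {..<N} (\<lambda>i j. f (int (a i) + int j - int i)) = 0"
    using pos by (intro fdet_zero_row[of _ 0]) (auto simp: f)
  then show ?thesis using False by simp
qed

lemma strips_row_len:
  assumes "D' \<in> strips D" "ydiag D"
  shows "row_len D (Suc i) \<le> row_len D' i" "row_len D' i \<le> row_len D i"
proof -
  have y: "ydiag D'" "D' \<subseteq> D" using assms by (auto simp: strips_def)
  show "row_len D' i \<le> row_len D i" using y(2) mem_iff_row_len[OF y(1)] mem_iff_row_len[OF assms(2)] 
    by (metis not_less_iff_gr_or_eq not_le subsetD)
  show "row_len D (Suc i) \<le> row_len D' i"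
  proof (rule ccontr)
    assume "\<not> row_len D (Suc i) \<le> row_len D' i"
    then have "(Suc i, row_len D' i) \<in> D" "(i, row_len D' i) \<notin> D'" using mem_iff_row_len[OF assms(2)] mem_iff_row_len[OF y(1)] by auto
    moreover then have "(i, row_len D' i) \<in> D" using ydiagD[OF assms(2)] by (meson le_SucI le_refl)
    ultimately show False using assms(1) by (auto simp: strips_def)
  qed
qed

lemma strips_col_len:
  assumes "D' \<in> strips D" "ydiag D"
  shows "col_len D i \<le> Suc (col_len D' i)" "col_len D' i \<le> col_len D i"
proof -
  have y: "ydiag D'" "D' \<subseteq> D" using assms by (auto simp: strips_def)
  show "col_len D' i \<le> col_len D i" using y(2) mem_iff_col_len[OF y(1)] mem_iff_col_len[OF assms(2)] 
    by (metis not_less_iff_gr_or_eq not_le subsetD)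
  show "col_len D i \<le> Suc (col_len D' i)"
  proof (rule ccontr)
    assume "\<not> col_len D i \<le> Suc (col_len D' i)"
    then have "(Suc (col_len D' i), i) \<in> D" "(col_len D' i, i) \<notin> D'" "(col_len D' i, i) \<in> D"
      using mem_iff_col_len[OF assms(2)] mem_iff_col_len[OF y(1)] by auto
    then show False using assms(1) by (auto simp: strips_def)
  qed
qed

lemma card_diff_strips:
  assumes "D' \<in> strips D" "ydiag D" 
  shows "card (D - D') = card D - card D'"
  using assms by (intro card_Diff_subset) (auto simp: strips_def ydiag_finite)

text \<open>Removing a horizontal strip means choosing the new row lengths independently, each
  between two consecutive old ones. The product form is what the multilinear expansion of a
  determinant yields.\<close>

lemma bij_betw_strips_row_len:
  assumes D: "ydiag D" and N: "\<And>r. r \<ge> N \<Longrightarrow> row_len D r = 0"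
  shows "bij_betw (\<lambda>D'. restrict (row_len D') {..<N}) (strips D) (PiE {..<N} (\<lambda>i. {row_len D (Suc i)..row_len D i}))"
proof (rule bij_betw_byWitness[where f' = "\<lambda>\<nu>. {(r, c). r < N \<and> c < \<nu> r}"])
  have N': "\<And>r. r \<ge> N \<Longrightarrow> row_len D' r = 0" if "D' \<in> strips D" for D'
    using strips_row_len(2)[OF that D] N by (metis le_zero_eq)
  show "\<forall>D'\<in>strips D. {(r, c). r < N \<and> c < restrict (row_len D') {..<N} r} = D'"
  proof
    fix D' assume D': "D' \<in> strips D"
    then have "D' = {(r, c). r < N \<and> c < row_len D' r}"
      by (intro ydiag_eq_rows N') (auto simp: strips_def)
    moreover have "{(r, c). r < N \<and> c < restrict (row_len D') {..<N} r} = {(r, c). r < N \<and> c < row_len D' r}" by auto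
    ultimately show "{(r, c). r < N \<and> c < restrict (row_len D') {..<N} r} = D'" by (rule trans[OF _ sym, rotated])
  qed
  show "\<forall>\<nu>\<in>PiE {..<N} (\<lambda>i. {row_len D (Suc i)..row_len D i}). restrict (row_len {(r, c). r < N \<and> c < \<nu> r}) {..<N} = \<nu>"
    by (auto simp: row_len_rows fun_eq_iff PiE_iff extensional_def)
  show "(\<lambda>D'. restrict (row_len D') {..<N}) ` strips D \<subseteq> PiE {..<N} (\<lambda>i. {row_len D (Suc i)..row_len D i})"
    using strips_row_len[OF _ D] by (intro image_subsetI) simp
  show "(\<lambda>\<nu>. {(r, c). r < N \<and> c < \<nu> r}) ` PiE {..<N} (\<lambda>i. {row_len D (Suc i)..row_len D i}) \<subseteq> strips D"
  proof safe
    fix \<nu> assume \<nu>: "\<nu> \<in> PiE {..<N} (\<lambda>i. {row_len D (Suc i)..row_len D i})"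
    then have b: "row_len D (Suc i) \<le> \<nu> i" "\<nu> i \<le> row_len D i" if "i < N" for i using that by (auto simp: PiE_iff)
    show "{(r, c). r < N \<and> c < \<nu> r} \<in> strips D"
      unfolding strips_def
    proof (intro CollectI conjI allI impI)
      show "{(r, c). r < N \<and> c < \<nu> r} \<subseteq> D" using b by (force simp: mem_iff_row_len[OF D])
      show "ydiag {(r, c). r < N \<and> c < \<nu> r}"
      proof (rule ydiag_rows)
        fix i j assume ij: "i \<le> j" "j < N"
        show "\<nu> j \<le> \<nu> i"
        proof (cases "i = j")
          case False
          then have "\<nu> j \<le> row_len D j" "row_len D j \<le> row_len D (Suc i)" "row_len D (Suc i) \<le> \<nu> i"
            using ij b row_len_antimono[OF D] by auto
          then show ?thesis by linarith
        qed simp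
      qed
      fix r c assume a: "(r, c) \<in> D - {(r, c). r < N \<and> c < \<nu> r}"
      then have "c < row_len D r" by (auto simp: mem_iff_row_len[OF D])
      then have "r < N" using N[of r] by (metis not_le not_less_zero)
      then have "\<nu> r \<le> c" using a by auto
      then show "(Suc r, c) \<notin> D" using b(1)[OF \<open>r < N\<close>] by (auto simp: mem_iff_row_len[OF D])
    qed
  qed
qed

text \<open>Induction on the number of variables. A row operation truncates each entry to a sum over
  the interlacing interval of its row, and multilinearity then reproduces the branching
  rule.\<close>

theorem jacobi_trudi_h:
  fixes x :: "nat \<Rightarrow> 'a :: comm_ring_1"
  assumes "ydiag D" "\<And>r. r \<ge> N \<Longrightarrow> row_len D r = 0"
  shows "schur_diag n D x = fdet {..<N} (\<lambda>i j. hsym_int n x (int (row_len D i) + int j - int i))"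
  using assms
proof (induction n arbitrary: D)
  case 0
  have "D = {} \<longleftrightarrow> row_len D 0 = 0"
    using mem_iff_row_len[OF 0(1), of 0 0] ydiagD[OF 0(1), of _ _ 0 0] by auto
  then show ?case using 0
    by (subst fdet_delta_shift[of D]) (auto simp: schur_diag_0 row_len_antimono hsym_int_def hsym_0_left)
next
  case (Suc n)
  note D = Suc.prems(1) and N = Suc.prems(2)
  let ?x = "x (Suc n)"
  let ?B = "\<lambda>i. {row_len D (Suc i)..row_len D i}"
  let ?R = "\<lambda>i j. hsym_int (Suc n) x (int (row_len D i) + int j - int i)"
  \<comment> \<open>The exponent is the drop in degree from row \<open>i\<close> to row
    \<open>Suc i\<close> within one column, which is the gap of the row lengths plus one.\<close>
  let ?c = "\<lambda>i. ?x ^ (Suc (row_len D i) - row_len D (Suc i))"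
  have row: "?R i j - ?c i * ?R (Suc i) j =
      (\<Sum>\<nu>\<in>?B i. ?x ^ (row_len D i - \<nu>) * hsym_int n x (int \<nu> + int j - int i))" for i j
  proof -
    let ?g = "Suc (row_len D i) - row_len D (Suc i)"
    have le: "row_len D (Suc i) \<le> row_len D i" using row_len_antimono[OF D] by simp
    have e: "int (row_len D (Suc i)) + int j - int (Suc i) = (int (row_len D i) + int j - int i) - int ?g"
      using le by (simp add: of_nat_diff)
    have "?R i j - ?c i * ?R (Suc i) j = (\<Sum>s<?g. ?x ^ s * hsym_int n x (int (row_len D i) + int j - int i - int s))"
      unfolding e by (rule hsym_int_diff)
    also have "\<dots> = (\<Sum>\<nu>\<in>?B i. ?x ^ (row_len D i - \<nu>) * hsym_int n x (int \<nu> + int j - int i))"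
    proof (rule sum.reindex_bij_witness[of _ "\<lambda>\<nu>. row_len D i - \<nu>" "\<lambda>s. row_len D i - s"])
      fix s assume "s \<in> {..<?g}"
      then have s: "s \<le> row_len D i" by auto
      then have e: "int (row_len D i - s) + int j - int i = int (row_len D i) + int j - int i - int s" by (simp add: of_nat_diff)
      show "?x ^ (row_len D i - (row_len D i - s)) * hsym_int n x (int (row_len D i - s) + int j - int i) =
          ?x ^ s * hsym_int n x (int (row_len D i) + int j - int i - int s)" unfolding e using s by simp
    qed (use le in auto)
    finally show ?thesis .
  qed
  have "fdet {..<N} ?R = fdet {..<N} (\<lambda>i j. ?R i j - ?c i * ?R (Suc i) j)"
    by (rule fdet_row_op[symmetric]) (simp add: N hsym_int_def)
  also have "\<dots> = fdet {..<N} (\<lambda>i j. \<Sum>\<nu>\<in>?B i. ?x ^ (row_len D i - \<nu>) * hsym_int n x (int \<nu> + int j - int i))"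
    by (simp only: row)
  also have "\<dots> = (\<Sum>\<nu>\<in>PiE {..<N} ?B. (\<Prod>i<N. ?x ^ (row_len D i - \<nu> i)) * fdet {..<N} (\<lambda>i j. hsym_int n x (int (\<nu> i) + int j - int i)))"
    by (rule fdet_sum_rows) auto
  also have "\<dots> = (\<Sum>D'\<in>strips D. (\<Prod>i<N. ?x ^ (row_len D i - restrict (row_len D') {..<N} i)) *
      fdet {..<N} (\<lambda>i j. hsym_int n x (int (restrict (row_len D') {..<N} i) + int j - int i)))"
    by (rule sum.reindex_bij_betw[OF bij_betw_strips_row_len[OF D N], symmetric])
  also have "\<dots> = (\<Sum>D'\<in>strips D. ?x ^ card (D - D') * schur_diag n D' x)"
  proof (rule sum.cong[OF refl])
    fix D' assume D': "D' \<in> strips D"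
    then have y: "ydiag D'" by (simp add: strips_def)
    have N': "row_len D' r = 0" if "r \<ge> N" for r
      using strips_row_len(2)[OF D' D, of r] N[OF that] by simp
    have "(\<Prod>i<N. ?x ^ (row_len D i - restrict (row_len D') {..<N} i)) = ?x ^ (\<Sum>i<N. row_len D i - row_len D' i)"
      by (simp add: power_sum)
    also have "(\<Sum>i<N. row_len D i - row_len D' i) = card (D - D')"
      using strips_row_len(2)[OF D' D]
      by (simp add: card_diff_strips[OF D' D] card_eq_sum_row_len[OF D N] card_eq_sum_row_len[OF y N'] sum_subtractf_nat)
    finally have 1: "(\<Prod>i<N. ?x ^ (row_len D i - restrict (row_len D') {..<N} i)) = ?x ^ card (D - D')" .
    have "fdet {..<N} (\<lambda>i j. hsym_int n x (int (restrict (row_len D') {..<N} i) + int j - int i)) = 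
        fdet {..<N} (\<lambda>i j. hsym_int n x (int (row_len D' i) + int j - int i))" by (rule fdet_cong) simp
    also have "\<dots> = schur_diag n D' x" by (rule Suc.IH[OF y N', symmetric])
    finally have 2: "fdet {..<N} (\<lambda>i j. hsym_int n x (int (restrict (row_len D') {..<N} i) + int j - int i)) = schur_diag n D' x" .
    show "(\<Prod>i<N. ?x ^ (row_len D i - restrict (row_len D') {..<N} i)) *
        fdet {..<N} (\<lambda>i j. hsym_int n x (int (restrict (row_len D') {..<N} i) + int j - int i)) = ?x ^ card (D - D') * schur_diag n D' x"
      by (simp only: 1 2)
  qed
  also have "\<dots> = schur_diag (Suc n) D x" by (rule schur_diag_branching[OF D, symmetric])
  finally show ?case ..
qed


text \<open>Each column loses 0 or 1 cells, but unlike row lengths these choices are linked: the new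
  column lengths must again decrease. The \<open>if\<close> is there because \<open>\<beta>\<close>
  is \<open>undefined\<close> at \<open>N\<close>; in the last column the condition only forbids
  taking a cell from an empty column.\<close>

lemma bij_betw_strips_col_len:
  assumes D: "ydiag D" and N: "\<And>c. c \<ge> N \<Longrightarrow> col_len D c = 0"
  shows "bij_betw (\<lambda>D'. restrict (\<lambda>c. col_len D c - col_len D' c) {..<N}) (strips D)
    {\<beta> \<in> {..<N} \<rightarrow>\<^sub>E {0, 1}. \<forall>i<N. col_len D (Suc i) - (if Suc i < N then \<beta> (Suc i) else 0) + \<beta> i \<le> col_len D i}"
    (is "bij_betw ?f _ ?V")
proof (rule bij_betw_byWitness[where f' = "\<lambda>\<beta>. {(r, c). c < N \<and> r < col_len D c - \<beta> c}"])
  have N': "\<And>r. r \<ge> N \<Longrightarrow> col_len D' r = 0" if "D' \<in> strips D" for D'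
    using strips_col_len(2)[OF that D] N by (metis le_zero_eq)
  show "\<forall>D'\<in>strips D. {(r, c). c < N \<and> r < col_len D c - ?f D' c} = D'"
  proof
    fix D' assume D': "D' \<in> strips D"
    then have "D' = {(r, c). c < N \<and> r < col_len D' c}"
      by (intro ydiag_eq_cols N') (auto simp: strips_def)
    moreover have "{(r, c). c < N \<and> r < col_len D c - ?f D' c} = {(r, c). c < N \<and> r < col_len D' c}"
      using strips_col_len(2)[OF D' D] by auto
    ultimately show "{(r, c). c < N \<and> r < col_len D c - ?f D' c} = D'" by (rule trans[OF _ sym, rotated])
  qed
  show "\<forall>\<beta>\<in>?V. ?f {(r, c). c < N \<and> r < col_len D c - \<beta> c} = \<beta>"
  proof
    fix \<beta> assume \<beta>: "\<beta> \<in> ?V"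
    show "?f {(r, c). c < N \<and> r < col_len D c - \<beta> c} = \<beta>"
    proof
      fix i
      show "?f {(r, c). c < N \<and> r < col_len D c - \<beta> c} i = \<beta> i"
      proof (cases "i < N")
        case True
        then have "col_len D (Suc i) - (if Suc i < N then \<beta> (Suc i) else 0) + \<beta> i \<le> col_len D i" using \<beta> by blast
        then have "\<beta> i \<le> col_len D i" by linarith
        then show ?thesis using True by (simp add: col_len_cols)
      next
        case False
        have "\<beta> \<in> {..<N} \<rightarrow>\<^sub>E {0, 1}" using \<beta> by blast
        moreover have "i \<notin> {..<N}" using False by simp
        ultimately have "\<beta> i = undefined" by (rule PiE_arb)
        then show ?thesis using False by simp
      qed
    qed
  qed
  show "?f ` strips D \<subseteq> ?V"
  proof (intro image_subsetI CollectI conjI allI impI)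
    fix D' assume D': "D' \<in> strips D"
    note c = strips_col_len[OF D' D]
    have y: "ydiag D'" using D' by (simp add: strips_def)
    have "col_len D i - col_len D' i = 0 \<or> col_len D i - col_len D' i = 1" for i using c[of i] by linarith
    then show "?f D' \<in> {..<N} \<rightarrow>\<^sub>E {0, 1}" by simp
    fix i assume "i < N"
    then show "col_len D (Suc i) - (if Suc i < N then ?f D' (Suc i) else 0) + ?f D' i \<le> col_len D i"
      using c[of i] c[of "Suc i"] col_len_antimono[OF y, of i "Suc i"] N[of "Suc i"] by (auto simp: restrict_def)
  qed
  show "(\<lambda>\<beta>. {(r, c). c < N \<and> r < col_len D c - \<beta> c}) ` ?V \<subseteq> strips D"
  proof (rule image_subsetI)
    fix \<beta> assume \<beta>: "\<beta> \<in> ?V"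
    let ?D' = "{(r, c). c < N \<and> r < col_len D c - \<beta> c}"
    have "\<beta> \<in> {..<N} \<rightarrow>\<^sub>E {0, 1}" using \<beta> by blast
    then have "\<beta> i \<in> {0, 1}" if "i < N" for i by (rule PiE_mem) (simp add: that)
    then have b: "\<beta> i \<le> 1" if "i < N" for i using that by fastforce
    have st: "col_len D (Suc i) - \<beta> (Suc i) \<le> col_len D i - \<beta> i" if "Suc i < N" for i
    proof -
      have "col_len D (Suc i) - (if Suc i < N then \<beta> (Suc i) else 0) + \<beta> i \<le> col_len D i"
        using \<beta> Suc_lessD[OF that] by blast
      then show ?thesis using that by simp
    qed
    show "?D' \<in> strips D"
      unfolding strips_def
    proof (intro CollectI conjI allI impI)
      show "?D' \<subseteq> D" by (auto simp: mem_iff_col_len[OF D])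
      show "ydiag ?D'"
      proof (rule ydiag_cols)
        fix i j :: nat assume "i \<le> j" "j < N"
        then show "col_len D j - \<beta> j \<le> col_len D i - \<beta> i"
        proof (induction rule: dec_induct)
          case (step k)
          then show ?case using st[of k] by simp
        qed simp
      qed
      fix r c assume a: "(r, c) \<in> D - ?D'"
      then have "r < col_len D c" by (auto simp: mem_iff_col_len[OF D])
      then have "c < N" using N[of c] by (metis not_le not_less_zero)
      then have "col_len D c \<le> Suc r" using a b[of c] by auto
      then show "(Suc r, c) \<notin> D" by (auto simp: mem_iff_col_len[OF D])
    qed
  qed
qed

text \<open>The recursion splits every entry into just two terms, so multilinearity applies
  directly. The choices that are not horizontal strips cancel individually, through two equal rows
  or a zero row.\<close>

theorem jacobi_trudi_e:
  fixes x :: "nat \<Rightarrow> 'a :: comm_ring_1"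
  assumes "ydiag D" "\<And>c. c \<ge> N \<Longrightarrow> col_len D c = 0"
  shows "schur_diag n D x = fdet {..<N} (\<lambda>i j. esym_int n x (int (col_len D i) + int j - int i))"
  using assms
proof (induction n arbitrary: D)
  case 0
  have "D = {} \<longleftrightarrow> col_len D 0 = 0"
    using mem_iff_col_len[OF 0(1), of 0 0] ydiagD[OF 0(1), of _ _ 0 0] by auto
  then show ?case using 0
    by (subst fdet_delta_shift[of D]) (auto simp: schur_diag_0 col_len_antimono esym_int_def esym_0_left)
next
  case (Suc n)
  note D = Suc.prems(1) and N = Suc.prems(2)
  let ?x = "x (Suc n)"
  let ?V = "{\<beta> \<in> {..<N} \<rightarrow>\<^sub>E {0, 1}. \<forall>i<N. col_len D (Suc i) - (if Suc i < N then \<beta> (Suc i) else 0) + \<beta> i \<le> col_len D i}"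
  let ?d = "\<lambda>\<beta>. fdet {..<N} (\<lambda>i j. esym_int n x (int (col_len D i) - int (\<beta> i) + int j - int i))"
  let ?g = "\<lambda>\<beta>. (\<Prod>i<N. ?x ^ \<beta> i) * ?d \<beta>"
  have "fdet {..<N} (\<lambda>i j. esym_int (Suc n) x (int (col_len D i) + int j - int i)) =
      fdet {..<N} (\<lambda>i j. \<Sum>b\<in>{0, 1}. ?x ^ b * esym_int n x (int (col_len D i) - int b + int j - int i))"
    by (rule fdet_cong) (simp add: esym_int_Suc algebra_simps)
  also have "\<dots> = (\<Sum>\<beta>\<in>{..<N} \<rightarrow>\<^sub>E {0, 1}. ?g \<beta>)"
    by (rule fdet_sum_rows) auto
  also have "\<dots> = sum ?g ?V"
  proof (rule sum.mono_neutral_right)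
    show "finite ({..<N} \<rightarrow>\<^sub>E {0, 1::nat})" by (intro finite_PiE) auto
    show "\<forall>\<beta>\<in>({..<N} \<rightarrow>\<^sub>E {0, 1}) - ?V. ?g \<beta> = 0"
    proof
      fix \<beta> assume \<beta>: "\<beta> \<in> ({..<N} \<rightarrow>\<^sub>E {0, 1}) - ?V"
      have "\<beta> \<in> {..<N} \<rightarrow>\<^sub>E {0, 1}" using \<beta> by blast
      then have "\<beta> i \<in> {0, 1}" if "i < N" for i by (rule PiE_mem) (simp add: that)
    then have b: "\<beta> i \<le> 1" if "i < N" for i using that by fastforce
      \<comment> \<open>Taking the last violation guarantees that the condition holds one column
        further on, so the subtraction there is not truncated. The violation is then by exactly one,
        which makes the rows \<open>i\<close> and \<open>Suc i\<close> equal.\<close>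
      let ?bad = "\<lambda>i. i < N \<and> col_len D (Suc i) - (if Suc i < N then \<beta> (Suc i) else 0) + \<beta> i > col_len D i"
      have "\<not> (\<forall>i<N. col_len D (Suc i) - (if Suc i < N then \<beta> (Suc i) else 0) + \<beta> i \<le> col_len D i)"
        using \<beta> by blast
      then have "{i. ?bad i} \<noteq> {}" by (auto simp: not_le)
      then have "Max {i. ?bad i} \<in> {i. ?bad i}" by (intro Max_in) auto
      then obtain i where i: "?bad i" and i_eq: "i = Max {i. ?bad i}" by blast
      have "\<not> ?bad (Suc i)"
      proof
        assume "?bad (Suc i)"
        then have "Suc i \<in> {i. ?bad i}" by blast
        then have "Suc i \<le> Max {i. ?bad i}" by (intro Max_ge) auto
        then show False using i_eq by linarith
      qed
      then have nb: "\<beta> (Suc i) \<le> col_len D (Suc i)" if "Suc i < N" using that by linarith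
      have "?d \<beta> = 0"
      proof (cases "Suc i < N")
        case True
        have "col_len D (Suc i) \<le> col_len D i" using col_len_antimono[OF D] by simp
        then have "int (col_len D i) - int (\<beta> i) + 1 = int (col_len D (Suc i)) - int (\<beta> (Suc i))"
          using i True b[of i] b[of "Suc i"] nb by (simp split: nat_diff_split_asm)
        then have "int (col_len D i) - int (\<beta> i) + int j - int i =
            int (col_len D (Suc i)) - int (\<beta> (Suc i)) + int j - int (Suc i)" for j by simp
        note r = arg_cong[OF this, of "esym_int n x"]
        show ?thesis
          by (rule fdet_equal_rows[of _ i "Suc i"]) (use True in simp, use True in simp, use True in simp, simp, rule r)
      next
        case False
        then have "col_len D (Suc i) = 0" "N = Suc i" using N i by auto
        then have "col_len D i = 0" "\<beta> i = 1" using i b[of i] by auto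
        then show ?thesis using \<open>N = Suc i\<close> by (intro fdet_zero_row[of _ i]) (auto simp: esym_int_def)
      qed
      then show "?g \<beta> = 0" by simp
    qed
  qed auto
  also have "\<dots> = (\<Sum>D'\<in>strips D. ?g (restrict (\<lambda>c. col_len D c - col_len D' c) {..<N}))"
    by (rule sum.reindex_bij_betw[OF bij_betw_strips_col_len[OF D N], symmetric])
  also have "\<dots> = (\<Sum>D'\<in>strips D. ?x ^ card (D - D') * schur_diag n D' x)"
  proof (rule sum.cong[OF refl])
    fix D' assume D': "D' \<in> strips D"
    then have y: "ydiag D'" by (simp add: strips_def)
    note c = strips_col_len[OF D' D]
    have N': "col_len D' r = 0" if "r \<ge> N" for r
      using c(2)[of r] N[OF that] by simp
    let ?b = "restrict (\<lambda>c. col_len D c - col_len D' c) {..<N}"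
    have "(\<Prod>i<N. ?x ^ ?b i) = ?x ^ (\<Sum>i<N. col_len D i - col_len D' i)"
      by (simp add: power_sum)
    also have "(\<Sum>i<N. col_len D i - col_len D' i) = card (D - D')"
      using c(2)
      by (simp add: card_diff_strips[OF D' D] card_eq_sum_col_len[OF D N] card_eq_sum_col_len[OF y N'] sum_subtractf_nat)
    finally have 1: "(\<Prod>i<N. ?x ^ ?b i) = ?x ^ card (D - D')" .
    have "?d ?b = fdet {..<N} (\<lambda>i j. esym_int n x (int (col_len D' i) + int j - int i))"
      using c(2) by (intro fdet_cong) (simp add: of_nat_diff)
    also have "\<dots> = schur_diag n D' x" by (rule Suc.IH[OF y N', symmetric])
    finally have 2: "?d ?b = schur_diag n D' x" .
    show "?g ?b = ?x ^ card (D - D') * schur_diag n D' x"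
      by (simp only: 1 2)
  qed
  also have "\<dots> = schur_diag (Suc n) D x" by (rule schur_diag_branching[OF D, symmetric])
  finally show ?case ..
qed

lemma esym_permute:
  assumes "\<pi> permutes {1..n}"
  shows "esym n (\<lambda>i. x (\<pi> i)) k = esym n x k"
proof -
  let ?A = "{S. S \<subseteq> {1..n} \<and> card S = k}"
  have inj: "inj_on \<pi> S" for S using assms permutes_inj by (metis inj_on_subset subset_UNIV)
  have "bij_betw (image \<pi>) ?A ?A"
  proof (rule bij_betw_byWitness[where f' = "image (inv_into UNIV \<pi>)"])
    have inv: "inv_into UNIV \<pi> permutes {1..n}" using assms by (rule permutes_inv)
    show "\<forall>S\<in>?A. inv_into UNIV \<pi> ` \<pi> ` S = S" "\<forall>S\<in>?A. \<pi> ` inv_into UNIV \<pi> ` S = S"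
      using permutes_inv_o[OF assms] by (auto simp: image_comp)
    show "image \<pi> ` ?A \<subseteq> ?A" using inj permutes_in_image[OF assms]
      by (auto simp: card_image permutes_in_image subset_iff)
    show "image (inv_into UNIV \<pi>) ` ?A \<subseteq> ?A" using permutes_inj_on[OF inv] permutes_in_image[OF inv]
      by (auto simp: card_image subset_iff)
  qed
  then have "esym n x k = (\<Sum>S\<in>?A. \<Prod>i\<in>\<pi> ` S. x i)"
    unfolding esym_def by (rule sum.reindex_bij_betw[symmetric])
  also have "\<dots> = esym n (\<lambda>i. x (\<pi> i)) k"
    unfolding esym_def using inj by (intro sum.cong refl) (simp add: prod.reindex)
  finally show ?thesis ..
qed

text \<open>Symmetry is inherited from the elementary symmetric functions in the dual Jacobi-Trudi
  determinant; this replaces the Bender-Knuth involution.\<close>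

lemma schur_diag_permute:
  fixes x :: "nat \<Rightarrow> 'a :: comm_ring_1"
  assumes D: "ydiag D" and "\<pi> permutes {1..n}"
  shows "schur_diag n D (\<lambda>i. x (\<pi> i)) = schur_diag n D x"
proof -
  obtain N where N: "D \<subseteq> UNIV \<times> {..<N}"
  proof -
    have "finite (snd ` D)" using D by (simp add: ydiag_def)
    then obtain N where "snd ` D \<subseteq> {..<N}" by (metis finite_nat_set_iff_bounded lessThan_iff subsetI)
    then show ?thesis by (intro that[of N]) force
  qed
  have "col_len D c = 0" if "c \<ge> N" for c using N that mem_iff_col_len[OF D, of 0 c] by auto
  note jt = jacobi_trudi_e[OF D this, where n = n]
  have "esym_int n (\<lambda>i. x (\<pi> i)) k = esym_int n x k" for k
    by (simp add: esym_int_def esym_permute[OF assms(2)])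
  then show ?thesis by (simp add: jt)
qed

section \<open>Exterior powers\<close>

lemma fdet_transpose:
  assumes "finite I"
  shows "fdet I (\<lambda>i j. M j i) = fdet I M"
proof -
  have perm: "permutation p" if "p permutes I" for p
    using that \<open>finite I\<close> permutation_permutes by blast
  have "fdet I M = (\<Sum>p | p permutes I. of_int (sign (inv_into UNIV p)) * (\<Prod>i\<in>I. M i (inv_into UNIV p i)))"
    unfolding fdet_def by (rule sum_permutations_inverse)
  also have "\<dots> = (\<Sum>p | p permutes I. of_int (sign p) * (\<Prod>i\<in>I. M (p i) i))"
  proof (rule sum.cong[OF refl])
    fix p assume "p \<in> {p. p permutes I}"
    then have p: "p permutes I" by simp
    have "(\<Prod>i\<in>I. M i (inv_into UNIV p i)) = (\<Prod>i\<in>I. M (p i) (inv_into UNIV p (p i)))"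
      using prod.permute[OF p, of "\<lambda>i. M i (inv_into UNIV p i)"] by (simp add: o_def)
    then show "of_int (sign (inv_into UNIV p)) * (\<Prod>i\<in>I. M i (inv_into UNIV p i)) = of_int (sign p) * (\<Prod>i\<in>I. M (p i) i)"
      using permutes_inverses(2)[OF p] by (simp add: sign_inverse[OF perm[OF p]])
  qed
  finally show ?thesis by (simp add: fdet_def)
qed

lemma fdet_row_linear:
  assumes "finite I" "l \<in> I"
  shows "(\<Sum>b\<in>B. c b * fdet I (\<lambda>i j. if i = l then R b j else M i j)) =
    fdet I (\<lambda>i j. if i = l then \<Sum>b\<in>B. c b * R b j else M i j)"
proof -
  have pr: "(\<Prod>i\<in>I. if i = l then f (p i) else M i (p i)) = f (p l) * (\<Prod>i\<in>I-{l}. M i (p i))" for f p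
  proof -
    have "(\<Prod>i\<in>I. if i = l then f (p i) else M i (p i)) = 
        (if l = l then f (p l) else M l (p l)) * (\<Prod>i\<in>I-{l}. if i = l then f (p i) else M i (p i))"
      using assms by (rule prod.remove)
    also have "(\<Prod>i\<in>I-{l}. if i = l then f (p i) else M i (p i)) = (\<Prod>i\<in>I-{l}. M i (p i))"
      by (rule prod.cong) auto
    finally show ?thesis by simp
  qed
  show ?thesis
    unfolding fdet_def pr pr[of "\<lambda>j. \<Sum>b\<in>B. c b * R b j"] sum_distrib_left
    by (subst sum.swap) (simp add: sum_distrib_left sum_distrib_right mult_ac)
qed

text \<open>A permutation preserves the sum of \<open>w\<close> over \<open>I\<close>, whereas one
  other than the identity that met only nonzero entries would raise it. A weight is used in place of
  a linear order because different subsets can have the same element sum.\<close>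

lemma fdet_triangular:
  fixes w :: "'i \<Rightarrow> nat"
  assumes "finite I" and tri: "\<And>i j. i \<in> I \<Longrightarrow> j \<in> I \<Longrightarrow> i \<noteq> j \<Longrightarrow> M i j \<noteq> 0 \<Longrightarrow> w i < w j"
  shows "fdet I M = (\<Prod>i\<in>I. M i i)"
proof -
  have "fdet I M = (\<Sum>p\<in>{id}. of_int (sign p) * (\<Prod>i\<in>I. M i (p i)))"
    unfolding fdet_def
  proof (rule sum.mono_neutral_right)
    show "finite {p. p permutes I}" using assms(1) by (rule finite_permutations)
    show "{id} \<subseteq> {p. p permutes I}" by (simp add: permutes_id)
    show "\<forall>p\<in>{p. p permutes I} - {id}. of_int (sign p) * (\<Prod>i\<in>I. M i (p i)) = 0"
    proof
      fix p assume p: "p \<in> {p. p permutes I} - {id}"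
      then have pp: "p permutes I" by simp
      obtain i where "p i \<noteq> i" using p by (auto simp: fun_eq_iff)
      then have i: "i \<in> I" "i \<noteq> p i" using p by (auto dest: permutes_not_in)
      have "\<exists>i\<in>I. M i (p i) = 0"
      proof (rule ccontr)
        assume nz: "\<not> (\<exists>i\<in>I. M i (p i) = 0)"
        have "w i \<le> w (p i)" if "i \<in> I" for i
          using tri[of i "p i"] nz that permutes_in_image[OF pp] by (cases "i = p i") (auto simp: less_imp_le)
        moreover have "w i < w (p i)" using tri[of i "p i"] nz i permutes_in_image[OF pp] by auto
        ultimately have "sum w I < (\<Sum>i\<in>I. w (p i))" using assms(1) i(1) by (intro sum_strict_mono_ex1) auto
        also have "\<dots> = sum w I" using sum.permute[OF pp, of w] by (simp add: o_def)
        finally show False by simp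
      qed
      then show "of_int (sign p) * (\<Prod>i\<in>I. M i (p i)) = 0" using assms(1) by (simp add: prod_zero)
    qed
  qed
  then show ?thesis by simp
qed

section \<open>Wedge products of basis vectors and compound matrices\<close>

definition Sub :: "nat \<Rightarrow> 'x set \<Rightarrow> 'x set set" where
  "Sub j X = {S. S \<subseteq> X \<and> card S = j}"

lemma finite_Sub: "finite X \<Longrightarrow> finite (Sub j X)"
  unfolding Sub_def by (rule finite_subset[of _ "Pow X"]) auto

text \<open>The elements carry no order in general, so the enumeration is arbitrary. Another one
  changes basis vectors of the exterior power only by signs.\<close>

definition enum_set :: "'x set \<Rightarrow> nat \<Rightarrow> 'x" where
  "enum_set S = (SOME f. bij_betw f {..<card S} S)"

lemma bij_enum_set:
  assumes "finite X" "S \<in> Sub j X"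
  shows "bij_betw (enum_set S) {..<j} S"
proof -
  have "finite S" "card S = j" using assms finite_subset by (auto simp: Sub_def)
  then have "\<exists>f. bij_betw f {..<j} S" using ex_bij_betw_nat_finite[of S] by (auto simp: atLeast0LessThan)
  then show ?thesis unfolding enum_set_def \<open>card S = j\<close> by (rule someI_ex)
qed

text \<open>The coefficient of the basis vector of \<open>R\<close> in the wedge product of the
  basis vectors \<open>f 0\<close>, ..., \<open>f (j - 1)\<close>: a sign if \<open>f\<close> lists
  \<open>R\<close> without repetition, and 0 otherwise.\<close>

definition wedge_sign :: "nat \<Rightarrow> (nat \<Rightarrow> 'x) \<Rightarrow> 'x set \<Rightarrow> int" where
  "wedge_sign j f R = fdet {..<j} (\<lambda>i l. if f i = enum_set R l then 1 else 0)"

lemma wedge_sign_cong: "(\<And>i. i < j \<Longrightarrow> f i = g i) \<Longrightarrow> wedge_sign j f R = wedge_sign j g R"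
  unfolding wedge_sign_def by (rule fdet_cong) auto

lemma wedge_sign_permute:
  assumes "finite X" "R \<in> Sub j X" "\<tau> permutes {..<j}"
  shows "wedge_sign j (\<lambda>i. enum_set R (\<tau> i)) R = sign \<tau>"
proof -
  have "wedge_sign j (\<lambda>i. enum_set R (\<tau> i)) R = sign \<tau> * fdet {..<j} (\<lambda>i l. if enum_set R i = enum_set R l then 1 else 0)"
    unfolding wedge_sign_def using fdet_permute_rows[OF _ assms(3), of "\<lambda>i l. if enum_set R i = enum_set R l then 1 else (0::int)"] by simp
  also have "fdet {..<j} (\<lambda>i l. if enum_set R i = enum_set R l then 1 else 0) = (fdet {..<j} (\<lambda>i l. if i = l then 1 else 0) :: int)"
    using bij_enum_set[OF assms(1,2)] by (intro fdet_cong) (auto simp: bij_betw_def inj_on_eq_iff)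
  finally show ?thesis by (simp add: fdet_one)
qed

lemma wedge_sign_nonzero:
  assumes X: "finite X" "R \<in> Sub j X" and nz: "wedge_sign j f R \<noteq> 0"
  shows "inj_on f {..<j}" "f ` {..<j} = R"
proof -
  have b: "bij_betw (enum_set R) {..<j} R" by (rule bij_enum_set[OF X])
  show inj: "inj_on f {..<j}"
  proof (rule ccontr)
    assume "\<not> inj_on f {..<j}"
    then obtain a b where "a < j" "b < j" "a \<noteq> b" "f a = f b" by (auto simp: inj_on_def)
    then have "wedge_sign j f R = 0" unfolding wedge_sign_def by (intro fdet_equal_rows[of _ a b]) auto
    then show False using nz by simp
  qed
  have "f i \<in> R" if "i < j" for i
  proof (rule ccontr)
    assume "f i \<notin> R"
    then have "wedge_sign j f R = 0" unfolding wedge_sign_def using b that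
      by (intro fdet_zero_row[of _ i]) (auto simp: bij_betw_def)
    then show False using nz by simp
  qed
  then have sub: "f ` {..<j} \<subseteq> R" by auto
  have "finite R" "card R = j" using X finite_subset by (auto simp: Sub_def)
  then show "f ` {..<j} = R" using card_subset_eq[OF _ sub] card_image[OF inj] by simp
qed

lemma wedge_sign_code:
  "wedge_sign j f R = (\<Sum>\<sigma> | \<sigma> permutes {..<j}. if \<forall>i<j. f i = enum_set R (\<sigma> i) then sign \<sigma> else 0)"
  unfolding wedge_sign_def fdet_def
proof (rule sum.cong[OF refl])
  fix \<sigma>
  have "(\<Prod>i<j. if f i = enum_set R (\<sigma> i) then 1 else (0::int)) = (if \<forall>i<j. f i = enum_set R (\<sigma> i) then 1 else 0)"
    by (auto intro: prod_zero)
  then show "of_int (sign \<sigma>) * (\<Prod>i<j. if f i = enum_set R (\<sigma> i) then 1 else (0::int)) =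
      (if \<forall>i<j. f i = enum_set R (\<sigma> i) then sign \<sigma> else 0)" by simp
qed

lemma sum_wedge_sign:
  fixes G :: "(nat \<Rightarrow> 'x) \<Rightarrow> 'a :: comm_ring_1"
  assumes X: "finite X" "S \<in> Sub j X"
  shows "(\<Sum>f\<in>{..<j} \<rightarrow>\<^sub>E X. of_int (wedge_sign j f S) * G f) =
    (\<Sum>\<sigma> | \<sigma> permutes {..<j}. of_int (sign \<sigma>) * G (restrict (\<lambda>i. enum_set S (\<sigma> i)) {..<j}))"
proof -
  have b: "bij_betw (enum_set S) {..<j} S" and S: "S \<subseteq> X" using bij_enum_set[OF X] X by (auto simp: Sub_def)
  have fin: "finite ({..<j} \<rightarrow>\<^sub>E X)" using X by (simp add: finite_PiE)
  have "(\<Sum>f\<in>{..<j} \<rightarrow>\<^sub>E X. of_int (wedge_sign j f S) * G f) =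
     (\<Sum>\<sigma> | \<sigma> permutes {..<j}. \<Sum>f\<in>{..<j} \<rightarrow>\<^sub>E X. if \<forall>i<j. f i = enum_set S (\<sigma> i) then of_int (sign \<sigma>) * G f else 0)"
    unfolding wedge_sign_code of_int_sum sum_distrib_right by (subst sum.swap) (intro sum.cong refl, auto)
  also have "\<dots> = (\<Sum>\<sigma> | \<sigma> permutes {..<j}. of_int (sign \<sigma>) * G (restrict (\<lambda>i. enum_set S (\<sigma> i)) {..<j}))"
  proof (rule sum.cong[OF refl])
    fix \<sigma> assume "\<sigma> \<in> {\<sigma>. \<sigma> permutes {..<j}}"
    then have s: "\<sigma> permutes {..<j}" by simp
    let ?r = "restrict (\<lambda>i. enum_set S (\<sigma> i)) {..<j}"
    have r: "?r \<in> {..<j} \<rightarrow>\<^sub>E X" using b S permutes_in_image[OF s] by (force simp: bij_betw_def)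
    have "(\<forall>i<j. f i = enum_set S (\<sigma> i)) \<longleftrightarrow> f = ?r" if f: "f \<in> {..<j} \<rightarrow>\<^sub>E X" for f
    proof
      assume a: "\<forall>i<j. f i = enum_set S (\<sigma> i)"
      show "f = ?r" by (rule PiE_ext[OF f r]) (use a in simp)
    qed auto
    then have "(\<Sum>f\<in>{..<j} \<rightarrow>\<^sub>E X. if \<forall>i<j. f i = enum_set S (\<sigma> i) then of_int (sign \<sigma>) * G f else 0) =
      (\<Sum>f\<in>{..<j} \<rightarrow>\<^sub>E X. if f = ?r then of_int (sign \<sigma>) * G ?r else 0)"
      by (intro sum.cong) auto
    also have "\<dots> = of_int (sign \<sigma>) * G ?r" using r fin by simp
    finally show "(\<Sum>f\<in>{..<j} \<rightarrow>\<^sub>E X. if \<forall>i<j. f i = enum_set S (\<sigma> i) then of_int (sign \<sigma>) * G f else 0) =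
      of_int (sign \<sigma>) * G ?r" .
  qed
  finally show ?thesis .
qed

text \<open>A minor depends on its rows only through their wedge product. It vanishes if a row
  repeats; otherwise exactly one \<open>R\<close> contributes, the set of the rows used.\<close>

lemma fdet_rows_expand:
  fixes Q :: "'x \<Rightarrow> nat \<Rightarrow> 'a :: comm_ring_1"
  assumes X: "finite X" and f: "\<And>i. i < j \<Longrightarrow> f i \<in> X"
  shows "fdet {..<j} (\<lambda>i. Q (f i)) = (\<Sum>R\<in>Sub j X. of_int (wedge_sign j f R) * fdet {..<j} (\<lambda>i. Q (enum_set R i)))"
proof (cases "inj_on f {..<j}")
  case False
  then obtain a b where "a < j" "b < j" "a \<noteq> b" "f a = f b" by (auto simp: inj_on_def)
  then have "fdet {..<j} (\<lambda>i. Q (f i)) = 0" by (intro fdet_equal_rows[of _ a b]) auto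
  moreover have "wedge_sign j f R = 0" if "R \<in> Sub j X" for R using wedge_sign_nonzero(1)[OF X that] False by blast
  ultimately show ?thesis by simp
next
  case True
  define R where "R = f ` {..<j}"
  have R: "R \<in> Sub j X" using f card_image[OF True] by (auto simp: R_def Sub_def)
  have b: "bij_betw (enum_set R) {..<j} R" by (rule bij_enum_set[OF X R])
  have bf: "bij_betw f {..<j} R" using True by (simp add: bij_betw_def R_def)
  have bg: "bij_betw (\<lambda>i. inv_into {..<j} (enum_set R) (f i)) {..<j} {..<j}"
    using bij_betw_trans[OF bf bij_betw_inv_into[OF b]] by (simp add: o_def)
  define \<tau> where "\<tau> = (\<lambda>i. if i \<in> {..<j} then inv_into {..<j} (enum_set R) (f i) else i)"
  have "bij_betw \<tau> {..<j} {..<j} \<longleftrightarrow> bij_betw (\<lambda>i. inv_into {..<j} (enum_set R) (f i)) {..<j} {..<j}"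
    by (rule bij_betw_cong) (simp add: \<tau>_def)
  then have \<tau>: "\<tau> permutes {..<j}"
    using bg by (intro bij_imp_permutes) (simp_all add: \<tau>_def)
  have f\<tau>: "f i = enum_set R (\<tau> i)" if "i < j" for i
  proof -
    have "f i \<in> enum_set R ` {..<j}" using that b by (auto simp: R_def bij_betw_def)
    then show ?thesis using that by (simp add: \<tau>_def f_inv_into_f)
  qed
  have "wedge_sign j f R' = 0" if "R' \<in> Sub j X - {R}" for R'
    using wedge_sign_nonzero(2)[OF X, of R' j f] that by (auto simp: R_def)
  then have "(\<Sum>R\<in>Sub j X. of_int (wedge_sign j f R) * fdet {..<j} (\<lambda>i. Q (enum_set R i))) =
     of_int (wedge_sign j f R) * fdet {..<j} (\<lambda>i. Q (enum_set R i))"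
    using R by (subst sum.remove[OF finite_Sub[OF X] R]) simp
  also have "wedge_sign j f R = sign \<tau>"
    using wedge_sign_permute[OF X R \<tau>] wedge_sign_cong[of j f "\<lambda>i. enum_set R (\<tau> i)", OF f\<tau>] by simp
  also have "of_int (sign \<tau>) * fdet {..<j} (\<lambda>i. Q (enum_set R i)) = fdet {..<j} (\<lambda>i. Q (enum_set R (\<tau> i)))"
    using fdet_permute_rows[OF _ \<tau>, of "\<lambda>i. Q (enum_set R i)"] by simp
  also have "\<dots> = fdet {..<j} (\<lambda>i. Q (f i))" by (rule fdet_cong) (simp add: f\<tau>)
  finally show ?thesis ..
qed

text \<open>The matrix of the \<open>j\<close>-th exterior power of \<open>P\<close>, with the
  \<open>j\<close>-minors of \<open>P\<close> as entries.\<close>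

definition compound :: "nat \<Rightarrow> ('x \<Rightarrow> 'x \<Rightarrow> 'a) \<Rightarrow> 'x set \<Rightarrow> 'x set \<Rightarrow> 'a::comm_ring_1" where
  "compound j P S R = fdet {..<j} (\<lambda>i l. P (enum_set S i) (enum_set R l))"

lemma compound_transpose: "compound j (\<lambda>a b. P b a) S R = compound j P R S"
  unfolding compound_def using fdet_transpose[of "{..<j}" "\<lambda>i l. P (enum_set R i) (enum_set S l)"] by simp

lemma compound_cong:
  assumes "finite X" "S \<in> Sub j X" "R \<in> Sub j X" "\<And>a b. a \<in> X \<Longrightarrow> b \<in> X \<Longrightarrow> P a b = Q a b"
  shows "compound j P S R = compound j Q S R"
  unfolding compound_def
proof (rule fdet_cong)
  fix i l assume "i \<in> {..<j}" "l \<in> {..<j}"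
  then have "enum_set S i \<in> X" "enum_set R l \<in> X"
    using bij_enum_set[OF assms(1,2)] bij_enum_set[OF assms(1,3)] assms(2,3) by (auto simp: bij_betw_def Sub_def)
  then show "P (enum_set S i) (enum_set R l) = Q (enum_set S i) (enum_set R l)" by (rule assms(4))
qed

lemma compound_one:
  assumes "finite X" "S \<in> Sub j X" "R \<in> Sub j X"
  shows "compound j (\<lambda>a b. if a = b then 1 else 0) S R = (if S = R then 1 else (0::'a::comm_ring_1))"
proof -
  have "compound j (\<lambda>a b. if a = b then 1 else 0) S R = (of_int (wedge_sign j (enum_set S) R) :: 'a)"
    by (simp add: compound_def wedge_sign_def fdet_def of_int_sum of_int_prod if_distrib[of of_int] cong: if_cong)
  moreover have "wedge_sign j (enum_set S) R = 0" if "S \<noteq> R"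
    using wedge_sign_nonzero(2)[OF assms(1,3), of "enum_set S"] bij_enum_set[OF assms(1,2)] that by (auto simp: bij_betw_def)
  moreover have "wedge_sign j (enum_set R) R = 1" using wedge_sign_permute[OF assms(1,3) permutes_id] by simp
  ultimately show ?thesis by auto
qed

text \<open>The Cauchy-Binet formula, that is, functoriality of the exterior power.\<close>

lemma compound_mult:
  fixes P Q :: "'x \<Rightarrow> 'x \<Rightarrow> 'a :: comm_ring_1"
  assumes X: "finite X" and S: "S \<in> Sub j X"
  shows "(\<Sum>R\<in>Sub j X. compound j P S R * compound j Q R R') = compound j (\<lambda>a b. \<Sum>c\<in>X. P a c * Q c b) S R'"
proof -
  have "compound j (\<lambda>a b. \<Sum>c\<in>X. P a c * Q c b) S R' =
      (\<Sum>f\<in>{..<j} \<rightarrow>\<^sub>E X. (\<Prod>i<j. P (enum_set S i) (f i)) * fdet {..<j} (\<lambda>i l. Q (f i) (enum_set R' l)))"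
    unfolding compound_def by (rule fdet_sum_rows) (use X in auto)
  also have "\<dots> = (\<Sum>f\<in>{..<j} \<rightarrow>\<^sub>E X. \<Sum>R\<in>Sub j X.
      of_int (wedge_sign j f R) * (\<Prod>i<j. P (enum_set S i) (f i)) * compound j Q R R')"
  proof (rule sum.cong[OF refl])
    fix f assume "f \<in> {..<j} \<rightarrow>\<^sub>E X"
    then have f: "f i \<in> X" if "i < j" for i using that by (auto dest: PiE_mem)
    show "(\<Prod>i<j. P (enum_set S i) (f i)) * fdet {..<j} (\<lambda>i l. Q (f i) (enum_set R' l)) =
       (\<Sum>R\<in>Sub j X. of_int (wedge_sign j f R) * (\<Prod>i<j. P (enum_set S i) (f i)) * compound j Q R R')"
      using fdet_rows_expand[OF X f, where Q = "\<lambda>a l. Q a (enum_set R' l)"]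
      by (simp add: compound_def sum_distrib_left mult_ac)
  qed
  also have "\<dots> = (\<Sum>R\<in>Sub j X. (\<Sum>f\<in>{..<j} \<rightarrow>\<^sub>E X.
      of_int (wedge_sign j f R) * (\<Prod>i<j. P (enum_set S i) (f i))) * compound j Q R R')"
    by (subst sum.swap) (simp add: sum_distrib_right)
  also have "\<dots> = (\<Sum>R\<in>Sub j X. compound j P S R * compound j Q R R')"
  proof (rule sum.cong[OF refl])
    fix R assume R: "R \<in> Sub j X"
    have "(\<Sum>f\<in>{..<j} \<rightarrow>\<^sub>E X. of_int (wedge_sign j f R) * (\<Prod>i<j. P (enum_set S i) (f i))) = compound j P S R"
      unfolding sum_wedge_sign[OF X R] compound_def fdet_def by (intro sum.cong refl) simp
    then show "(\<Sum>f\<in>{..<j} \<rightarrow>\<^sub>E X. of_int (wedge_sign j f R) * (\<Prod>i<j. P (enum_set S i) (f i))) * compound j Q R R' =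
        compound j P S R * compound j Q R R'" by simp
  qed
  finally show ?thesis ..
qed

lemma sum_PiE_update:
  fixes G :: "('i \<Rightarrow> 'x) \<Rightarrow> 'a :: comm_monoid_add"
  assumes "finite I" "finite X" "l \<in> I"
  shows "(\<Sum>f\<in>I \<rightarrow>\<^sub>E X. G f) = (\<Sum>k\<in>(I - {l}) \<rightarrow>\<^sub>E X. \<Sum>a\<in>X. G (k(l := a)))"
proof -
  have I: "I = insert l (I - {l})" using assms by auto
  have "(\<Sum>f\<in>I \<rightarrow>\<^sub>E X. G f) = (\<Sum>(a, k)\<in>X \<times> ((I - {l}) \<rightarrow>\<^sub>E X). G (k(l := a)))"
    by (subst I, subst PiE_insert_eq, subst sum.reindex[OF inj_combinator]) (auto simp: case_prod_unfold)
  also have "\<dots> = (\<Sum>a\<in>X. \<Sum>k\<in>(I - {l}) \<rightarrow>\<^sub>E X. G (k(l := a)))"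
    by (rule sum.cartesian_product[symmetric])
  finally show ?thesis by (subst sum.swap)
qed

text \<open>
  The derivation that a matrix \<open>A\<close> induces on the \<open>j\<close>-th exterior power. Each unordered wedge
  product is counted \<open>fact j\<close> times by its orderings; in this form the dependence on the unit
  matrix at \<open>(a, b)\<close> is visibly of the shape \<open>\<Sum>q. \<beta> S q a * \<beta> R q b\<close>.
\<close>

definition deriv_ext :: "nat \<Rightarrow> 'x set \<Rightarrow> ('x \<Rightarrow> 'x \<Rightarrow> 'a) \<Rightarrow> 'x set \<Rightarrow> 'x set \<Rightarrow> 'a::field_char_0" where
  "deriv_ext j X A S R = (\<Sum>a\<in>X. \<Sum>b\<in>X. A a b * (\<Sum>l<j. \<Sum>k\<in>({..<j} - {l}) \<rightarrow>\<^sub>E X.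
     of_int (wedge_sign j (k(l := a)) S) * of_int (wedge_sign j (k(l := b)) R))) / fact j"

lemma deriv_ext_transpose: "deriv_ext j X (\<lambda>a b. A b a) S R = deriv_ext j X A R S"
  unfolding deriv_ext_def by (subst sum.swap) (simp add: mult_ac)

text \<open>Composing the derivation with the exterior power of \<open>P\<close> puts the product of
  \<open>A\<close> and \<open>P\<close> into one slot and \<open>P\<close> into all others.
  Antisymmetrizing on both sides gives a formula in which left and right play the same role; the
  intertwining relation relies on that.\<close>

lemma deriv_ext_compound:
  fixes A P :: "'x \<Rightarrow> 'x \<Rightarrow> 'a :: field_char_0"
  assumes X: "finite X" and S: "S \<in> Sub j X"
  shows "fact j * (\<Sum>R\<in>Sub j X. deriv_ext j X A S R * compound j P R R') =
    (\<Sum>l<j. \<Sum>\<sigma> | \<sigma> permutes {..<j}. \<Sum>\<rho> | \<rho> permutes {..<j}. of_int (sign \<sigma>) * of_int (sign \<rho>) *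
      (\<Prod>i<j. (if i = l then \<lambda>a b. \<Sum>c\<in>X. A a c * P c b else P) (enum_set S (\<sigma> i)) (enum_set R' (\<rho> i))))"
proof -
  let ?AP = "\<lambda>a b. \<Sum>c\<in>X. A a c * P c b"
  let ?Y = "\<lambda>l i. if i = l then ?AP else P"
  let ?K = "\<lambda>l. ({..<j} - {l}) \<rightarrow>\<^sub>E X"
  let ?d = "\<lambda>f S. of_int (wedge_sign j f S) :: 'a"
  have "fact j * (\<Sum>R\<in>Sub j X. deriv_ext j X A S R * compound j P R R') =
     (\<Sum>R\<in>Sub j X. \<Sum>a\<in>X. \<Sum>b\<in>X. \<Sum>l<j. \<Sum>k\<in>?K l. A a b * ?d (k(l := a)) S * (?d (k(l := b)) R * compound j P R R'))"
    by (simp add: deriv_ext_def sum_distrib_left sum_distrib_right sum_divide_distrib mult_ac)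
  \<comment> \<open>The sums over \<open>R\<close> and \<open>b\<close> move inside: first the sum
    over \<open>R\<close> rebuilds a minor from its wedge expansion, then the sum over
    \<open>b\<close> merges \<open>A\<close> with the row in slot \<open>l\<close>.\<close>
  also have "\<dots> = (\<Sum>l<j. \<Sum>k\<in>?K l. \<Sum>a\<in>X. \<Sum>b\<in>X. \<Sum>R\<in>Sub j X. A a b * ?d (k(l := a)) S * (?d (k(l := b)) R * compound j P R R'))"
  proof -
    have "(\<Sum>R\<in>Sub j X. \<Sum>a\<in>X. \<Sum>b\<in>X. \<Sum>l<j. \<Sum>k\<in>?K l. g R a b l k) =
        (\<Sum>l<j. \<Sum>k\<in>?K l. \<Sum>a\<in>X. \<Sum>b\<in>X. \<Sum>R\<in>Sub j X. g R a b l k)" for g :: "'x set \<Rightarrow> 'x \<Rightarrow> 'x \<Rightarrow> nat \<Rightarrow> (nat \<Rightarrow> 'x) \<Rightarrow> 'a"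
    proof -
      have "(\<Sum>R\<in>Sub j X. \<Sum>a\<in>X. \<Sum>b\<in>X. \<Sum>l<j. \<Sum>k\<in>?K l. g R a b l k) =
        (\<Sum>R\<in>Sub j X. \<Sum>l<j. \<Sum>k\<in>?K l. \<Sum>a\<in>X. \<Sum>b\<in>X. g R a b l k)"
      proof (rule sum.cong[OF refl])
        fix R
        have "(\<Sum>a\<in>X. \<Sum>b\<in>X. \<Sum>l<j. \<Sum>k\<in>?K l. g R a b l k) = (\<Sum>a\<in>X. \<Sum>l<j. \<Sum>b\<in>X. \<Sum>k\<in>?K l. g R a b l k)"
          by (intro sum.cong refl sum.swap)
        also have "\<dots> = (\<Sum>l<j. \<Sum>a\<in>X. \<Sum>b\<in>X. \<Sum>k\<in>?K l. g R a b l k)" by (rule sum.swap)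
        also have "\<dots> = (\<Sum>l<j. \<Sum>a\<in>X. \<Sum>k\<in>?K l. \<Sum>b\<in>X. g R a b l k)" by (intro sum.cong refl sum.swap)
        also have "\<dots> = (\<Sum>l<j. \<Sum>k\<in>?K l. \<Sum>a\<in>X. \<Sum>b\<in>X. g R a b l k)" by (intro sum.cong refl sum.swap)
        finally show "(\<Sum>a\<in>X. \<Sum>b\<in>X. \<Sum>l<j. \<Sum>k\<in>?K l. g R a b l k) = (\<Sum>l<j. \<Sum>k\<in>?K l. \<Sum>a\<in>X. \<Sum>b\<in>X. g R a b l k)" .
      qed
      also have "\<dots> = (\<Sum>l<j. \<Sum>R\<in>Sub j X. \<Sum>k\<in>?K l. \<Sum>a\<in>X. \<Sum>b\<in>X. g R a b l k)" by (rule sum.swap)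
      also have "\<dots> = (\<Sum>l<j. \<Sum>k\<in>?K l. \<Sum>R\<in>Sub j X. \<Sum>a\<in>X. \<Sum>b\<in>X. g R a b l k)"
        by (intro sum.cong refl sum.swap)
      also have "\<dots> = (\<Sum>l<j. \<Sum>k\<in>?K l. \<Sum>a\<in>X. \<Sum>R\<in>Sub j X. \<Sum>b\<in>X. g R a b l k)"
        by (intro sum.cong refl sum.swap)
      also have "\<dots> = (\<Sum>l<j. \<Sum>k\<in>?K l. \<Sum>a\<in>X. \<Sum>b\<in>X. \<Sum>R\<in>Sub j X. g R a b l k)"
        by (intro sum.cong refl sum.swap)
      finally show ?thesis .
    qed
    then show ?thesis .
  qed
  also have "\<dots> = (\<Sum>l<j. \<Sum>k\<in>?K l. \<Sum>a\<in>X. ?d (k(l := a)) S * fdet {..<j} (\<lambda>i c. ?Y l i ((k(l := a)) i) (enum_set R' c)))"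
  proof (intro sum.cong refl)
    fix l k a assume l: "l \<in> {..<j}" and k: "k \<in> ?K l" and a: "a \<in> X"
    have kX: "k i \<in> X" if "i < j" "i \<noteq> l" for i using PiE_mem[OF k, of i] that by auto
    have "(\<Sum>b\<in>X. \<Sum>R\<in>Sub j X. A a b * ?d (k(l := a)) S * (?d (k(l := b)) R * compound j P R R')) =
        (\<Sum>b\<in>X. A a b * ?d (k(l := a)) S * fdet {..<j} (\<lambda>i c. P ((k(l := b)) i) (enum_set R' c)))"
    proof (rule sum.cong[OF refl])
      fix b assume b: "b \<in> X"
      have "fdet {..<j} (\<lambda>i c. P ((k(l := b)) i) (enum_set R' c)) = (\<Sum>R\<in>Sub j X. ?d (k(l := b)) R * compound j P R R')"
        unfolding compound_def using b kX
        by (intro fdet_rows_expand[OF X, where Q = "\<lambda>a c. P a (enum_set R' c)"]) auto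
      then show "(\<Sum>R\<in>Sub j X. A a b * ?d (k(l := a)) S * (?d (k(l := b)) R * compound j P R R')) =
        A a b * ?d (k(l := a)) S * fdet {..<j} (\<lambda>i c. P ((k(l := b)) i) (enum_set R' c))"
        by (simp only: sum_distrib_left)
    qed
    also have "\<dots> = ?d (k(l := a)) S * (\<Sum>b\<in>X. A a b * fdet {..<j} (\<lambda>i c. if i = l then P b (enum_set R' c) else P (k i) (enum_set R' c)))"
    proof -
      have "(\<lambda>i c. P ((k(l := b)) i) (enum_set R' c)) = (\<lambda>i c. if i = l then P b (enum_set R' c) else P (k i) (enum_set R' c))" for b
        by (auto simp: fun_eq_iff)
      then show ?thesis by (simp only: sum_distrib_left mult.assoc mult.left_commute)
    qed
    also have "(\<Sum>b\<in>X. A a b * fdet {..<j} (\<lambda>i c. if i = l then P b (enum_set R' c) else P (k i) (enum_set R' c))) =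
        fdet {..<j} (\<lambda>i c. if i = l then ?AP a (enum_set R' c) else P (k i) (enum_set R' c))"
      using l by (intro fdet_row_linear) auto
    also have "\<dots> = fdet {..<j} (\<lambda>i c. ?Y l i ((k(l := a)) i) (enum_set R' c))"
      by (rule fdet_cong) auto
    finally show "(\<Sum>b\<in>X. \<Sum>R\<in>Sub j X. A a b * ?d (k(l := a)) S * (?d (k(l := b)) R * compound j P R R')) =
        ?d (k(l := a)) S * fdet {..<j} (\<lambda>i c. ?Y l i ((k(l := a)) i) (enum_set R' c))" .
  qed
  also have "\<dots> = (\<Sum>l<j. \<Sum>f\<in>{..<j} \<rightarrow>\<^sub>E X. ?d f S * fdet {..<j} (\<lambda>i c. ?Y l i (f i) (enum_set R' c)))"
  proof (rule sum.cong[OF refl])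
    fix l assume "l \<in> {..<j}"
    then show "(\<Sum>k\<in>?K l. \<Sum>a\<in>X. ?d (k(l := a)) S * fdet {..<j} (\<lambda>i c. ?Y l i ((k(l := a)) i) (enum_set R' c))) =
        (\<Sum>f\<in>{..<j} \<rightarrow>\<^sub>E X. ?d f S * fdet {..<j} (\<lambda>i c. ?Y l i (f i) (enum_set R' c)))"
      using X by (intro sum_PiE_update[where G = "\<lambda>f. ?d f S * fdet {..<j} (\<lambda>i c. ?Y l i (f i) (enum_set R' c))", symmetric]) simp_all
  qed
  also have "\<dots> = (\<Sum>l<j. \<Sum>\<sigma> | \<sigma> permutes {..<j}. of_int (sign \<sigma>) * fdet {..<j} (\<lambda>i c. ?Y l i (enum_set S (\<sigma> i)) (enum_set R' c)))"
  proof (rule sum.cong[OF refl])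
    fix l
    show "(\<Sum>f\<in>{..<j} \<rightarrow>\<^sub>E X. ?d f S * fdet {..<j} (\<lambda>i c. ?Y l i (f i) (enum_set R' c))) =
      (\<Sum>\<sigma> | \<sigma> permutes {..<j}. of_int (sign \<sigma>) * fdet {..<j} (\<lambda>i c. ?Y l i (enum_set S (\<sigma> i)) (enum_set R' c)))"
      unfolding sum_wedge_sign[OF X S]
      by (intro sum.cong refl arg_cong2[where f = "(*)"] fdet_cong) simp
  qed
  finally show ?thesis by (simp only: fdet_def sum_distrib_left mult.assoc)
qed

text \<open>Both sides place the same matrix, the product of \<open>A\<close> and \<open>P\<close>
  or equally of \<open>P\<close> and \<open>T\<close>, into one slot. The right-hand side is brought
  to the form of the left by transposing everything.\<close>

lemma deriv_ext_intertwine: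
  fixes A P T :: "'x \<Rightarrow> 'x \<Rightarrow> 'a :: field_char_0"
  assumes X: "finite X" and S: "S \<in> Sub j X" "R' \<in> Sub j X"
    and AP: "\<And>a b. a \<in> X \<Longrightarrow> b \<in> X \<Longrightarrow> (\<Sum>c\<in>X. A a c * P c b) = (\<Sum>c\<in>X. P a c * T c b)"
  shows "(\<Sum>R\<in>Sub j X. deriv_ext j X A S R * compound j P R R') =
    (\<Sum>R\<in>Sub j X. compound j P S R * deriv_ext j X T R R')"
proof -
  let ?g = "\<lambda>l \<sigma> \<rho>. of_int (sign \<sigma>) * of_int (sign \<rho>) *
      (\<Prod>i<j. (if i = l then \<lambda>a b. \<Sum>c\<in>X. A a c * P c b else P) (enum_set S (\<sigma> i)) (enum_set R' (\<rho> i)))"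
  let ?h = "\<lambda>l \<rho> \<sigma>. of_int (sign \<rho>) * of_int (sign \<sigma>) *
      (\<Prod>i<j. (if i = l then \<lambda>a b. \<Sum>c\<in>X. T c a * P b c else (\<lambda>a b. P b a)) (enum_set R' (\<rho> i)) (enum_set S (\<sigma> i)))"
  have mem: "enum_set S i \<in> X" "enum_set R' i \<in> X" if "i < j" for i
    using bij_enum_set[OF X S(1)] bij_enum_set[OF X S(2)] S that by (auto simp: bij_betw_def Sub_def)
  have "fact j * (\<Sum>R\<in>Sub j X. compound j P S R * deriv_ext j X T R R') =
      fact j * (\<Sum>R\<in>Sub j X. deriv_ext j X (\<lambda>a b. T b a) R' R * compound j (\<lambda>a b. P b a) R S)"
    unfolding deriv_ext_transpose[of j X T] compound_transpose[of j P] by (simp only: mult.commute)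
  also have "\<dots> = (\<Sum>l<j. \<Sum>\<rho> | \<rho> permutes {..<j}. \<Sum>\<sigma> | \<sigma> permutes {..<j}. ?h l \<rho> \<sigma>)"
    by (rule deriv_ext_compound[OF X S(2)])
  also have "\<dots> = (\<Sum>l<j. \<Sum>\<rho> | \<rho> permutes {..<j}. \<Sum>\<sigma> | \<sigma> permutes {..<j}. ?g l \<sigma> \<rho>)"
  proof (intro sum.cong refl)
    fix l \<rho> \<sigma> assume "\<rho> \<in> {\<rho>. \<rho> permutes {..<j}}" "\<sigma> \<in> {\<sigma>. \<sigma> permutes {..<j}}"
    then have p: "\<rho> i < j" "\<sigma> i < j" if "i < j" for i using that permutes_in_image by fastforce+
    have "(\<Prod>i<j. (if i = l then \<lambda>a b. \<Sum>c\<in>X. T c a * P b c else (\<lambda>a b. P b a)) (enum_set R' (\<rho> i)) (enum_set S (\<sigma> i))) =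
      (\<Prod>i<j. (if i = l then \<lambda>a b. \<Sum>c\<in>X. A a c * P c b else P) (enum_set S (\<sigma> i)) (enum_set R' (\<rho> i)))"
      using AP mem p by (intro prod.cong refl) (auto simp: mult.commute)
    then show "?h l \<rho> \<sigma> = ?g l \<sigma> \<rho>" by (simp add: mult_ac)
  qed
  also have "\<dots> = (\<Sum>l<j. \<Sum>\<sigma> | \<sigma> permutes {..<j}. \<Sum>\<rho> | \<rho> permutes {..<j}. ?g l \<sigma> \<rho>)"
    by (intro sum.cong refl sum.swap)
  also have "\<dots> = fact j * (\<Sum>R\<in>Sub j X. deriv_ext j X A S R * compound j P R R')"
    by (rule deriv_ext_compound[OF X S(1), symmetric])
  finally show ?thesis by simp
qed

section \<open>Triangularization and the determinant of the Kronecker sum\<close>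

text \<open>\<open>P\<close> is invertible with inverse \<open>P'\<close> and conjugates
  \<open>A\<close> to the upper triangular \<open>T\<close>, whose diagonal lists the eigenvalues.
  Indices start at 1 to agree with the numbering of the variables.\<close>

definition tri_form :: "nat \<Rightarrow> (nat \<Rightarrow> nat \<Rightarrow> complex) \<Rightarrow> (nat \<Rightarrow> nat \<Rightarrow> complex) \<Rightarrow>
    (nat \<Rightarrow> nat \<Rightarrow> complex) \<Rightarrow> (nat \<Rightarrow> nat \<Rightarrow> complex) \<Rightarrow> bool" where
  "tri_form n A P P' T \<longleftrightarrow>
    (\<forall>a\<in>{1..n}. \<forall>b\<in>{1..n}. (\<Sum>c\<in>{1..n}. P a c * P' c b) = (if a = b then 1 else 0)) \<and>
    (\<forall>a\<in>{1..n}. \<forall>b\<in>{1..n}. (\<Sum>c\<in>{1..n}. P' a c * P c b) = (if a = b then 1 else 0)) \<and>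
    (\<forall>a\<in>{1..n}. \<forall>b\<in>{1..n}. (\<Sum>c\<in>{1..n}. A a c * P c b) = (\<Sum>c\<in>{1..n}. P a c * T c b)) \<and>
    (\<forall>a\<in>{1..n}. \<forall>b\<in>{1..n}. T a b \<noteq> 0 \<longrightarrow> a \<le> b)"

lemma sum_shift_1: "(\<Sum>c\<in>{1..n}. f c) = (\<Sum>c<n. f (Suc c))"
  using sum.atLeast_Suc_atMost_Suc_shift[of f 0 "n - 1"] 
  by (cases n) (auto simp: lessThan_Suc_atMost atLeast0AtMost simp del: sum.cl_ivl_Suc)

lemma tri_form_exists: "\<exists>P P' T. tri_form n A P P' T"
proof -
  define A0 where "A0 = mat n n (\<lambda>(i, j). A (Suc i) (Suc j))"
  have A0: "A0 \<in> carrier_mat n n" by (simp add: A0_def)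
  obtain as where as: "char_poly A0 = (\<Prod>a\<leftarrow>as. [:- a, 1:])"
    using char_poly_factorized[OF A0] by auto
  obtain B P Q where s: "schur_decomposition A0 as = (B, P, Q)" by (cases "schur_decomposition A0 as") auto
  then have sim: "similar_mat_wit A0 B P Q" and ut: "upper_triangular B"
    using schur_decomposition[OF A0 as] by auto
  note d = similar_mat_witD2[OF A0 sim]
  have P: "P \<in> carrier_mat n n" and Q: "Q \<in> carrier_mat n n" and B: "B \<in> carrier_mat n n"
    and PQ: "P * Q = 1\<^sub>m n" and QP: "Q * P = 1\<^sub>m n" and A: "A0 = P * B * Q" using d by auto
  have AP: "A0 * P = P * B"
  proof -
    have "A0 * P = P * B * (Q * P)" unfolding A using P Q B by (simp add: assoc_mult_mat[of _ n n _ n _ n])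
    then show ?thesis using P B by (simp add: QP)
  qed
  have entry: "(M * N) $$ (i, l) = (\<Sum>c<n. M $$ (i, c) * N $$ (c, l))"
    if "M \<in> carrier_mat n n" "N \<in> carrier_mat n n" "i < n" "l < n" for M N :: "complex mat" and i l
    using that by (simp add: scalar_prod_def atLeast0LessThan)
  \<comment> \<open>Matrix entries are counted from 0, labels from 1.\<close>
  let ?f = "\<lambda>M a b. M $$ (a - 1, b - 1)"
  have "tri_form n A (?f P) (?f Q) (?f B)"
    unfolding tri_form_def
  proof (intro conjI ballI impI)
    fix a b assume ab: "a \<in> {1..n}" "b \<in> {1..n}"
    then have i: "a - 1 < n" "b - 1 < n" and eq: "a - 1 = b - 1 \<longleftrightarrow> a = b" by auto
    show "(\<Sum>c\<in>{1..n}. ?f P a c * ?f Q c b) = (if a = b then 1 else 0)"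
      using entry[OF P Q i] i eq unfolding PQ sum_shift_1 by simp
    show "(\<Sum>c\<in>{1..n}. ?f Q a c * ?f P c b) = (if a = b then 1 else 0)"
      using entry[OF Q P i] i eq unfolding QP sum_shift_1 by simp
    have "A a (Suc c) = A0 $$ (a - 1, c)" if "c < n" for c
      using ab that unfolding A0_def by (subst index_mat) auto
    then show "(\<Sum>c\<in>{1..n}. A a c * ?f P c b) = (\<Sum>c\<in>{1..n}. ?f P a c * ?f B c b)"
      using entry[OF A0 P i] entry[OF P B i] unfolding AP sum_shift_1 by simp
    assume "?f B a b \<noteq> 0"
    then have "\<not> b - 1 < a - 1" using ut i B by (auto simp: upper_triangular_def)
    then show "a \<le> b" using ab by auto
  qed
  then show ?thesis by blast
qed

definition kronsum :: "nat \<Rightarrow> nat \<Rightarrow> 'x set \<Rightarrow> 'y set \<Rightarrow> ('x \<Rightarrow> 'x \<Rightarrow> 'a) \<Rightarrow> ('y \<Rightarrow> 'y \<Rightarrow> 'a) \<Rightarrow>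
    'x set \<times> 'y set \<Rightarrow> 'x set \<times> 'y set \<Rightarrow> 'a::field_char_0" where
  "kronsum j k X Y A B I J =
    deriv_ext j X A (fst I) (fst J) * (if snd I = snd J then 1 else 0) +
    (if fst I = fst J then 1 else 0) * deriv_ext k Y B (snd I) (snd J)"

lemma sum_delta_mult: "finite A \<Longrightarrow> a \<in> A \<Longrightarrow> (\<Sum>b\<in>A. (if a = b then 1 else 0) * f b) = (f a :: 'a :: comm_ring_1)"
  using sum.delta'[of A a f] by (simp add: if_distrib[of "\<lambda>x. x * _"] cong: if_cong)

lemma sum_mult_delta: "finite A \<Longrightarrow> a \<in> A \<Longrightarrow> (\<Sum>b\<in>A. f b * (if b = a then 1 else 0)) = (f a :: 'a :: comm_ring_1)"
  using sum.delta[of A a f] by (simp add: if_distrib cong: if_cong)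

text \<open>The tensor product of the compounds of \<open>P\<close> and \<open>Q\<close> intertwines
  the two Kronecker sums. Its determinant has an inverse, the one formed from \<open>P'\<close> and
  \<open>Q'\<close>, and cancels.\<close>

lemma fdet_kronsum_similar:
  fixes A TA P :: "'x \<Rightarrow> 'x \<Rightarrow> 'a :: field_char_0" and B TB Q :: "'y \<Rightarrow> 'y \<Rightarrow> 'a"
  assumes X: "finite X" and Y: "finite Y"
    and P: "\<And>a b. a \<in> X \<Longrightarrow> b \<in> X \<Longrightarrow> (\<Sum>c\<in>X. P a c * P' c b) = (if a = b then 1 else 0)"
    and Q: "\<And>a b. a \<in> Y \<Longrightarrow> b \<in> Y \<Longrightarrow> (\<Sum>c\<in>Y. Q a c * Q' c b) = (if a = b then 1 else 0)"
    and AP: "\<And>a b. a \<in> X \<Longrightarrow> b \<in> X \<Longrightarrow> (\<Sum>c\<in>X. A a c * P c b) = (\<Sum>c\<in>X. P a c * TA c b)"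
    and BQ: "\<And>a b. a \<in> Y \<Longrightarrow> b \<in> Y \<Longrightarrow> (\<Sum>c\<in>Y. B a c * Q c b) = (\<Sum>c\<in>Y. Q a c * TB c b)"
  shows "fdet (Sub j X \<times> Sub k Y) (kronsum j k X Y A B) = fdet (Sub j X \<times> Sub k Y) (kronsum j k X Y TA TB)"
proof -
  let ?I = "Sub j X \<times> Sub k Y"
  let ?K = "\<lambda>P Q I J. compound j P (fst I) (fst J) * compound k Q (snd I) (snd J)"
  have fin: "finite ?I" using X Y by (simp add: finite_Sub)
  have kk: "(\<Sum>J\<in>?I. ?K P Q I J * ?K P' Q' J L) = (if I = L then 1 else 0)" if "I \<in> ?I" "L \<in> ?I" for I L
  proof -
    have "(\<Sum>J\<in>?I. ?K P Q I J * ?K P' Q' J L) =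
      (\<Sum>R\<in>Sub j X. compound j P (fst I) R * compound j P' R (fst L)) * (\<Sum>U\<in>Sub k Y. compound k Q (snd I) U * compound k Q' U (snd L))"
      by (simp add: sum_product sum.cartesian_product case_prod_unfold mult_ac)
    also have "\<dots> = compound j (\<lambda>a b. if a = b then 1 else 0) (fst I) (fst L) * compound k (\<lambda>a b. if a = b then 1 else 0) (snd I) (snd L)"
    proof (rule arg_cong2[where f = "(*)"])
      have m: "fst I \<in> Sub j X" "snd I \<in> Sub k Y" "fst L \<in> Sub j X" "snd L \<in> Sub k Y" using that by auto
      show "(\<Sum>R\<in>Sub j X. compound j P (fst I) R * compound j P' R (fst L)) = compound j (\<lambda>a b. if a = b then 1 else 0) (fst I) (fst L)"
        unfolding compound_mult[OF X m(1)] by (rule compound_cong[OF X m(1,3) P])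
      show "(\<Sum>U\<in>Sub k Y. compound k Q (snd I) U * compound k Q' U (snd L)) = compound k (\<lambda>a b. if a = b then 1 else 0) (snd I) (snd L)"
        unfolding compound_mult[OF Y m(2)] by (rule compound_cong[OF Y m(2,4) Q])
    qed
    also have "\<dots> = (if I = L then 1 else 0)"
      using that compound_one[OF X, of "fst I" j "fst L", where 'a = 'a] compound_one[OF Y, of "snd I" k "snd L", where 'a = 'a]
      by (cases "fst I = fst L"; cases "snd I = snd L") (simp_all add: mem_Times_iff prod_eq_iff)
    finally show ?thesis .
  qed
  have "fdet ?I (?K P Q) * fdet ?I (?K P' Q') = fdet ?I (\<lambda>I L. \<Sum>J\<in>?I. ?K P Q I J * ?K P' Q' J L)"
    by (rule fdet_mult[OF fin, symmetric])
  also have "\<dots> = fdet ?I (\<lambda>I L. if I = L then 1 else 0)" by (rule fdet_cong) (rule kk)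
  also have "\<dots> = 1" by (rule fdet_one[OF fin])
  finally have "fdet ?I (?K P Q) * fdet ?I (?K P' Q') = 1" .
  then have nz: "fdet ?I (?K P Q) \<noteq> 0" by auto
  have comm: "(\<Sum>J\<in>?I. kronsum j k X Y A B I J * ?K P Q J L) = (\<Sum>J\<in>?I. ?K P Q I J * kronsum j k X Y TA TB J L)"
    if I: "I \<in> ?I" and L: "L \<in> ?I" for I L
  proof -
    have "(\<Sum>J\<in>?I. kronsum j k X Y A B I J * ?K P Q J L) =
      (\<Sum>J\<in>?I. (deriv_ext j X A (fst I) (fst J) * compound j P (fst J) (fst L)) * ((if snd I = snd J then 1 else 0) * compound k Q (snd J) (snd L))) +
      (\<Sum>J\<in>?I. ((if fst I = fst J then 1 else 0) * compound j P (fst J) (fst L)) * (deriv_ext k Y B (snd I) (snd J) * compound k Q (snd J) (snd L)))"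
      by (simp only: kronsum_def sum.distrib[symmetric]) (intro sum.cong refl, simp add: algebra_simps)
    also have "\<dots> = (\<Sum>R\<in>Sub j X. deriv_ext j X A (fst I) R * compound j P R (fst L)) * (\<Sum>U\<in>Sub k Y. (if snd I = U then 1 else 0) * compound k Q U (snd L)) +
      (\<Sum>R\<in>Sub j X. (if fst I = R then 1 else 0) * compound j P R (fst L)) * (\<Sum>U\<in>Sub k Y. deriv_ext k Y B (snd I) U * compound k Q U (snd L))"
      by (simp only: sum_product sum.cartesian_product case_prod_unfold fst_conv snd_conv)
    also have "(\<Sum>R\<in>Sub j X. deriv_ext j X A (fst I) R * compound j P R (fst L)) = (\<Sum>R\<in>Sub j X. compound j P (fst I) R * deriv_ext j X TA R (fst L))"
      using I L by (intro deriv_ext_intertwine X AP) auto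
    also have "(\<Sum>U\<in>Sub k Y. deriv_ext k Y B (snd I) U * compound k Q U (snd L)) = (\<Sum>U\<in>Sub k Y. compound k Q (snd I) U * deriv_ext k Y TB U (snd L))"
      using I L by (intro deriv_ext_intertwine Y BQ) auto
    also have "(\<Sum>U\<in>Sub k Y. (if snd I = U then 1 else 0) * compound k Q U (snd L)) = (\<Sum>U\<in>Sub k Y. compound k Q (snd I) U * (if U = snd L then 1 else 0))"
      using I L Y by (subst sum_delta_mult sum_mult_delta; auto simp: finite_Sub)+
    also have "(\<Sum>R\<in>Sub j X. (if fst I = R then 1 else 0) * compound j P R (fst L)) = (\<Sum>R\<in>Sub j X. compound j P (fst I) R * (if R = fst L then 1 else 0))"
      using I L X by (subst sum_delta_mult sum_mult_delta; auto simp: finite_Sub)+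
    also have "(\<Sum>R\<in>Sub j X. compound j P (fst I) R * deriv_ext j X TA R (fst L)) * (\<Sum>U\<in>Sub k Y. compound k Q (snd I) U * (if U = snd L then 1 else 0)) +
       (\<Sum>R\<in>Sub j X. compound j P (fst I) R * (if R = fst L then 1 else 0)) * (\<Sum>U\<in>Sub k Y. compound k Q (snd I) U * deriv_ext k Y TB U (snd L)) =
      (\<Sum>J\<in>?I. (compound j P (fst I) (fst J) * deriv_ext j X TA (fst J) (fst L)) * (compound k Q (snd I) (snd J) * (if snd J = snd L then 1 else 0))) +
      (\<Sum>J\<in>?I. (compound j P (fst I) (fst J) * (if fst J = fst L then 1 else 0)) * (compound k Q (snd I) (snd J) * deriv_ext k Y TB (snd J) (snd L)))"
      by (simp only: sum_product sum.cartesian_product case_prod_unfold fst_conv snd_conv)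
    also have "\<dots> = (\<Sum>J\<in>?I. ?K P Q I J * kronsum j k X Y TA TB J L)"
      by (simp only: kronsum_def sum.distrib[symmetric]) (intro sum.cong refl, simp add: algebra_simps)
    finally show ?thesis .
  qed
  have "fdet ?I (kronsum j k X Y A B) * fdet ?I (?K P Q) = fdet ?I (?K P Q) * fdet ?I (kronsum j k X Y TA TB)"
    unfolding fdet_mult[OF fin, symmetric] by (rule fdet_cong) (rule comm)
  then show ?thesis using nz by simp
qed

lemma wedge_sign_sum:
  assumes "finite X" "S \<in> Sub j X" "wedge_sign j f S \<noteq> 0"
  shows "(\<Sum>i<j. f i) = \<Sum>S"
  using wedge_sign_nonzero[OF assms] by (metis sum.reindex_cong)

text \<open>A nonzero entry comes from replacing one element \<open>a\<close> of \<open>S\<close> by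
  some \<open>b\<close> with \<open>a \<le> b\<close>. If the set changes, the replacement is strict
  and the element sum grows.\<close>

lemma deriv_ext_triangular:
  fixes T :: "nat \<Rightarrow> nat \<Rightarrow> 'a :: field_char_0"
  assumes X: "finite X" and S: "S \<in> Sub j X" "R \<in> Sub j X" 
    and T: "\<And>a b. a \<in> X \<Longrightarrow> b \<in> X \<Longrightarrow> T a b \<noteq> 0 \<Longrightarrow> a \<le> b"
    and nz: "deriv_ext j X T S R \<noteq> 0" and "S \<noteq> R"
  shows "\<Sum>S < \<Sum>R"
proof -
  have "\<exists>a b l k. a \<in> X \<and> b \<in> X \<and> T a b \<noteq> 0 \<and> l < j \<and> wedge_sign j (k(l := a)) S \<noteq> 0 \<and> wedge_sign j (k(l := b)) R \<noteq> 0"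
  proof (rule ccontr)
    assume "\<not> ?thesis"
    then have z: "T a b = 0 \<or> wedge_sign j (k(l := a)) S = 0 \<or> wedge_sign j (k(l := b)) R = 0" if "a \<in> X" "b \<in> X" "l < j" for a b k l
      using that by blast
    have "T a b * (\<Sum>l<j. \<Sum>k\<in>({..<j} - {l}) \<rightarrow>\<^sub>E X. of_int (wedge_sign j (k(l := a)) S) * of_int (wedge_sign j (k(l := b)) R)) = 0"
      if "a \<in> X" "b \<in> X" for a b
      using z[OF that] by (cases "T a b = 0") (auto intro!: sum.neutral)
    then have "deriv_ext j X T S R = 0"
      unfolding deriv_ext_def by simp
    then show False using nz by simp
  qed
  then obtain a b l k where ab: "a \<in> X" "b \<in> X" "T a b \<noteq> 0" "l < j"
    "wedge_sign j (k(l := a)) S \<noteq> 0" "wedge_sign j (k(l := b)) R \<noteq> 0" by blast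
  have s: "(\<Sum>i<j. (k(l := c)) i) = c + (\<Sum>i\<in>{..<j} - {l}. k i)" for c
  proof -
    have "(\<Sum>i<j. (k(l := c)) i) = (k(l := c)) l + (\<Sum>i\<in>{..<j} - {l}. (k(l := c)) i)"
      using ab by (intro sum.remove) auto
    then show ?thesis by simp
  qed
  have "a \<noteq> b"
  proof
    assume "a = b"
    then have "S = R" using wedge_sign_nonzero(2)[OF X S(1) ab(5)] wedge_sign_nonzero(2)[OF X S(2) ab(6)] by simp
    then show False using \<open>S \<noteq> R\<close> by simp
  qed
  then have "a < b" using T[OF ab(1-3)] by simp
  then show ?thesis using wedge_sign_sum[OF X S(1) ab(5)] wedge_sign_sum[OF X S(2) ab(6)] s[of a] s[of b] by simp
qed

text \<open>If replacing \<open>a\<close> by \<open>b\<close> leaves the set \<open>S\<close>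
  unchanged, comparing element sums gives \<open>a = b\<close>. The remaining signs are squared, and
  each of the \<open>fact j\<close> orderings of \<open>S\<close> contributes the same sum.\<close>

lemma deriv_ext_diag:
  fixes T :: "nat \<Rightarrow> nat \<Rightarrow> 'a :: field_char_0"
  assumes X: "finite X" and S: "S \<in> Sub j X" 
  shows "deriv_ext j X T S S = (\<Sum>a\<in>S. T a a)"
proof -
  let ?K = "\<lambda>l. ({..<j} - {l}) \<rightarrow>\<^sub>E X"
  let ?d = "\<lambda>f. of_int (wedge_sign j f S) :: 'a"
  have b: "bij_betw (enum_set S) {..<j} S" by (rule bij_enum_set[OF X S])
  have off: "?d (k(l := a)) * ?d (k(l := b)) = 0" if "a \<noteq> b" "l < j" for a b k l
  proof (rule ccontr)
    assume nz: "?d (k(l := a)) * ?d (k(l := b)) \<noteq> 0"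
    then have "wedge_sign j (k(l := a)) S \<noteq> 0" "wedge_sign j (k(l := b)) S \<noteq> 0" by auto
    then have "(\<Sum>i<j. (k(l := a)) i) = (\<Sum>i<j. (k(l := b)) i)" using wedge_sign_sum[OF X S] by metis
    moreover have "(\<Sum>i<j. (k(l := c)) i) = c + (\<Sum>i\<in>{..<j} - {l}. k i)" for c
    proof -
      have "(\<Sum>i<j. (k(l := c)) i) = (k(l := c)) l + (\<Sum>i\<in>{..<j} - {l}. (k(l := c)) i)"
        using that by (intro sum.remove) auto
      then show ?thesis by simp
    qed
    ultimately show False using that by simp
  qed
  have "fact j * deriv_ext j X T S S = (\<Sum>a\<in>X. \<Sum>b\<in>X. T a b * (\<Sum>l<j. \<Sum>k\<in>?K l. ?d (k(l := a)) * ?d (k(l := b))))"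
    by (simp add: deriv_ext_def)
  also have "\<dots> = (\<Sum>a\<in>X. T a a * (\<Sum>l<j. \<Sum>k\<in>?K l. ?d (k(l := a)) * ?d (k(l := a))))"
  proof (rule sum.cong[OF refl])
    fix a assume a: "a \<in> X"
    have "T a b * (\<Sum>l<j. \<Sum>k\<in>?K l. ?d (k(l := a)) * ?d (k(l := b))) = 0" if "b \<in> X - {a}" for b
    proof -
      have "(\<Sum>l<j. \<Sum>k\<in>?K l. ?d (k(l := a)) * ?d (k(l := b))) = 0"
        using that by (intro sum.neutral ballI off) auto
      then show ?thesis by simp
    qed
    then have "(\<Sum>b\<in>X - {a}. T a b * (\<Sum>l<j. \<Sum>k\<in>?K l. ?d (k(l := a)) * ?d (k(l := b)))) = 0"
      by (intro sum.neutral ballI)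
    then show "(\<Sum>b\<in>X. T a b * (\<Sum>l<j. \<Sum>k\<in>?K l. ?d (k(l := a)) * ?d (k(l := b)))) =
       T a a * (\<Sum>l<j. \<Sum>k\<in>?K l. ?d (k(l := a)) * ?d (k(l := a)))"
      by (subst sum.remove[OF X a]) simp
  qed
  also have "\<dots> = (\<Sum>a\<in>X. \<Sum>l<j. \<Sum>k\<in>?K l. T a a * (?d (k(l := a)) * ?d (k(l := a))))"
    by (simp only: sum_distrib_left)
  also have "\<dots> = (\<Sum>l<j. \<Sum>a\<in>X. \<Sum>k\<in>?K l. T a a * (?d (k(l := a)) * ?d (k(l := a))))"
    by (rule sum.swap)
  also have "\<dots> = (\<Sum>l<j. \<Sum>\<sigma> | \<sigma> permutes {..<j}. T (enum_set S (\<sigma> l)) (enum_set S (\<sigma> l)))"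
  proof (rule sum.cong[OF refl])
    fix l assume l: "l \<in> {..<j}"
    let ?G = "\<lambda>f. T (f l) (f l) * ?d f"
    have "(\<Sum>a\<in>X. \<Sum>k\<in>?K l. T a a * (?d (k(l := a)) * ?d (k(l := a)))) =
       (\<Sum>k\<in>?K l. \<Sum>a\<in>X. ?d (k(l := a)) * ?G (k(l := a)))"
      by (subst sum.swap) (intro sum.cong refl, simp only: fun_upd_same mult.left_commute)
    also have "\<dots> = (\<Sum>f\<in>{..<j} \<rightarrow>\<^sub>E X. ?d f * ?G f)"
      using l X by (intro sum_PiE_update[where G = "\<lambda>f. ?d f * ?G f", symmetric]) auto
    also have "\<dots> = (\<Sum>\<sigma> | \<sigma> permutes {..<j}. of_int (sign \<sigma>) * ?G (restrict (\<lambda>i. enum_set S (\<sigma> i)) {..<j}))"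
      by (rule sum_wedge_sign[OF X S])
    also have "\<dots> = (\<Sum>\<sigma> | \<sigma> permutes {..<j}. T (enum_set S (\<sigma> l)) (enum_set S (\<sigma> l)))"
    proof (rule sum.cong[OF refl])
      fix \<sigma> assume "\<sigma> \<in> {\<sigma>. \<sigma> permutes {..<j}}"
      then have s: "\<sigma> permutes {..<j}" by simp
      have "wedge_sign j (restrict (\<lambda>i. enum_set S (\<sigma> i)) {..<j}) S = sign \<sigma>"
        unfolding wedge_sign_permute[OF X S s, symmetric] by (rule wedge_sign_cong) simp
      moreover have "of_int (sign \<sigma>) * of_int (sign \<sigma>) = (1::'a)"
        by (metis of_int_1 of_int_mult sign_idempotent)
      ultimately show "of_int (sign \<sigma>) * ?G (restrict (\<lambda>i. enum_set S (\<sigma> i)) {..<j}) = T (enum_set S (\<sigma> l)) (enum_set S (\<sigma> l))"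
        using l by (simp add: mult_ac)
    qed
    finally show "(\<Sum>a\<in>X. \<Sum>k\<in>?K l. T a a * (?d (k(l := a)) * ?d (k(l := a)))) =
       (\<Sum>\<sigma> | \<sigma> permutes {..<j}. T (enum_set S (\<sigma> l)) (enum_set S (\<sigma> l)))" .
  qed
  also have "\<dots> = (\<Sum>\<sigma> | \<sigma> permutes {..<j}. \<Sum>l<j. T (enum_set S (\<sigma> l)) (enum_set S (\<sigma> l)))" by (rule sum.swap)
  also have "\<dots> = (\<Sum>\<sigma> | \<sigma> permutes {..<j}. \<Sum>a\<in>S. T a a)"
  proof (rule sum.cong[OF refl])
    fix \<sigma> assume "\<sigma> \<in> {\<sigma>. \<sigma> permutes {..<j}}"
    then have "bij_betw \<sigma> {..<j} {..<j}" by (simp add: permutes_imp_bij)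
    then have "bij_betw (enum_set S \<circ> \<sigma>) {..<j} S" using b by (rule bij_betw_trans)
    from sum.reindex_bij_betw[OF this, of "\<lambda>a. T a a"]
    show "(\<Sum>l<j. T (enum_set S (\<sigma> l)) (enum_set S (\<sigma> l))) = (\<Sum>a\<in>S. T a a)" by simp
  qed
  also have "\<dots> = fact j * (\<Sum>a\<in>S. T a a)"
    by (simp add: card_permutations[of "{..<j}" j])
  finally show ?thesis by simp
qed

theorem fdet_kronsum_tri_form:
  assumes A: "tri_form n A P P' TA" and B: "tri_form m B Q Q' TB"
  shows "fdet (Sub j {1..n} \<times> Sub k {1..m}) (kronsum j k {1..n} {1..m} A B) =
    (\<Prod>S\<in>Sub j {1..n}. \<Prod>T\<in>Sub k {1..m}. (\<Sum>i\<in>S. TA i i) + (\<Sum>i\<in>T. TB i i))"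
proof -
  let ?X = "{1..n}" and ?Y = "{1..m}"
  let ?I = "Sub j ?X \<times> Sub k ?Y"
  let ?M = "kronsum j k ?X ?Y TA TB"
  have fin: "finite ?I" by (simp add: finite_Sub)
  have "fdet ?I (kronsum j k ?X ?Y A B) = fdet ?I ?M"
  proof (rule fdet_kronsum_similar[where P = P and P' = P' and Q = Q and Q' = Q'])
    fix a b assume ab: "a \<in> ?X" "b \<in> ?X"
    show "(\<Sum>c\<in>?X. P a c * P' c b) = (if a = b then 1 else 0)" 
      "(\<Sum>c\<in>?X. A a c * P c b) = (\<Sum>c\<in>?X. P a c * TA c b)"
      using A ab unfolding tri_form_def by blast+
  next
    fix a b assume ab: "a \<in> ?Y" "b \<in> ?Y"
    show "(\<Sum>c\<in>?Y. Q a c * Q' c b) = (if a = b then 1 else 0)" 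
      "(\<Sum>c\<in>?Y. B a c * Q c b) = (\<Sum>c\<in>?Y. Q a c * TB c b)"
      using B ab unfolding tri_form_def by blast+
  qed simp_all
  \<comment> \<open>Each summand of the Kronecker sum moves only one component of the index, and
    raises its element sum; the two sums added together serve as weight.\<close>
  also have "\<dots> = (\<Prod>I\<in>?I. ?M I I)"
  proof (rule fdet_triangular[OF fin, where w = "\<lambda>(S, T). \<Sum>S + \<Sum>T"])
    fix I J assume I: "I \<in> ?I" and J: "J \<in> ?I" and "I \<noteq> J" and nz: "?M I J \<noteq> 0"
    obtain S T R U where [simp]: "I = (S, T)" "J = (R, U)" by (cases I, cases J)
    have tA: "a \<le> b" if "a \<in> ?X" "b \<in> ?X" "TA a b \<noteq> 0" for a b using A that unfolding tri_form_def by blast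
    have tB: "a \<le> b" if "a \<in> ?Y" "b \<in> ?Y" "TB a b \<noteq> 0" for a b using B that unfolding tri_form_def by blast
    show "(case I of (S, T) \<Rightarrow> \<Sum>S + \<Sum>T) < (case J of (S, T) \<Rightarrow> \<Sum>S + \<Sum>T)"
    proof (cases "T = U")
      case True
      then have 1: "deriv_ext j ?X TA S R \<noteq> 0" "S \<noteq> R" using \<open>I \<noteq> J\<close> nz by (auto simp: kronsum_def)
      have "\<Sum>S < \<Sum>R" by (rule deriv_ext_triangular[of ?X S j R TA, OF _ _ _ tA 1]) (use I J in simp_all)
      then show ?thesis using True by simp
    next
      case False
      then have "S = R" and 1: "deriv_ext k ?Y TB T U \<noteq> 0" using nz by (auto simp: kronsum_def split: if_splits)
      have "\<Sum>T < \<Sum>U" by (rule deriv_ext_triangular[of ?Y T k U TB, OF _ _ _ tB 1 False]) (use I J in simp_all)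
      then show ?thesis using \<open>S = R\<close> by simp
    qed
  qed
  also have "\<dots> = (\<Prod>(S, T)\<in>?I. (\<Sum>i\<in>S. TA i i) + (\<Sum>i\<in>T. TB i i))"
    by (intro prod.cong refl) (auto simp: kronsum_def deriv_ext_diag)
  finally show ?thesis by (simp add: prod.cartesian_product)
qed

section \<open>Complete and elementary symmetric functions of the eigenvalues\<close>

text \<open>The trace, on a tensor power, of \<open>A\<close> acting in every factor combined with
  the permutation \<open>\<sigma>\<close> of the factors; equivalently, the product of traces of
  powers of \<open>A\<close> over the cycles of \<open>\<sigma>\<close>. Being a sum of monomials in
  the entries of \<open>A\<close>, it can be polarized.\<close>

definition cyc_trace :: "'i set \<Rightarrow> 'x set \<Rightarrow> ('i \<Rightarrow> 'i) \<Rightarrow> ('x \<Rightarrow> 'x \<Rightarrow> 'a) \<Rightarrow> 'a::comm_ring_1" where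
  "cyc_trace I X \<sigma> A = (\<Sum>a\<in>I \<rightarrow>\<^sub>E X. \<Prod>i\<in>I. A (a i) (a (\<sigma> i)))"

lemma cyc_trace_cong:
  assumes "\<sigma> permutes I" "\<And>a b. a \<in> X \<Longrightarrow> b \<in> X \<Longrightarrow> A a b = B a b"
  shows "cyc_trace I X \<sigma> A = cyc_trace I X \<sigma> B"
  unfolding cyc_trace_def
proof (intro sum.cong prod.cong refl)
  fix a i assume a: "a \<in> I \<rightarrow>\<^sub>E X" and i: "i \<in> I"
  have "\<sigma> i \<in> I" using i permutes_in_image[OF assms(1)] by simp
  then show "A (a i) (a (\<sigma> i)) = B (a i) (a (\<sigma> i))"
    using PiE_mem[OF a] i by (intro assms(2))
qed

lemma bij_betw_PiE_permutes:
  assumes s: "\<sigma> permutes I"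
  shows "bij_betw (\<lambda>a. restrict (\<lambda>i. a (\<sigma> i)) I) (I \<rightarrow>\<^sub>E X) (I \<rightarrow>\<^sub>E X)"
proof (rule bij_betw_byWitness[where f' = "\<lambda>a. restrict (\<lambda>i. a (inv_into UNIV \<sigma> i)) I"])
  have m: "\<sigma> i \<in> I" "inv_into UNIV \<sigma> i \<in> I" if "i \<in> I" for i
    using that permutes_in_image[OF s] permutes_in_image[OF permutes_inv[OF s]] by auto
  show "\<forall>a\<in>I \<rightarrow>\<^sub>E X. restrict (\<lambda>i. restrict (\<lambda>i. a (\<sigma> i)) I (inv_into UNIV \<sigma> i)) I = a"
    "\<forall>a\<in>I \<rightarrow>\<^sub>E X. restrict (\<lambda>i. restrict (\<lambda>i. a (inv_into UNIV \<sigma> i)) I (\<sigma> i)) I = a"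
    using m permutes_inverses[OF s] by (auto simp: fun_eq_iff PiE_iff extensional_def)
  show "(\<lambda>a. restrict (\<lambda>i. a (\<sigma> i)) I) ` (I \<rightarrow>\<^sub>E X) \<subseteq> I \<rightarrow>\<^sub>E X"
    "(\<lambda>a. restrict (\<lambda>i. a (inv_into UNIV \<sigma> i)) I) ` (I \<rightarrow>\<^sub>E X) \<subseteq> I \<rightarrow>\<^sub>E X"
    using m by (auto dest: PiE_mem)
qed

lemma cyc_trace_mult:
  assumes I: "finite I" and X: "finite X" and s: "\<sigma> permutes I"
  shows "cyc_trace I X \<sigma> (\<lambda>a b. \<Sum>c\<in>X. M a c * N c b) =
    (\<Sum>a\<in>I \<rightarrow>\<^sub>E X. \<Sum>u\<in>I \<rightarrow>\<^sub>E X. \<Prod>i\<in>I. M (a i) (u i) * N (u i) (a (\<sigma> i)))"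
  unfolding cyc_trace_def using I X by (simp add: prod_sum_PiE)

text \<open>Cyclicity of the trace: the intermediate labels become the outer ones after the old
  outer labels are shifted along \<open>\<sigma>\<close>.\<close>

lemma cyc_trace_commute:
  assumes I: "finite I" and X: "finite X" and s: "\<sigma> permutes I"
  shows "cyc_trace I X \<sigma> (\<lambda>a b. \<Sum>c\<in>X. M a c * N c b) = cyc_trace I X \<sigma> (\<lambda>a b. \<Sum>c\<in>X. N a c * M c b)"
proof -
  let ?F = "\<lambda>a u. \<Prod>i\<in>I. N (u i) (a i) * M (a i) (u (\<sigma> i))"
  have m: "\<sigma> i \<in> I" if "i \<in> I" for i using that permutes_in_image[OF s] by auto
  have "cyc_trace I X \<sigma> (\<lambda>a b. \<Sum>c\<in>X. M a c * N c b) =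
    (\<Sum>a\<in>I \<rightarrow>\<^sub>E X. \<Sum>u\<in>I \<rightarrow>\<^sub>E X. \<Prod>i\<in>I. M (a i) (u i) * N (u i) (a (\<sigma> i)))"
    by (rule cyc_trace_mult[OF assms])
  also have "\<dots> = (\<Sum>a\<in>I \<rightarrow>\<^sub>E X. \<Sum>u\<in>I \<rightarrow>\<^sub>E X. ?F (restrict (\<lambda>i. a (\<sigma> i)) I) u)"
  proof (intro sum.cong refl)
    fix a u
    have "(\<Prod>i\<in>I. M (a i) (u i)) = (\<Prod>i\<in>I. M (a (\<sigma> i)) (u (\<sigma> i)))"
      using prod.permute[OF s, of "\<lambda>i. M (a i) (u i)"] by (simp add: o_def)
    then show "(\<Prod>i\<in>I. M (a i) (u i) * N (u i) (a (\<sigma> i))) = ?F (restrict (\<lambda>i. a (\<sigma> i)) I) u"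
      by (simp add: prod.distrib mult.commute)
  qed
  also have "\<dots> = (\<Sum>a\<in>I \<rightarrow>\<^sub>E X. \<Sum>u\<in>I \<rightarrow>\<^sub>E X. ?F a u)"
    by (rule sum.reindex_bij_betw[OF bij_betw_PiE_permutes[OF s], where g = "\<lambda>a. \<Sum>u\<in>I \<rightarrow>\<^sub>E X. ?F a u"])
  also have "\<dots> = (\<Sum>u\<in>I \<rightarrow>\<^sub>E X. \<Sum>a\<in>I \<rightarrow>\<^sub>E X. ?F a u)" by (rule sum.swap)
  also have "\<dots> = cyc_trace I X \<sigma> (\<lambda>a b. \<Sum>c\<in>X. N a c * M c b)"
    by (rule cyc_trace_mult[OF assms, symmetric])
  finally show ?thesis .
qed

text \<open>Cyclicity replaces \<open>A\<close> by \<open>T\<close>. A nonzero product of entries of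
  \<open>T\<close> needs labels that never decrease along \<open>\<sigma>\<close>; since
  \<open>\<sigma>\<close> preserves their sum, they are constant on its cycles.\<close>

lemma cyc_trace_tri_form:
  assumes A: "tri_form n A P P' T" and I: "finite I" and s: "\<sigma> permutes I"
  shows "cyc_trace I {1..n} \<sigma> A =
    (\<Sum>u | u \<in> I \<rightarrow>\<^sub>E {1..n} \<and> (\<forall>i\<in>I. u (\<sigma> i) = u i). \<Prod>i\<in>I. T (u i) (u i))"
proof -
  let ?X = "{1..n}"
  let ?TP = "\<lambda>a b. \<Sum>c\<in>?X. T a c * P' c b"
  have P: "(\<Sum>c\<in>?X. P a c * P' c b) = (if a = b then 1 else 0)"
    "(\<Sum>c\<in>?X. P' a c * P c b) = (if a = b then 1 else 0)"
    "(\<Sum>c\<in>?X. A a c * P c b) = (\<Sum>c\<in>?X. P a c * T c b)" if "a \<in> ?X" "b \<in> ?X" for a b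
    using A that unfolding tri_form_def by blast+
  have Aeq: "A a b = (\<Sum>c\<in>?X. P a c * ?TP c b)" if ab: "a \<in> ?X" "b \<in> ?X" for a b
  proof -
    have "(\<Sum>c\<in>?X. P a c * ?TP c b) = (\<Sum>c\<in>?X. \<Sum>e\<in>?X. (P a c * T c e) * P' e b)"
      by (simp add: sum_distrib_left mult.assoc)
    also have "\<dots> = (\<Sum>e\<in>?X. (\<Sum>c\<in>?X. P a c * T c e) * P' e b)"
      by (subst sum.swap) (simp add: sum_distrib_right)
    also have "\<dots> = (\<Sum>e\<in>?X. (\<Sum>c\<in>?X. A a c * P c e) * P' e b)"
      by (intro sum.cong refl) (simp only: P(3)[OF ab(1)])
    also have "\<dots> = (\<Sum>c\<in>?X. A a c * (\<Sum>e\<in>?X. P c e * P' e b))"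
      unfolding sum_distrib_right sum_distrib_left by (subst sum.swap) (simp only: mult.assoc)
    also have "\<dots> = (\<Sum>c\<in>?X. A a c * (if c = b then 1 else 0))"
      by (intro sum.cong refl) (simp only: P(1)[OF _ ab(2)])
    also have "\<dots> = A a b" using ab by (simp add: if_distrib cong: if_cong)
    finally show ?thesis ..
  qed
  have Teq: "(\<Sum>c\<in>?X. ?TP a c * P c b) = T a b" if ab: "a \<in> ?X" "b \<in> ?X" for a b
  proof -
    have "(\<Sum>c\<in>?X. ?TP a c * P c b) = (\<Sum>e\<in>?X. T a e * (\<Sum>c\<in>?X. P' e c * P c b))"
      unfolding sum_distrib_right sum_distrib_left by (subst sum.swap) (simp only: mult.assoc)
    also have "\<dots> = (\<Sum>e\<in>?X. T a e * (if e = b then 1 else 0))"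
      by (intro sum.cong refl) (simp only: P(2)[OF _ ab(2)])
    also have "\<dots> = T a b" using ab by (simp add: if_distrib cong: if_cong)
    finally show ?thesis .
  qed
  have "cyc_trace I ?X \<sigma> A = cyc_trace I ?X \<sigma> (\<lambda>a b. \<Sum>c\<in>?X. P a c * ?TP c b)"
    by (rule cyc_trace_cong[OF s Aeq])
  also have "\<dots> = cyc_trace I ?X \<sigma> (\<lambda>a b. \<Sum>c\<in>?X. ?TP a c * P c b)"
    by (rule cyc_trace_commute[OF I _ s]) simp
  also have "\<dots> = cyc_trace I ?X \<sigma> T"
    by (rule cyc_trace_cong[OF s Teq])
  also have "\<dots> = (\<Sum>u | u \<in> I \<rightarrow>\<^sub>E ?X \<and> (\<forall>i\<in>I. u (\<sigma> i) = u i). \<Prod>i\<in>I. T (u i) (u (\<sigma> i)))"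
    unfolding cyc_trace_def
  proof (rule sum.mono_neutral_right)
    show "finite (I \<rightarrow>\<^sub>E ?X)" using I by (simp add: finite_PiE)
    show "\<forall>u\<in>(I \<rightarrow>\<^sub>E ?X) - {u. u \<in> I \<rightarrow>\<^sub>E ?X \<and> (\<forall>i\<in>I. u (\<sigma> i) = u i)}. (\<Prod>i\<in>I. T (u i) (u (\<sigma> i))) = 0"
    proof (rule ballI, rule ccontr)
      fix u assume u: "u \<in> (I \<rightarrow>\<^sub>E ?X) - {u. u \<in> I \<rightarrow>\<^sub>E ?X \<and> (\<forall>i\<in>I. u (\<sigma> i) = u i)}"
      assume "(\<Prod>i\<in>I. T (u i) (u (\<sigma> i))) \<noteq> 0"
      then have nz: "T (u i) (u (\<sigma> i)) \<noteq> 0" if "i \<in> I" for i using I that by (auto simp: prod_zero_iff)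
      have uX: "u i \<in> ?X" "u (\<sigma> i) \<in> ?X" if "i \<in> I" for i 
        using u that permutes_in_image[OF s] by (auto dest: PiE_mem)
      have le: "u i \<le> u (\<sigma> i)" if "i \<in> I" for i
        using A nz[OF that] uX[OF that] unfolding tri_form_def by blast
      obtain i where i: "i \<in> I" "u (\<sigma> i) \<noteq> u i" using u by auto
      then have "u i < u (\<sigma> i)" using le[of i] by simp
      then have "sum u I < (\<Sum>i\<in>I. u (\<sigma> i))" using I i le by (intro sum_strict_mono_ex1) auto
      also have "\<dots> = sum u I" using sum.permute[OF s, of u] by (simp add: o_def)
      finally show False by simp
    qed
  qed auto
  also have "\<dots> = (\<Sum>u | u \<in> I \<rightarrow>\<^sub>E ?X \<and> (\<forall>i\<in>I. u (\<sigma> i) = u i). \<Prod>i\<in>I. T (u i) (u i))"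
    by (intro sum.cong prod.cong refl) auto
  finally show ?thesis .
qed

text \<open>Orbit counting: the permutations that carry \<open>u0\<close> to \<open>u\<close> form a
  coset of the stabilizer of \<open>u\<close>, so the stabilizers along the orbit of
  \<open>u0\<close> add up to the whole symmetric group.\<close>

lemma card_stabilizer_fiber:
  fixes u0 :: "nat \<Rightarrow> 'x"
  assumes X: "finite X" and u0: "u0 \<in> {..<k} \<rightarrow>\<^sub>E X"
  shows "(\<Sum>u | u \<in> {..<k} \<rightarrow>\<^sub>E X \<and> image_mset u (mset_set {..<k}) = image_mset u0 (mset_set {..<k}).
      card {\<sigma>. \<sigma> permutes {..<k} \<and> (\<forall>i\<in>{..<k}. u (\<sigma> i) = u i)}) = fact k"
proof -
  let ?U = "{u \<in> {..<k} \<rightarrow>\<^sub>E X. image_mset u (mset_set {..<k}) = image_mset u0 (mset_set {..<k})}"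
  let ?P = "{\<sigma>. \<sigma> permutes {..<k}}"
  let ?t = "\<lambda>\<sigma>. restrict (\<lambda>i. u0 (\<sigma> i)) {..<k}"
  have fin: "finite ?U" by (rule finite_subset[of _ "{..<k} \<rightarrow>\<^sub>E X"]) (use X in \<open>auto intro: finite_PiE\<close>)
  have tU: "?t \<sigma> \<in> ?U" if s: "\<sigma> permutes {..<k}" for \<sigma>
  proof -
    have "image_mset (?t \<sigma>) (mset_set {..<k}) = image_mset (\<lambda>i. u0 (\<sigma> i)) (mset_set {..<k})"
      by (rule image_mset_cong) simp
    also have "\<dots> = image_mset u0 (image_mset \<sigma> (mset_set {..<k}))"
      by (simp add: image_mset.compositionality o_def)
    also have "image_mset \<sigma> (mset_set {..<k}) = mset_set (\<sigma> ` {..<k})"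
      using s by (intro image_mset_mset_set permutes_inj_on)
    also have "\<sigma> ` {..<k} = {..<k}" using s by (rule permutes_image)
    finally have "image_mset (?t \<sigma>) (mset_set {..<k}) = image_mset u0 (mset_set {..<k})" .
    moreover have "?t \<sigma> \<in> {..<k} \<rightarrow>\<^sub>E X" using permutes_in_image[OF s] u0 by (auto dest: PiE_mem)
    ultimately show ?thesis by (simp only: mem_Collect_eq)
  qed
  have "card {\<sigma>. \<sigma> permutes {..<k} \<and> (\<forall>i\<in>{..<k}. u (\<sigma> i) = u i)} = card {\<sigma> \<in> ?P. ?t \<sigma> = u}" if u: "u \<in> ?U" for u
  proof -
    have "image_mset u (mset_set {..<k}) = image_mset u0 (mset_set {..<k})" using u by simp
    then obtain \<tau> where t: "\<tau> permutes {..<k}" "\<forall>x\<in>{..<k}. u x = u0 (\<tau> x)"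
      using image_mset_eq_implies_permutes[of "{..<k}" u u0] by auto
    have uE: "u \<in> {..<k} \<rightarrow>\<^sub>E X" using u by simp
    have iff: "(\<forall>i\<in>{..<k}. u (\<sigma> i) = u i) \<longleftrightarrow> ?t (\<tau> \<circ> \<sigma>) = u" if s: "\<sigma> permutes {..<k}" for \<sigma>
    proof
      assume a: "\<forall>i\<in>{..<k}. u (\<sigma> i) = u i"
      have m: "?t (\<tau> \<circ> \<sigma>) \<in> {..<k} \<rightarrow>\<^sub>E X" using tU[OF permutes_compose[OF s t(1)]] by simp
      show "?t (\<tau> \<circ> \<sigma>) = u"
        by (rule PiE_ext[OF m uE]) (use a t(2) permutes_in_image[OF s] in simp)
    next
      assume "?t (\<tau> \<circ> \<sigma>) = u"
      then have "?t (\<tau> \<circ> \<sigma>) i = u i" for i by simp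
      then show "\<forall>i\<in>{..<k}. u (\<sigma> i) = u i"
        using t(2) permutes_in_image[OF s] by (metis comp_apply restrict_apply')
    qed
    have "bij_betw ((\<circ>) \<tau>) {\<sigma>. \<sigma> permutes {..<k} \<and> (\<forall>i\<in>{..<k}. u (\<sigma> i) = u i)} {\<sigma> \<in> ?P. ?t \<sigma> = u}"
    proof (rule bij_betw_byWitness[where f' = "(\<circ>) (inv_into UNIV \<tau>)"])
      note o = permutes_inv_o[OF t(1)]
      show "\<forall>\<sigma>\<in>{\<sigma>. \<sigma> permutes {..<k} \<and> (\<forall>i\<in>{..<k}. u (\<sigma> i) = u i)}. inv_into UNIV \<tau> \<circ> (\<tau> \<circ> \<sigma>) = \<sigma>"
        using o by (simp add: o_assoc)
      show "\<forall>\<sigma>\<in>{\<sigma> \<in> ?P. ?t \<sigma> = u}. \<tau> \<circ> (inv_into UNIV \<tau> \<circ> \<sigma>) = \<sigma>" using o by (simp add: o_assoc)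
      show "(\<circ>) \<tau> ` {\<sigma>. \<sigma> permutes {..<k} \<and> (\<forall>i\<in>{..<k}. u (\<sigma> i) = u i)} \<subseteq> {\<sigma> \<in> ?P. ?t \<sigma> = u}"
        using iff permutes_compose[OF _ t(1)] by (auto simp del: restrict_apply)
      show "(\<circ>) (inv_into UNIV \<tau>) ` {\<sigma> \<in> ?P. ?t \<sigma> = u} \<subseteq> {\<sigma>. \<sigma> permutes {..<k} \<and> (\<forall>i\<in>{..<k}. u (\<sigma> i) = u i)}"
      proof (rule image_subsetI)
        fix \<sigma> assume \<sigma>: "\<sigma> \<in> {\<sigma> \<in> ?P. ?t \<sigma> = u}"
        then have p: "(inv_into UNIV \<tau> \<circ> \<sigma>) permutes {..<k}" using permutes_compose[OF _ permutes_inv[OF t(1)]] by simp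
        moreover have "\<tau> \<circ> (inv_into UNIV \<tau> \<circ> \<sigma>) = \<sigma>" using o by (simp add: o_assoc)
        ultimately show "inv_into UNIV \<tau> \<circ> \<sigma> \<in> {\<sigma>. \<sigma> permutes {..<k} \<and> (\<forall>i\<in>{..<k}. u (\<sigma> i) = u i)}"
          using iff[OF p] \<sigma> by simp
      qed
    qed
    then show ?thesis by (rule bij_betw_same_card)
  qed
  then have "(\<Sum>u\<in>?U. card {\<sigma>. \<sigma> permutes {..<k} \<and> (\<forall>i\<in>{..<k}. u (\<sigma> i) = u i)}) = (\<Sum>u\<in>?U. card {\<sigma> \<in> ?P. ?t \<sigma> = u})"
    by (rule sum.cong[OF refl])
  also have "\<dots> = (\<Sum>u\<in>?U. \<Sum>\<sigma>\<in>{\<sigma> \<in> ?P. ?t \<sigma> = u}. 1)" by simp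
  also have "\<dots> = (\<Sum>\<sigma>\<in>?P. 1)"
  proof (rule sum.group[OF finite_permutations[OF finite_lessThan] fin])
    show "?t ` ?P \<subseteq> ?U" using tU by (intro image_subsetI) (simp only: mem_Collect_eq)
  qed
  also have "\<dots> = fact k" by (simp add: card_permutations[of "{..<k}" k])
  finally show ?thesis by simp
qed

text \<open>The trace on the symmetric power, up to \<open>fact k\<close>. A labelling is counted
  once for every permutation fixing it, and over the labellings with a given multiset of values
  these counts add up to \<open>fact k\<close>.\<close>

lemma hsym_cyc_trace:
  assumes A: "tri_form n A P P' T"
  shows "(\<Sum>\<sigma> | \<sigma> permutes {..<k}. cyc_trace {..<k} {1..n} \<sigma> A) = fact k * hsym n (\<lambda>i. T i i) k"
proof -
  let ?X = "{1..n}"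
  let ?U = "{..<k} \<rightarrow>\<^sub>E ?X"
  let ?P = "{\<sigma>. \<sigma> permutes {..<k}}"
  let ?c = "\<lambda>u. image_mset u (mset_set {..<k})"
  let ?w = "\<lambda>u. \<Prod>i<k. T (u i) (u i)"
  let ?M = "{M. set_mset M \<subseteq> ?X \<and> size M = k}"
  let ?st = "\<lambda>u. card {\<sigma>. \<sigma> permutes {..<k} \<and> (\<forall>i\<in>{..<k}. u (\<sigma> i) = u i)}"
  have finU: "finite ?U" by (simp add: finite_PiE)
  have finP: "finite ?P" by (simp add: finite_permutations)
  have "(\<Sum>\<sigma>\<in>?P. cyc_trace {..<k} ?X \<sigma> A) = (\<Sum>\<sigma>\<in>?P. \<Sum>u\<in>?U. if \<forall>i\<in>{..<k}. u (\<sigma> i) = u i then ?w u else 0)"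
    by (intro sum.cong refl) (simp only: cyc_trace_tri_form[OF A finite_lessThan] mem_Collect_eq sum.inter_filter[OF finU])
  also have "\<dots> = (\<Sum>u\<in>?U. \<Sum>\<sigma>\<in>?P. if \<forall>i\<in>{..<k}. u (\<sigma> i) = u i then ?w u else 0)" by (rule sum.swap)
  also have "\<dots> = (\<Sum>u\<in>?U. of_nat (?st u) * ?w u)"
    using finP by (intro sum.cong refl) (simp add: sum.If_cases Int_def)
  also have "\<dots> = (\<Sum>M\<in>?M. \<Sum>u\<in>{u\<in>?U. ?c u = M}. of_nat (?st u) * ?w u)"
  proof (rule sum.group[symmetric, OF finU finite_msets_of_size])
    show "?c ` ?U \<subseteq> ?M"
    proof (rule image_subsetI)
      fix u assume u: "u \<in> ?U"
      have "u i \<in> ?X" if "i < k" for i using PiE_mem[OF u, of i] that by simp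
      then show "?c u \<in> ?M" by (simp only: mem_Collect_eq) (intro conjI subsetI, auto)
    qed
  qed simp
  also have "\<dots> = (\<Sum>M\<in>?M. fact k * (\<Prod>i\<in>#M. T i i))"
  proof (rule sum.cong[OF refl])
    fix M assume M: "M \<in> ?M"
    obtain xs where xs: "mset xs = M" using ex_mset by blast
    then have len: "length xs = k" and sx: "set xs \<subseteq> ?X" using M by auto
    define u0 where "u0 = restrict (\<lambda>i. xs ! i) {..<k}"
    have u0: "u0 \<in> ?U" using len sx by (auto simp: u0_def subset_iff)
    have "?c u0 = image_mset ((!) xs) (mset_set {..<k})"
      by (intro image_mset_cong) (simp add: u0_def)
    also have "\<dots> = mset (map ((!) xs) [0..<length xs])" 
      by (simp add: len lessThan_atLeast0)
    also have "\<dots> = M" using xs by (simp only: map_nth)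
    finally have cu0: "?c u0 = M" .
    have "(\<Sum>u\<in>{u\<in>?U. ?c u = M}. of_nat (?st u) * ?w u) = (\<Sum>u\<in>{u\<in>?U. ?c u = M}. of_nat (?st u) * (\<Prod>i\<in>#M. T i i))"
    proof (rule sum.cong[OF refl])
      fix u assume "u \<in> {u\<in>?U. ?c u = M}"
      then have "M = ?c u" by simp
      then have "(\<Prod>i\<in>#M. T i i) = ?w u" by (simp add: image_mset.compositionality o_def prod_unfold_prod_mset)
      then show "of_nat (?st u) * ?w u = of_nat (?st u) * (\<Prod>i\<in>#M. T i i)" by simp
    qed
    also have "\<dots> = of_nat (\<Sum>u\<in>{u\<in>?U. ?c u = ?c u0}. ?st u) * (\<Prod>i\<in>#M. T i i)"
      by (simp only: cu0 of_nat_sum sum_distrib_right)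
    also have "(\<Sum>u\<in>{u\<in>?U. ?c u = ?c u0}. ?st u) = fact k"
      by (rule card_stabilizer_fiber[OF _ u0]) simp
    finally show "(\<Sum>u\<in>{u\<in>?U. ?c u = M}. of_nat (?st u) * ?w u) = fact k * (\<Prod>i\<in>#M. T i i)" by simp
  qed
  finally show ?thesis by (simp add: hsym_def sum_distrib_left)
qed

lemma card_inj_fiber:
  assumes X: "finite X" and S: "S \<in> Sub k X"
  shows "card {u \<in> {..<k} \<rightarrow>\<^sub>E X. inj_on u {..<k} \<and> u ` {..<k} = S} = fact k"
proof -
  have S': "S \<subseteq> X" "card S = k" "finite S" using S X finite_subset by (auto simp: Sub_def)
  let ?U = "{u \<in> {..<k} \<rightarrow>\<^sub>E X. inj_on u {..<k} \<and> u ` {..<k} = S}"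
  have "?U = {u \<in> {..<k} \<rightarrow>\<^sub>E S. inj_on u {..<k}}"
  proof (intro equalityI subsetI)
    fix u assume "u \<in> ?U"
    then show "u \<in> {u \<in> {..<k} \<rightarrow>\<^sub>E S. inj_on u {..<k}}" by (auto simp: PiE_iff)
  next
    fix u assume u: "u \<in> {u \<in> {..<k} \<rightarrow>\<^sub>E S. inj_on u {..<k}}"
    then have "u ` {..<k} \<subseteq> S" "card (u ` {..<k}) = card S" using S' by (auto simp: card_image)
    then have "u ` {..<k} = S" using S' by (intro card_subset_eq)
    then show "u \<in> ?U" using u S' by (auto simp: PiE_iff)
  qed
  also have "card \<dots> = fact k"
  proof -
    have "card {u \<in> {..<k} \<rightarrow>\<^sub>E S. inj_on u {..<k}} = (\<Prod>i=0..<k. k - i)"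
      using card_inj_on_subset_funcset[of "{..<k}" S "{..<k}"] S' by simp
    also have "\<dots> = fact k" by (simp add: fact_prod_rev)
    finally show ?thesis .
  qed
  finally show ?thesis .
qed


text \<open>The trace on the exterior power, up to \<open>fact k\<close>. The signed number of
  permutations fixing a labelling is a determinant with two equal rows unless the labelling is
  injective.\<close>

lemma esym_cyc_trace:
  assumes A: "tri_form n A P P' T"
  shows "(\<Sum>\<sigma> | \<sigma> permutes {..<k}. of_int (sign \<sigma>) * cyc_trace {..<k} {1..n} \<sigma> A) = fact k * esym n (\<lambda>i. T i i) k"
proof -
  let ?X = "{1..n}"
  let ?U = "{..<k} \<rightarrow>\<^sub>E ?X"
  let ?P = "{\<sigma>. \<sigma> permutes {..<k}}"
  let ?w = "\<lambda>u. \<Prod>i<k. T (u i) (u i)"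
  let ?J = "{u \<in> ?U. inj_on u {..<k}}"
  have finU: "finite ?U" by (simp add: finite_PiE)
  have "(\<Sum>\<sigma>\<in>?P. of_int (sign \<sigma>) * cyc_trace {..<k} ?X \<sigma> A) =
     (\<Sum>\<sigma>\<in>?P. of_int (sign \<sigma>) * (\<Sum>u\<in>?U. if \<forall>i\<in>{..<k}. u (\<sigma> i) = u i then ?w u else 0))"
    by (intro sum.cong refl) (simp only: cyc_trace_tri_form[OF A finite_lessThan] mem_Collect_eq sum.inter_filter[OF finU])
  also have "\<dots> = (\<Sum>u\<in>?U. \<Sum>\<sigma>\<in>?P. of_int (sign \<sigma>) * (if \<forall>i\<in>{..<k}. u (\<sigma> i) = u i then ?w u else 0))"
    unfolding sum_distrib_left by (rule sum.swap)
  also have "\<dots> = (\<Sum>u\<in>?U. ?w u * fdet {..<k} (\<lambda>i l. if u l = u i then 1 else 0))"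
  proof (rule sum.cong[OF refl])
    fix u :: "nat \<Rightarrow> nat"
    have "(\<Prod>i<k. if u (\<sigma> i) = u i then 1 else (0::complex)) = (if \<forall>i\<in>{..<k}. u (\<sigma> i) = u i then 1 else 0)" for \<sigma>
      by (auto intro: prod_zero)
    then show "(\<Sum>\<sigma>\<in>?P. of_int (sign \<sigma>) * (if \<forall>i\<in>{..<k}. u (\<sigma> i) = u i then ?w u else 0)) =
        ?w u * fdet {..<k} (\<lambda>i l. if u l = u i then 1 else 0)"
      unfolding fdet_def sum_distrib_left by (intro sum.cong refl) simp
  qed
  also have "\<dots> = (\<Sum>u\<in>?J. ?w u)"
  proof -
    have "?w u * fdet {..<k} (\<lambda>i l. if u l = u i then 1 else 0) = (if inj_on u {..<k} then ?w u else 0)" for u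
    proof (cases "inj_on u {..<k}")
      case True
      then have "fdet {..<k} (\<lambda>i l. if u l = u i then 1 else 0) = fdet {..<k} (\<lambda>i l. if i = l then 1 else (0::complex))"
        by (intro fdet_cong) (auto simp: inj_on_eq_iff)
      then show ?thesis using True by (simp add: fdet_one)
    next
      case False
      then obtain a b where "a < k" "b < k" "a \<noteq> b" "u a = u b" by (auto simp: inj_on_def)
      then have "fdet {..<k} (\<lambda>i l. if u l = u i then 1 else (0::complex)) = 0"
        by (intro fdet_equal_rows[of _ a b]) auto
      then show ?thesis using False by simp
    qed
    then show ?thesis using finU by (simp add: sum.inter_filter)
  qed
  also have "\<dots> = (\<Sum>S\<in>Sub k ?X. \<Sum>u\<in>{u\<in>?J. u ` {..<k} = S}. ?w u)"
  proof (rule sum.group[symmetric])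
    show "finite ?J" using finU by simp
    show "finite (Sub k ?X)" by (simp add: finite_Sub)
    show "(\<lambda>u. u ` {..<k}) ` ?J \<subseteq> Sub k ?X"
    proof (rule image_subsetI)
      fix u assume u: "u \<in> ?J"
      then have "u i \<in> ?X" if "i < k" for i using PiE_mem[of u "{..<k}" "\<lambda>_. ?X" i] that by simp
      then have "u ` {..<k} \<subseteq> ?X" by (simp only: image_subset_iff lessThan_iff) blast
      then show "u ` {..<k} \<in> Sub k ?X" using u by (simp add: Sub_def card_image)
    qed
  qed
  also have "\<dots> = (\<Sum>S\<in>Sub k ?X. fact k * (\<Prod>i\<in>S. T i i))"
  proof (rule sum.cong[OF refl])
    fix S assume S: "S \<in> Sub k ?X"
    have "(\<Sum>u\<in>{u\<in>?J. u ` {..<k} = S}. ?w u) = (\<Sum>u\<in>{u\<in>?J. u ` {..<k} = S}. \<Prod>i\<in>S. T i i)"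
    proof (rule sum.cong[OF refl])
      fix u assume "u \<in> {u\<in>?J. u ` {..<k} = S}"
      then have "inj_on u {..<k}" "u ` {..<k} = S" by auto
      then show "?w u = (\<Prod>i\<in>S. T i i)" by (metis (no_types, lifting) prod.reindex_cong)
    qed
    also have "\<dots> = of_nat (card {u\<in>?J. u ` {..<k} = S}) * (\<Prod>i\<in>S. T i i)" by simp
    also have "{u\<in>?J. u ` {..<k} = S} = {u \<in> ?U. inj_on u {..<k} \<and> u ` {..<k} = S}" by auto
    also have "card \<dots> = fact k" by (rule card_inj_fiber[OF _ S]) simp
    finally show "(\<Sum>u\<in>{u\<in>?J. u ` {..<k} = S}. ?w u) = fact k * (\<Prod>i\<in>S. T i i)" by simp
  qed
  finally show ?thesis by (simp add: esym_def Sub_def sum_distrib_left)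
qed

section \<open>The polarized pairing attached to a diagram\<close>

lemma sum_supersets_alternating:
  assumes "finite C" "S \<subseteq> C"
  shows "(\<Sum>B | S \<subseteq> B \<and> B \<subseteq> C. (-1) ^ card (C - B)) = (if S = C then 1 else (0 :: 'a :: comm_ring_1))"
proof (cases "S = C")
  case True
  then have "{B. S \<subseteq> B \<and> B \<subseteq> C} = {C}" by auto
  then show ?thesis using True by simp
next
  case False
  have "card (C - B) + 2 * card B = card C + card B" if "B \<subseteq> C" for B
    using that assms card_mono[OF assms(1) that] by (simp add: card_Diff_subset finite_subset)
  then have "(-1) ^ card (C - B) = (-1) ^ card C * ((-1) ^ card B :: 'a)" if "B \<subseteq> C" for B
  proof -
    have "(-1) ^ card (C - B) = ((-1) ^ (card (C - B) + 2 * card B) :: 'a)" by (simp add: power_add)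
    then show ?thesis using that \<open>\<And>B. B \<subseteq> C \<Longrightarrow> card (C - B) + 2 * card B = card C + card B\<close>
      by (simp only: power_add[symmetric])
  qed
  then have "(\<Sum>B | S \<subseteq> B \<and> B \<subseteq> C. (-1) ^ card (C - B)) = (-1) ^ card C * (\<Sum>B | S \<subseteq> B \<and> B \<subseteq> C. (-1) ^ card B :: 'a)"
    unfolding sum_distrib_left by (intro sum.cong) auto
  also have "(\<Sum>B | S \<subseteq> B \<and> B \<subseteq> C. (-1) ^ card B :: 'a) = 0"
  proof (rule sum_alternating_cancels)
    show "finite {B. S \<subseteq> B \<and> B \<subseteq> C}" by (rule finite_subset[of _ "Pow C"]) (use assms in auto)
    show "card {x. x \<in> {B. S \<subseteq> B \<and> B \<subseteq> C} \<and> even (card x)} = card {x. x \<in> {B. S \<subseteq> B \<and> B \<subseteq> C} \<and> odd (card x)}"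
      using card_subsupersets_even_odd[of C S] assms False by (simp add: psubset_eq conj_assoc conj_ac)
  qed
  finally show ?thesis using False by simp
qed

text \<open>Inclusion-exclusion over \<open>B\<close> keeps the choices that use every element of
  \<open>C\<close>. They are bijections if \<open>I\<close> and \<open>C\<close> have equal size,
  and there are none if \<open>I\<close> is smaller.\<close>

lemma polarization:
  fixes g :: "'i \<Rightarrow> 'c \<Rightarrow> 'a :: comm_ring_1"
  assumes C: "finite C" and I: "finite I"
  shows "(\<Sum>B\<in>Pow C. (-1) ^ card (C - B) * (\<Prod>i\<in>I. \<Sum>c\<in>B. g i c)) =
    (\<Sum>\<pi> | \<pi> \<in> I \<rightarrow>\<^sub>E C \<and> \<pi> ` I = C. \<Prod>i\<in>I. g i (\<pi> i))"
proof -
  have fin: "finite (I \<rightarrow>\<^sub>E C)" using C I by (simp add: finite_PiE)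
  have "(\<Sum>B\<in>Pow C. (-1) ^ card (C - B) * (\<Prod>i\<in>I. \<Sum>c\<in>B. g i c)) =
     (\<Sum>B\<in>Pow C. \<Sum>\<pi>\<in>I \<rightarrow>\<^sub>E C. if \<pi> ` I \<subseteq> B then (-1) ^ card (C - B) * (\<Prod>i\<in>I. g i (\<pi> i)) else 0)"
  proof (rule sum.cong[OF refl])
    fix B assume B: "B \<in> Pow C"
    then have "finite B" using C finite_subset by auto
    then have "(\<Prod>i\<in>I. \<Sum>c\<in>B. g i c) = (\<Sum>\<pi>\<in>I \<rightarrow>\<^sub>E B. \<Prod>i\<in>I. g i (\<pi> i))" using I by (simp add: prod_sum_PiE)
    also have "I \<rightarrow>\<^sub>E B = {\<pi> \<in> I \<rightarrow>\<^sub>E C. \<pi> ` I \<subseteq> B}" using B by (auto simp: PiE_def Pi_def)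
    finally show "(-1) ^ card (C - B) * (\<Prod>i\<in>I. \<Sum>c\<in>B. g i c) =
      (\<Sum>\<pi>\<in>I \<rightarrow>\<^sub>E C. if \<pi> ` I \<subseteq> B then (-1) ^ card (C - B) * (\<Prod>i\<in>I. g i (\<pi> i)) else 0)"
      by (simp only: sum.inter_filter[OF fin, symmetric] sum_distrib_left)
  qed
  also have "\<dots> = (\<Sum>\<pi>\<in>I \<rightarrow>\<^sub>E C. \<Sum>B\<in>Pow C. if \<pi> ` I \<subseteq> B then (-1) ^ card (C - B) * (\<Prod>i\<in>I. g i (\<pi> i)) else 0)"
    by (rule sum.swap)
  also have "\<dots> = (\<Sum>\<pi>\<in>I \<rightarrow>\<^sub>E C. if \<pi> ` I = C then \<Prod>i\<in>I. g i (\<pi> i) else 0)"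
  proof (rule sum.cong[OF refl])
    fix \<pi> assume p: "\<pi> \<in> I \<rightarrow>\<^sub>E C"
    have "(\<Sum>B\<in>Pow C. if \<pi> ` I \<subseteq> B then (-1) ^ card (C - B) * (\<Prod>i\<in>I. g i (\<pi> i)) else 0) =
      (\<Sum>B\<in>{B \<in> Pow C. \<pi> ` I \<subseteq> B}. (-1) ^ card (C - B) * (\<Prod>i\<in>I. g i (\<pi> i)))"
      using C by (subst sum.inter_filter) auto
    also have "{B \<in> Pow C. \<pi> ` I \<subseteq> B} = {B. \<pi> ` I \<subseteq> B \<and> B \<subseteq> C}" by auto
    also have "(\<Sum>B\<in>\<dots>. (-1) ^ card (C - B) * (\<Prod>i\<in>I. g i (\<pi> i))) = (if \<pi> ` I = C then 1 else 0) * (\<Prod>i\<in>I. g i (\<pi> i))"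
      using p by (subst sum_distrib_right[symmetric], subst sum_supersets_alternating[OF C]) (auto dest: PiE_mem)
    finally show "(\<Sum>B\<in>Pow C. if \<pi> ` I \<subseteq> B then (-1) ^ card (C - B) * (\<Prod>i\<in>I. g i (\<pi> i)) else 0) =
      (if \<pi> ` I = C then \<Prod>i\<in>I. g i (\<pi> i) else 0)" by simp
  qed
  also have "\<dots> = (\<Sum>\<pi> | \<pi> \<in> I \<rightarrow>\<^sub>E C \<and> \<pi> ` I = C. \<Prod>i\<in>I. g i (\<pi> i))"
    by (rule sum.inter_filter[OF fin, symmetric])
  finally show ?thesis .
qed

definition unitsum :: "'c set \<Rightarrow> ('c \<Rightarrow> nat) \<Rightarrow> ('c \<Rightarrow> nat) \<Rightarrow> nat \<Rightarrow> nat \<Rightarrow> 'a::comm_ring_1" where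
  "unitsum B t t' a b = (\<Sum>c\<in>B. if t c = a \<and> t' c = b then 1 else 0)"

text \<open>
  The coefficient of \<open>\<Prod>c\<in>D. z (t c) c\<close> in the product, over the columns of \<open>D\<close>, of the minors of \<open>z\<close> on
  that column and on as many first rows.
\<close>

definition antisym_coeff :: "(nat \<times> nat) set \<Rightarrow> (nat \<times> nat \<Rightarrow> nat) \<Rightarrow> int" where
  "antisym_coeff D t = (\<Sum>\<tau> | \<tau> permutes D \<and> (\<forall>c\<in>D. snd (\<tau> c) = snd c).
     if \<forall>c\<in>D. t c = Suc (fst (\<tau> c)) then sign \<tau> else 0)"

text \<open>
  The alternating sum over \<open>B\<close> extracts the coefficient of \<open>\<Prod>c\<in>D. \<omega> c\<close> from \<open>F (\<Sum>c\<in>D. \<omega> c * E (t c) (t' c))\<close>,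
  with \<open>E a b\<close> the unit matrices, provided that \<open>F\<close> has degree at most \<open>card D\<close>.
\<close>

definition polar_form :: "nat \<Rightarrow> (nat \<times> nat) set \<Rightarrow> ((nat \<Rightarrow> nat \<Rightarrow> complex) \<Rightarrow> complex) \<Rightarrow> complex" where
  "polar_form n D F = (\<Sum>t\<in>D \<rightarrow>\<^sub>E {1..n}. \<Sum>t'\<in>D \<rightarrow>\<^sub>E {1..n}. of_int (antisym_coeff D t) * of_int (antisym_coeff D t') *
     (\<Sum>B\<in>Pow D. (-1) ^ card (D - B) * F (unitsum B t t')))"

lemma polar_form_sum: "polar_form n D (\<lambda>A. \<Sum>s\<in>S. F s A) = (\<Sum>s\<in>S. polar_form n D (F s))"
proof (cases "finite S")
  case True
  then show ?thesis
  proof (induction S rule: finite_induct)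
    case empty
    show ?case by (simp add: polar_form_def)
  next
    case (insert s S)
    then show ?case by (simp add: polar_form_def distrib_left sum.distrib)
  qed
qed (simp add: polar_form_def)

lemma polar_form_cmult: "polar_form n D (\<lambda>A. k * F A) = k * polar_form n D F"
  by (simp add: polar_form_def sum_distrib_left mult_ac)

text \<open>Composing with the transposition preserves the group of column-preserving permutations,
  because both cells lie in one column, and reverses the sign.\<close>

lemma antisym_coeff_swap:
  assumes D: "finite D" and c: "c \<in> D" "c' \<in> D" "c \<noteq> c'" "snd c = snd c'"
  shows "antisym_coeff D (restrict (\<lambda>x. t (transpose c c' x)) D) = - antisym_coeff D t"
proof -
  let ?s = "transpose c c'"
  let ?G = "{\<tau>. \<tau> permutes D \<and> (\<forall>c\<in>D. snd (\<tau> c) = snd c)}"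
  have s: "?s permutes D" using c by (intro permutes_swap_id)
  have perm: "permutation p" if "p permutes D" for p using that D permutation_permutes by blast
  have sn: "snd (?s x) = snd x" for x using c by (auto simp: transpose_def)
  have sD: "?s x \<in> D \<longleftrightarrow> x \<in> D" for x using permutes_in_image[OF s] .
  have closed: "\<tau> \<circ> ?s \<in> ?G" if "\<tau> \<in> ?G" for \<tau> using that permutes_compose[OF s] sn sD by auto
  have bij: "bij_betw (\<lambda>\<tau>. \<tau> \<circ> ?s) ?G ?G"
    by (rule bij_betw_byWitness[where f' = "\<lambda>\<tau>. \<tau> \<circ> ?s"]) (use closed in \<open>auto simp: o_assoc[symmetric]\<close>)
  have "antisym_coeff D (restrict (\<lambda>x. t (?s x)) D) =
      (\<Sum>\<tau>\<in>?G. if \<forall>c\<in>D. t (?s c) = Suc (fst ((\<tau> \<circ> ?s) c)) then sign (\<tau> \<circ> ?s) else 0)"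
    unfolding antisym_coeff_def by (subst sum.reindex_bij_betw[OF bij, symmetric]) (intro sum.cong refl if_cong, auto)
  also have "\<dots> = (\<Sum>\<tau>\<in>?G. - (if \<forall>c\<in>D. t c = Suc (fst (\<tau> c)) then sign \<tau> else 0))"
  proof (rule sum.cong[OF refl])
    fix \<tau> assume "\<tau> \<in> ?G"
    then have t: "\<tau> permutes D" by simp
    have "(\<forall>c\<in>D. t (?s c) = Suc (fst ((\<tau> \<circ> ?s) c))) \<longleftrightarrow> (\<forall>c\<in>D. t c = Suc (fst (\<tau> c)))"
    proof
      assume a: "\<forall>c\<in>D. t (?s c) = Suc (fst ((\<tau> \<circ> ?s) c))"
      show "\<forall>c\<in>D. t c = Suc (fst (\<tau> c))"
      proof
        fix x assume "x \<in> D"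
        then show "t x = Suc (fst (\<tau> x))" using bspec[OF a, of "?s x"] by (simp add: sD)
      qed
    qed (simp add: sD)
    moreover have "sign (\<tau> \<circ> ?s) = - sign \<tau>"
      using sign_compose[OF perm[OF t] perm[OF s]] c by (simp add: sign_swap_id)
    ultimately show "(if \<forall>c\<in>D. t (?s c) = Suc (fst ((\<tau> \<circ> ?s) c)) then sign (\<tau> \<circ> ?s) else 0) =
      - (if \<forall>c\<in>D. t c = Suc (fst (\<tau> c)) then sign \<tau> else 0)" by simp
  qed
  finally show ?thesis by (simp add: antisym_coeff_def sum_negf)
qed

lemma antisym_coeff_nonzero: "antisym_coeff D t \<noteq> 0 \<Longrightarrow> \<exists>\<tau>. \<tau> permutes D \<and> (\<forall>c\<in>D. t c = Suc (fst (\<tau> c)))"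
proof (rule ccontr)
  assume "antisym_coeff D t \<noteq> 0" and a: "\<not> (\<exists>\<tau>. \<tau> permutes D \<and> (\<forall>c\<in>D. t c = Suc (fst (\<tau> c))))"
  moreover have "antisym_coeff D t = 0" unfolding antisym_coeff_def
  proof (rule sum.neutral, rule ballI)
    fix \<tau> assume "\<tau> \<in> {\<tau>. \<tau> permutes D \<and> (\<forall>c\<in>D. snd (\<tau> c) = snd c)}"
    then have "\<not> (\<forall>c\<in>D. t c = Suc (fst (\<tau> c)))" using a by blast
    then show "(if \<forall>c\<in>D. t c = Suc (fst (\<tau> c)) then sign \<tau> else 0) = 0" by (rule if_not_P)
  qed
  ultimately show False by simp
qed

text \<open>Cells of one column have distinct row numbers, so only the identity contributes. This
  value later makes the self-pairing of a diagram strictly positive.\<close>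

lemma antisym_coeff_fst:
  assumes "finite D"
  shows "antisym_coeff D (restrict (\<lambda>c. Suc (fst c)) D) = 1"
proof -
  let ?G = "{\<tau>. \<tau> permutes D \<and> (\<forall>c\<in>D. snd (\<tau> c) = snd c)}"
  have "antisym_coeff D (restrict (\<lambda>c. Suc (fst c)) D) = (\<Sum>\<tau>\<in>?G. if \<tau> = id then 1 else 0)"
    unfolding antisym_coeff_def
  proof (rule sum.cong[OF refl])
    fix \<tau> assume t: "\<tau> \<in> ?G"
    have "(\<forall>c\<in>D. restrict (\<lambda>c. Suc (fst c)) D c = Suc (fst (\<tau> c))) \<longleftrightarrow> \<tau> = id"
    proof
      assume a: "\<forall>c\<in>D. restrict (\<lambda>c. Suc (fst c)) D c = Suc (fst (\<tau> c))"
      show "\<tau> = id"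
      proof
        fix c
        show "\<tau> c = id c"
        proof (cases "c \<in> D")
          case True
          then show ?thesis using a t by (auto simp: prod_eq_iff)
        next
          case False
          then show ?thesis using t permutes_not_in[of \<tau> D c] by auto
        qed
      qed
    qed simp
    then show "(if \<forall>c\<in>D. restrict (\<lambda>c. Suc (fst c)) D c = Suc (fst (\<tau> c)) then sign \<tau> else 0) = (if \<tau> = id then 1 else 0)"
      by simp
  qed
  also have "\<dots> = 1"
    using finite_subset[OF _ finite_permutations[OF assms], of ?G] by (subst sum.delta) (auto simp: permutes_id)
  finally show ?thesis .
qed

text \<open>For a bijection \<open>\<pi>\<close> from \<open>I\<close> to \<open>D\<close>, and
  labels in range, the only surviving \<open>t\<close> is \<open>\<alpha>\<close> transported along
  \<open>\<pi>\<close>. The sum form avoids the inverse of \<open>\<pi>\<close>.\<close>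

definition antisym_pairing :: "nat \<Rightarrow> (nat \<times> nat) set \<Rightarrow> 'p set \<Rightarrow> ('p \<Rightarrow> nat \<times> nat) \<Rightarrow> ('p \<Rightarrow> nat) \<Rightarrow> int" where
  "antisym_pairing n D I \<pi> \<alpha> = (\<Sum>t\<in>D \<rightarrow>\<^sub>E {1..n}. antisym_coeff D t * (if \<forall>p\<in>I. t (\<pi> p) = \<alpha> p then 1 else 0))"

lemma antisym_pairing_cong: "(\<And>p. p \<in> I \<Longrightarrow> \<alpha> p = \<beta> p) \<Longrightarrow> antisym_pairing n D I \<pi> \<alpha> = antisym_pairing n D I \<pi> \<beta>"
  unfolding antisym_pairing_def by (intro sum.cong refl arg_cong2[where f = "(*)"] if_cong ball_cong) simp_all

text \<open>After polarization the row labels see only \<open>t\<close> and the column labels only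
  \<open>t'\<close>, so each matching \<open>\<pi>\<close> gives a product of two separate
  pairings.\<close>

lemma polar_form_monomial:
  assumes D: "finite D" and I: "finite I"
  shows "polar_form n D (\<lambda>A. \<Prod>p\<in>I. A (\<alpha> p) (\<beta> p)) =
    (\<Sum>\<pi> | \<pi> \<in> I \<rightarrow>\<^sub>E D \<and> \<pi> ` I = D. of_int (antisym_pairing n D I \<pi> \<alpha> * antisym_pairing n D I \<pi> \<beta>))"
proof -
  let ?S = "{\<pi>. \<pi> \<in> I \<rightarrow>\<^sub>E D \<and> \<pi> ` I = D}"
  let ?i = "\<lambda>t \<alpha> \<pi>. if \<forall>p\<in>I. t (\<pi> p) = \<alpha> p then 1 else (0::complex)"
  let ?E = "D \<rightarrow>\<^sub>E {1..n}"
  have pr: "(\<Prod>p\<in>I. if t (\<pi> p) = \<alpha> p \<and> t' (\<pi> p) = \<beta> p then 1 else (0::complex)) = ?i t \<alpha> \<pi> * ?i t' \<beta> \<pi>" for t t' \<pi>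
    using I by (auto intro: prod_zero)
  have "(\<Sum>B\<in>Pow D. (-1) ^ card (D - B) * (\<Prod>p\<in>I. unitsum B t t' (\<alpha> p) (\<beta> p))) = (\<Sum>\<pi>\<in>?S. ?i t \<alpha> \<pi> * ?i t' \<beta> \<pi>)" for t t'
    unfolding unitsum_def polarization[OF D I] by (intro sum.cong refl pr)
  then have "polar_form n D (\<lambda>A. \<Prod>p\<in>I. A (\<alpha> p) (\<beta> p)) =
    (\<Sum>t\<in>?E. \<Sum>t'\<in>?E. \<Sum>\<pi>\<in>?S. (of_int (antisym_coeff D t) * ?i t \<alpha> \<pi>) * (of_int (antisym_coeff D t') * ?i t' \<beta> \<pi>))"
    by (simp add: polar_form_def sum_distrib_left mult_ac)
  also have "\<dots> = (\<Sum>t\<in>?E. \<Sum>\<pi>\<in>?S. \<Sum>t'\<in>?E. (of_int (antisym_coeff D t) * ?i t \<alpha> \<pi>) * (of_int (antisym_coeff D t') * ?i t' \<beta> \<pi>))"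
    by (intro sum.cong refl sum.swap)
  also have "\<dots> = (\<Sum>\<pi>\<in>?S. \<Sum>t\<in>?E. \<Sum>t'\<in>?E. (of_int (antisym_coeff D t) * ?i t \<alpha> \<pi>) * (of_int (antisym_coeff D t') * ?i t' \<beta> \<pi>))"
    by (rule sum.swap)
  also have "\<dots> = (\<Sum>\<pi>\<in>?S. of_int (antisym_pairing n D I \<pi> \<alpha> * antisym_pairing n D I \<pi> \<beta>))"
    by (intro sum.cong refl) (simp add: antisym_pairing_def sum_product if_distrib[of of_int] cong: if_cong)
  finally show ?thesis .
qed

lemma antisym_pairing_swap:
  assumes D: "finite D" and \<pi>: "inj_on \<pi> I" "\<pi> ` I \<subseteq> D" and p: "p \<in> I" "p' \<in> I" "p \<noteq> p'"
    and same: "snd (\<pi> p) = snd (\<pi> p')"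
  shows "antisym_pairing n D I \<pi> (\<lambda>q. \<beta> (transpose p p' q)) = - antisym_pairing n D I \<pi> \<beta>"
proof -
  let ?s = "transpose (\<pi> p) (\<pi> p')"
  let ?E = "D \<rightarrow>\<^sub>E {1..n}"
  have c: "\<pi> p \<in> D" "\<pi> p' \<in> D" "\<pi> p \<noteq> \<pi> p'" using \<pi> p by (auto simp: inj_on_eq_iff)
  have s: "?s permutes D" using c by (intro permutes_swap_id)
  have eq: "?s (\<pi> q) = \<pi> (transpose p p' q)" if "q \<in> I" for q
    using that \<pi> p by (auto simp: transpose_def inj_on_eq_iff)
  have tI: "transpose p p' q \<in> I \<longleftrightarrow> q \<in> I" for q using p by (auto simp: transpose_def)
  have "antisym_pairing n D I \<pi> (\<lambda>q. \<beta> (transpose p p' q)) =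
     (\<Sum>t\<in>?E. antisym_coeff D (restrict (\<lambda>x. t (?s x)) D) * (if \<forall>q\<in>I. restrict (\<lambda>x. t (?s x)) D (\<pi> q) = \<beta> (transpose p p' q) then 1 else 0))"
    unfolding antisym_pairing_def by (rule sum.reindex_bij_betw[OF bij_betw_PiE_permutes[OF s], symmetric])
  also have "\<dots> = (\<Sum>t\<in>?E. - (antisym_coeff D t * (if \<forall>q\<in>I. t (\<pi> q) = \<beta> q then 1 else 0)))"
  proof (rule sum.cong[OF refl])
    fix t
    have "(\<forall>q\<in>I. restrict (\<lambda>x. t (?s x)) D (\<pi> q) = \<beta> (transpose p p' q)) \<longleftrightarrow> (\<forall>q\<in>I. t (\<pi> (transpose p p' q)) = \<beta> (transpose p p' q))"
      using eq \<pi>(2) by (intro ball_cong refl) auto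
    also have "\<dots> \<longleftrightarrow> (\<forall>q\<in>I. t (\<pi> q) = \<beta> q)" 
    proof
      assume a: "\<forall>q\<in>I. t (\<pi> (transpose p p' q)) = \<beta> (transpose p p' q)"
      show "\<forall>q\<in>I. t (\<pi> q) = \<beta> q"
      proof
        fix x assume "x \<in> I"
        then show "t (\<pi> x) = \<beta> x" using bspec[OF a, of "transpose p p' x"] by (simp add: tI)
      qed
    qed (simp add: tI)
    finally show "antisym_coeff D (restrict (\<lambda>x. t (?s x)) D) * (if \<forall>q\<in>I. restrict (\<lambda>x. t (?s x)) D (\<pi> q) = \<beta> (transpose p p' q) then 1 else 0) =
       - (antisym_coeff D t * (if \<forall>q\<in>I. t (\<pi> q) = \<beta> q then 1 else 0))"
      using antisym_coeff_swap[OF D c same, of t] by simp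
  qed
  finally show ?thesis by (simp add: antisym_pairing_def sum_negf)
qed

text \<open>A nonzero pairing forces the labels to be the row numbers of \<open>D\<close> in some
  order. In the elementary case this turns a coincidence of rows into a coincidence of
  labels.\<close>

lemma antisym_pairing_nonzero:
  assumes "antisym_pairing n D I \<pi> \<alpha> \<noteq> 0" "\<pi> ` I \<subseteq> D"
  shows "\<exists>\<tau>. \<tau> permutes D \<and> (\<forall>p\<in>I. \<alpha> p = Suc (fst (\<tau> (\<pi> p))))"
proof -
  obtain t where "antisym_coeff D t * (if \<forall>p\<in>I. t (\<pi> p) = \<alpha> p then 1 else 0) \<noteq> 0"
    using assms(1) unfolding antisym_pairing_def by (rule sum.not_neutral_contains_not_neutral)
  then have "antisym_coeff D t \<noteq> 0" and t: "\<forall>p\<in>I. t (\<pi> p) = \<alpha> p" by (auto split: if_splits)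
  then obtain \<tau> where "\<tau> permutes D" "\<forall>c\<in>D. t c = Suc (fst (\<tau> c))" using antisym_coeff_nonzero by blast
  then show ?thesis using t assms(2) by (intro exI[of _ \<tau>]) (auto simp: image_subset_iff)
qed

lemma antisym_pairing_fst:
  assumes D: "finite D" and n: "\<And>c. c \<in> D \<Longrightarrow> fst c < n"
  shows "antisym_pairing n D D (restrict id D) (\<lambda>c. Suc (fst c)) = 1"
proof -
  let ?E = "D \<rightarrow>\<^sub>E {1..n}"
  let ?f = "restrict (\<lambda>c. Suc (fst c)) D"
  have f: "?f \<in> ?E" using n by (auto simp: Suc_le_eq)
  have "(\<forall>p\<in>D. t (restrict id D p) = Suc (fst p)) \<longleftrightarrow> t = ?f" if t: "t \<in> ?E" for t
  proof
    assume a: "\<forall>p\<in>D. t (restrict id D p) = Suc (fst p)"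
    show "t = ?f" by (rule PiE_ext[OF t f]) (use a in simp)
  qed simp
  then have "antisym_pairing n D D (restrict id D) (\<lambda>c. Suc (fst c)) = (\<Sum>t\<in>?E. if t = ?f then antisym_coeff D ?f else 0)"
    unfolding antisym_pairing_def by (intro sum.cong refl) auto
  also have "\<dots> = antisym_coeff D ?f" using f D by (subst sum.delta) (auto simp: finite_PiE)
  also have "\<dots> = 1" by (rule antisym_coeff_fst[OF D])
  finally show ?thesis .
qed


section \<open>Pairing with products of complete or elementary functions\<close>

definition block_cells :: "nat \<Rightarrow> (nat \<Rightarrow> nat) \<Rightarrow> (nat \<times> nat) set" where
  "block_cells N \<gamma> = Sigma {..<N} (\<lambda>i. {..<\<gamma> i})"

lemma finite_block_cells [simp]: "finite (block_cells N \<gamma>)"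
  by (simp add: block_cells_def)

lemma card_block_cells: "card (block_cells N \<gamma>) = (\<Sum>i<N. \<gamma> i)"
  by (simp add: block_cells_def)

definition block_perms :: "nat \<Rightarrow> (nat \<Rightarrow> nat) \<Rightarrow> (nat \<Rightarrow> nat \<Rightarrow> nat) set" where
  "block_perms N \<gamma> = PiE {..<N} (\<lambda>i. {\<sigma>. \<sigma> permutes {..<\<gamma> i}})"

definition block_labels :: "nat \<Rightarrow> nat \<Rightarrow> (nat \<Rightarrow> nat) \<Rightarrow> (nat \<Rightarrow> nat \<Rightarrow> nat) set" where
  "block_labels n N \<gamma> = PiE {..<N} (\<lambda>i. {..<\<gamma> i} \<rightarrow>\<^sub>E {1..n})"

lemma finite_block_perms: "finite (block_perms N \<gamma>)"
  unfolding block_perms_def by (intro finite_PiE) (auto intro: finite_permutations)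

lemma finite_block_labels: "finite (block_labels n N \<gamma>)"
  unfolding block_labels_def by (intro finite_PiE) auto

text \<open>With \<open>\<chi>\<close> constantly 1, block \<open>i\<close> yields the complete
  function of degree \<open>\<gamma> i\<close>, and with \<open>\<chi> = sign\<close> the elementary
  one, each multiplied by \<open>fact (\<gamma> i)\<close>.\<close>

definition block :: "((nat \<Rightarrow> nat) \<Rightarrow> int) \<Rightarrow> nat \<Rightarrow> nat \<Rightarrow> (nat \<Rightarrow> nat) \<Rightarrow> (nat \<Rightarrow> nat \<Rightarrow> complex) \<Rightarrow> complex" where
  "block \<chi> n N \<gamma> A = (\<Prod>i<N. \<Sum>\<sigma> | \<sigma> permutes {..<\<gamma> i}. of_int (\<chi> \<sigma>) * cyc_trace {..<\<gamma> i} {1..n} \<sigma> A)"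

lemma block_expand:
  "block \<chi> n N \<gamma> A = (\<Sum>\<sigma>\<in>block_perms N \<gamma>. \<Sum>a\<in>block_labels n N \<gamma>. of_int (\<Prod>i<N. \<chi> (\<sigma> i)) *
     (\<Prod>p\<in>block_cells N \<gamma>. A (a (fst p) (snd p)) (a (fst p) (\<sigma> (fst p) (snd p)))))"
proof -
  have "block \<chi> n N \<gamma> A = (\<Sum>\<sigma>\<in>block_perms N \<gamma>. \<Prod>i<N. of_int (\<chi> (\<sigma> i)) * cyc_trace {..<\<gamma> i} {1..n} (\<sigma> i) A)"
    unfolding block_def block_perms_def by (rule prod_sum_PiE) (auto intro: finite_permutations)
  also have "\<dots> = (\<Sum>\<sigma>\<in>block_perms N \<gamma>. of_int (\<Prod>i<N. \<chi> (\<sigma> i)) * (\<Sum>a\<in>block_labels n N \<gamma>. \<Prod>i<N. \<Prod>l<\<gamma> i. A (a i l) (a i (\<sigma> i l))))"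
    unfolding cyc_trace_def block_labels_def
    by (intro sum.cong refl, subst prod_sum_PiE[symmetric]) (auto simp: prod.distrib intro: finite_PiE)
  also have "\<dots> = (\<Sum>\<sigma>\<in>block_perms N \<gamma>. \<Sum>a\<in>block_labels n N \<gamma>. of_int (\<Prod>i<N. \<chi> (\<sigma> i)) *
     (\<Prod>p\<in>block_cells N \<gamma>. A (a (fst p) (snd p)) (a (fst p) (\<sigma> (fst p) (snd p)))))"
    by (simp add: sum_distrib_left block_cells_def prod.Sigma case_prod_unfold)
  finally show ?thesis .
qed

lemma polar_form_block:
  assumes D: "finite D"
  shows "polar_form n D (block \<chi> n N \<gamma>) = of_int (\<Sum>\<pi> | \<pi> \<in> block_cells N \<gamma> \<rightarrow>\<^sub>E D \<and> \<pi> ` block_cells N \<gamma> = D.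
    \<Sum>a\<in>block_labels n N \<gamma>. antisym_pairing n D (block_cells N \<gamma>) \<pi> (\<lambda>p. a (fst p) (snd p)) *
      (\<Sum>\<sigma>\<in>block_perms N \<gamma>. (\<Prod>i<N. \<chi> (\<sigma> i)) * antisym_pairing n D (block_cells N \<gamma>) \<pi> (\<lambda>p. a (fst p) (\<sigma> (fst p) (snd p)))))"
proof -
  let ?I = "block_cells N \<gamma>"
  let ?S = "{\<pi>. \<pi> \<in> ?I \<rightarrow>\<^sub>E D \<and> \<pi> ` ?I = D}"
  let ?W = "\<lambda>\<pi> a. antisym_pairing n D ?I \<pi> (\<lambda>p. a (fst p) (snd p))"
  let ?W' = "\<lambda>\<pi> a \<sigma>. antisym_pairing n D ?I \<pi> (\<lambda>p. a (fst p) (\<sigma> (fst p) (snd p)))"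
  have "polar_form n D (block \<chi> n N \<gamma>) = (\<Sum>\<sigma>\<in>block_perms N \<gamma>. \<Sum>a\<in>block_labels n N \<gamma>. of_int (\<Prod>i<N. \<chi> (\<sigma> i)) *
     polar_form n D (\<lambda>A. \<Prod>p\<in>?I. A (a (fst p) (snd p)) (a (fst p) (\<sigma> (fst p) (snd p)))))"
    unfolding block_expand[abs_def] polar_form_sum polar_form_cmult ..
  also have "\<dots> = of_int (\<Sum>\<sigma>\<in>block_perms N \<gamma>. \<Sum>a\<in>block_labels n N \<gamma>. \<Sum>\<pi>\<in>?S. (\<Prod>i<N. \<chi> (\<sigma> i)) * (?W \<pi> a * ?W' \<pi> a \<sigma>))"
    unfolding polar_form_monomial[OF D finite_block_cells] of_int_sum of_int_mult sum_distrib_left ..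
  also have "(\<Sum>\<sigma>\<in>block_perms N \<gamma>. \<Sum>a\<in>block_labels n N \<gamma>. \<Sum>\<pi>\<in>?S. (\<Prod>i<N. \<chi> (\<sigma> i)) * (?W \<pi> a * ?W' \<pi> a \<sigma>)) =
     (\<Sum>a\<in>block_labels n N \<gamma>. \<Sum>\<sigma>\<in>block_perms N \<gamma>. \<Sum>\<pi>\<in>?S. (\<Prod>i<N. \<chi> (\<sigma> i)) * (?W \<pi> a * ?W' \<pi> a \<sigma>))"
    by (rule sum.swap)
  also have "\<dots> = (\<Sum>a\<in>block_labels n N \<gamma>. \<Sum>\<pi>\<in>?S. \<Sum>\<sigma>\<in>block_perms N \<gamma>. (\<Prod>i<N. \<chi> (\<sigma> i)) * (?W \<pi> a * ?W' \<pi> a \<sigma>))"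
    by (intro sum.cong refl sum.swap)
  also have "\<dots> = (\<Sum>\<pi>\<in>?S. \<Sum>a\<in>block_labels n N \<gamma>. \<Sum>\<sigma>\<in>block_perms N \<gamma>. (\<Prod>i<N. \<chi> (\<sigma> i)) * (?W \<pi> a * ?W' \<pi> a \<sigma>))"
    by (rule sum.swap)
  also have "\<dots> = (\<Sum>\<pi>\<in>?S. \<Sum>a\<in>block_labels n N \<gamma>. ?W \<pi> a * (\<Sum>\<sigma>\<in>block_perms N \<gamma>. (\<Prod>i<N. \<chi> (\<sigma> i)) * ?W' \<pi> a \<sigma>))"
    by (simp only: sum_distrib_left mult.left_commute)
  finally show ?thesis .
qed

text \<open>There are too few positions for a surjection onto the cells of \<open>D\<close>.\<close>

lemma polar_form_block_small:
  assumes "finite D" "(\<Sum>i<N. \<gamma> i) < card D"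
  shows "polar_form n D (block \<chi> n N \<gamma>) = 0"
proof -
  have "\<not> \<pi> ` block_cells N \<gamma> = D" for \<pi>
    using card_image_le[OF finite_block_cells, of \<pi> N \<gamma>] assms(2) by (auto simp: card_block_cells)
  then show ?thesis unfolding polar_form_block[OF assms(1)] by simp
qed

lemma block_permsD: "\<sigma> \<in> block_perms N \<gamma> \<Longrightarrow> i < N \<Longrightarrow> \<sigma> i permutes {..<\<gamma> i}"
  unfolding block_perms_def using PiE_mem[of \<sigma> "{..<N}" "\<lambda>i. {\<sigma>. \<sigma> permutes {..<\<gamma> i}}" i] by simp

lemma block_perms_upd:
  assumes "\<sigma> \<in> block_perms N \<gamma>" "i < N" "\<tau> permutes {..<\<gamma> i}"
  shows "\<sigma>(i := \<tau>) \<in> block_perms N \<gamma>"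
  using assms PiE_fun_upd[of \<tau> "\<lambda>i. {\<sigma>. \<sigma> permutes {..<\<gamma> i}}" i \<sigma> "{..<N}"]
  by (simp add: block_perms_def insert_absorb)

text \<open>Composition on the left permutes labels within a block and serves the elementary case;
  its counterpart on the right permutes positions and serves the complete case.\<close>

lemma bij_betw_block_perms_left:
  assumes "i < N" "\<tau> permutes {..<\<gamma> i}"
  shows "bij_betw (\<lambda>\<sigma>. \<sigma>(i := \<tau> \<circ> \<sigma> i)) (block_perms N \<gamma>) (block_perms N \<gamma>)"
proof (rule bij_betw_byWitness[where f' = "\<lambda>\<sigma>. \<sigma>(i := inv_into UNIV \<tau> \<circ> \<sigma> i)"])
  note o = permutes_inv_o[OF assms(2)]
  show "\<forall>\<sigma>\<in>block_perms N \<gamma>. (\<sigma>(i := \<tau> \<circ> \<sigma> i))(i := inv_into UNIV \<tau> \<circ> (\<sigma>(i := \<tau> \<circ> \<sigma> i)) i) = \<sigma>"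
    "\<forall>\<sigma>\<in>block_perms N \<gamma>. (\<sigma>(i := inv_into UNIV \<tau> \<circ> \<sigma> i))(i := \<tau> \<circ> (\<sigma>(i := inv_into UNIV \<tau> \<circ> \<sigma> i)) i) = \<sigma>"
    using o by (simp_all add: o_assoc)
  show "(\<lambda>\<sigma>. \<sigma>(i := \<tau> \<circ> \<sigma> i)) ` block_perms N \<gamma> \<subseteq> block_perms N \<gamma>"
    "(\<lambda>\<sigma>. \<sigma>(i := inv_into UNIV \<tau> \<circ> \<sigma> i)) ` block_perms N \<gamma> \<subseteq> block_perms N \<gamma>"
    using assms block_perms_upd permutes_compose permutes_inv[OF assms(2)] block_permsD
    by (intro image_subsetI block_perms_upd; blast)+
qed

lemma bij_betw_block_perms_right:
  assumes "i < N" "\<tau> permutes {..<\<gamma> i}"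
  shows "bij_betw (\<lambda>\<sigma>. \<sigma>(i := \<sigma> i \<circ> \<tau>)) (block_perms N \<gamma>) (block_perms N \<gamma>)"
proof (rule bij_betw_byWitness[where f' = "\<lambda>\<sigma>. \<sigma>(i := \<sigma> i \<circ> inv_into UNIV \<tau>)"])
  note o = permutes_inv_o[OF assms(2)]
  show "\<forall>\<sigma>\<in>block_perms N \<gamma>. (\<sigma>(i := \<sigma> i \<circ> \<tau>))(i := (\<sigma>(i := \<sigma> i \<circ> \<tau>)) i \<circ> inv_into UNIV \<tau>) = \<sigma>"
    "\<forall>\<sigma>\<in>block_perms N \<gamma>. (\<sigma>(i := \<sigma> i \<circ> inv_into UNIV \<tau>))(i := (\<sigma>(i := \<sigma> i \<circ> inv_into UNIV \<tau>)) i \<circ> \<tau>) = \<sigma>"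
    using o by (simp_all add: o_assoc[symmetric])
  show "(\<lambda>\<sigma>. \<sigma>(i := \<sigma> i \<circ> \<tau>)) ` block_perms N \<gamma> \<subseteq> block_perms N \<gamma>"
    "(\<lambda>\<sigma>. \<sigma>(i := \<sigma> i \<circ> inv_into UNIV \<tau>)) ` block_perms N \<gamma> \<subseteq> block_perms N \<gamma>"
    using assms block_perms_upd permutes_compose permutes_inv[OF assms(2)] block_permsD
    by (intro image_subsetI block_perms_upd; blast)+
qed

lemma surj_eq_card_inj:
  assumes "finite I" "\<pi> ` I = D" "card I = card D"
  shows "inj_on \<pi> I"
  using assms by (intro eq_card_imp_inj_on) auto

text \<open>If \<open>\<pi>\<close> sends two positions of one block into the same column, composing
  \<open>\<sigma>\<close> with their transposition negates the pairing, and the sum over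
  \<open>\<sigma>\<close> vanishes. So a nonzero value supplies a matching that spreads every block
  over distinct columns.\<close>

lemma polar_form_block_h_nonzero:
  assumes D: "finite D" and card: "(\<Sum>i<N. \<gamma> i) = card D" and nz: "polar_form n D (block (\<lambda>_. 1) n N \<gamma>) \<noteq> 0"
  shows "\<exists>\<rho>. inj_on \<rho> (block_cells N \<gamma>) \<and> \<rho> ` block_cells N \<gamma> \<subseteq> D \<and>
    (\<forall>p\<in>block_cells N \<gamma>. \<forall>p'\<in>block_cells N \<gamma>. p \<noteq> p' \<longrightarrow> fst p = fst p' \<longrightarrow> snd (\<rho> p) \<noteq> snd (\<rho> p'))"
proof (rule ccontr)
  assume no: "\<not> ?thesis"
  let ?I = "block_cells N \<gamma>"
  have "(\<Sum>\<sigma>\<in>block_perms N \<gamma>. (\<Prod>i<N. 1) * antisym_pairing n D ?I \<pi> (\<lambda>p. a (fst p) (\<sigma> (fst p) (snd p)))) = 0"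
    if \<pi>: "\<pi> \<in> ?I \<rightarrow>\<^sub>E D" "\<pi> ` ?I = D" for \<pi> a
  proof -
    have inj: "inj_on \<pi> ?I" using \<pi> card by (intro surj_eq_card_inj[of _ _ D]) (auto simp: card_block_cells)
    then obtain p p' where p: "p \<in> ?I" "p' \<in> ?I" "p \<noteq> p'" "fst p = fst p'" "snd (\<pi> p) = snd (\<pi> p')"
      using no \<pi>(2) by blast
    obtain i l l' where [simp]: "p = (i, l)" "p' = (i, l')" using p(4) by (cases p, cases p') auto
    have il: "i < N" "l < \<gamma> i" "l' < \<gamma> i" "l \<noteq> l'" using p by (auto simp: block_cells_def)
    let ?t = "transpose l l'"
    have t: "?t permutes {..<\<gamma> i}" using il by (intro permutes_swap_id) auto
    let ?f = "\<lambda>\<sigma>. antisym_pairing n D ?I \<pi> (\<lambda>p. a (fst p) (\<sigma> (fst p) (snd p)))"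
    have "?f (\<sigma>(i := \<sigma> i \<circ> ?t)) = - ?f \<sigma>" for \<sigma>
    proof -
      have "?f (\<sigma>(i := \<sigma> i \<circ> ?t)) = antisym_pairing n D ?I \<pi> (\<lambda>q. (\<lambda>p. a (fst p) (\<sigma> (fst p) (snd p))) (transpose p p' q))"
        by (rule antisym_pairing_cong) (auto simp: transpose_def)
      also have "\<dots> = - ?f \<sigma>"
        by (rule antisym_pairing_swap[OF D inj _ p(1-3,5)]) (use \<pi> in simp)
      finally show ?thesis .
    qed
    then have "sum ?f (block_perms N \<gamma>) = - sum ?f (block_perms N \<gamma>)"
      using sum.reindex_bij_betw[OF bij_betw_block_perms_right[where \<gamma> = \<gamma>, OF il(1) t], of ?f] by (simp add: sum_negf)
    then show ?thesis by simp
  qed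
  then have "polar_form n D (block (\<lambda>_. 1) n N \<gamma>) = 0" unfolding polar_form_block[OF D] by simp
  then show False using nz by simp
qed

text \<open>A nonzero left pairing makes the labels the row numbers under
  \<open>\<tau> \<circ> \<pi>\<close>. If two positions of one block share a row there, their labels
  agree, and exchanging them changes only the sign of \<open>\<sigma>\<close>, so the sum
  vanishes.\<close>

lemma polar_form_block_e_nonzero:
  assumes D: "finite D" and card: "(\<Sum>i<N. \<gamma> i) = card D" and nz: "polar_form n D (block sign n N \<gamma>) \<noteq> 0"
  shows "\<exists>\<rho>. inj_on \<rho> (block_cells N \<gamma>) \<and> \<rho> ` block_cells N \<gamma> \<subseteq> D \<and>
    (\<forall>p\<in>block_cells N \<gamma>. \<forall>p'\<in>block_cells N \<gamma>. p \<noteq> p' \<longrightarrow> fst p = fst p' \<longrightarrow> fst (\<rho> p) \<noteq> fst (\<rho> p'))"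
proof (rule ccontr)
  assume no: "\<not> ?thesis"
  let ?I = "block_cells N \<gamma>"
  let ?W = "\<lambda>\<pi> a. antisym_pairing n D ?I \<pi> (\<lambda>p. a (fst p) (snd p))"
  have z: "(\<Sum>\<sigma>\<in>block_perms N \<gamma>. (\<Prod>i<N. sign (\<sigma> i)) * antisym_pairing n D ?I \<pi> (\<lambda>p. a (fst p) (\<sigma> (fst p) (snd p)))) = 0"
    if \<pi>: "\<pi> \<in> ?I \<rightarrow>\<^sub>E D" "\<pi> ` ?I = D" and W: "?W \<pi> a \<noteq> 0" for \<pi> a
  proof -
    have inj: "inj_on \<pi> ?I" using \<pi> card by (intro surj_eq_card_inj[of _ _ D]) (auto simp: card_block_cells)
    obtain \<tau> where \<tau>: "\<tau> permutes D" "\<And>p. p \<in> ?I \<Longrightarrow> a (fst p) (snd p) = Suc (fst (\<tau> (\<pi> p)))"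
      using antisym_pairing_nonzero[OF W] \<pi>(2) by auto
    have "inj_on (\<tau> \<circ> \<pi>) ?I" using inj permutes_inj[OF \<tau>(1)] by (simp add: comp_inj_on inj_on_subset)
    moreover have "(\<tau> \<circ> \<pi>) ` ?I \<subseteq> D" 
    proof (rule image_subsetI)
      fix p assume "p \<in> ?I"
      then have "\<pi> p \<in> D" using \<pi>(2) by blast
      then show "(\<tau> \<circ> \<pi>) p \<in> D" using permutes_in_image[OF \<tau>(1), of "\<pi> p"] by simp
    qed
    ultimately obtain p p' where p: "p \<in> ?I" "p' \<in> ?I" "p \<noteq> p'" "fst p = fst p'" "fst (\<tau> (\<pi> p)) = fst (\<tau> (\<pi> p'))"
    proof -
      assume 1: "inj_on (\<tau> \<circ> \<pi>) ?I" "(\<tau> \<circ> \<pi>) ` ?I \<subseteq> D"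
      have "\<not> (\<forall>p\<in>?I. \<forall>p'\<in>?I. p \<noteq> p' \<longrightarrow> fst p = fst p' \<longrightarrow> fst ((\<tau> \<circ> \<pi>) p) \<noteq> fst ((\<tau> \<circ> \<pi>) p'))"
        using no 1 by blast
      then show thesis using that by (simp only: comp_apply) blast
    qed
    obtain i l l' where pp: "p = (i, l)" "p' = (i, l')" using p(4) by (cases p, cases p') auto
    have il: "i < N" "l < \<gamma> i" "l' < \<gamma> i" "l \<noteq> l'" using p pp by (auto simp: block_cells_def)
    have al: "a i l = a i l'" using \<tau>(2)[OF p(1)] \<tau>(2)[OF p(2)] p(5) pp by simp
    let ?t = "transpose l l'"
    have t: "?t permutes {..<\<gamma> i}" using il by (intro permutes_swap_id) auto
    let ?f = "\<lambda>\<sigma>. (\<Prod>i<N. sign (\<sigma> i)) * antisym_pairing n D ?I \<pi> (\<lambda>p. a (fst p) (\<sigma> (fst p) (snd p)))"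
    have "?f (\<sigma>(i := ?t \<circ> \<sigma> i)) = - ?f \<sigma>" if \<sigma>: "\<sigma> \<in> block_perms N \<gamma>" for \<sigma>
    proof -
      have s: "\<sigma> i permutes {..<\<gamma> i}" using block_permsD[OF \<sigma> il(1)] .
      have perm: "permutation q" if "q permutes {..<\<gamma> i}" for q using that permutation_permutes by blast
      have "antisym_pairing n D ?I \<pi> (\<lambda>p. a (fst p) ((\<sigma>(i := ?t \<circ> \<sigma> i)) (fst p) (snd p))) = antisym_pairing n D ?I \<pi> (\<lambda>p. a (fst p) (\<sigma> (fst p) (snd p)))"
        by (rule antisym_pairing_cong) (auto simp: transpose_def al)
      moreover have "(\<Prod>m<N. sign ((\<sigma>(i := ?t \<circ> \<sigma> i)) m)) = - (\<Prod>m<N. sign (\<sigma> m))"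
      proof -
        have "(\<Prod>m<N. sign ((\<sigma>(i := ?t \<circ> \<sigma> i)) m)) = sign (?t \<circ> \<sigma> i) * (\<Prod>m\<in>{..<N} - {i}. sign (\<sigma> m))"
          using il(1) by (subst prod.remove[of _ i]) (auto intro!: prod.cong)
        also have "sign (?t \<circ> \<sigma> i) = - sign (\<sigma> i)"
          using sign_compose[OF perm[OF t] perm[OF s]] il(4) by (simp add: sign_swap_id)
        also have "- sign (\<sigma> i) * (\<Prod>m\<in>{..<N} - {i}. sign (\<sigma> m)) = - (\<Prod>m<N. sign (\<sigma> m))"
          using il(1) by (subst (2) prod.remove[of _ i]) auto
        finally show ?thesis .
      qed
      ultimately show ?thesis by simp
    qed
    then have "(\<Sum>\<sigma>\<in>block_perms N \<gamma>. ?f (\<sigma>(i := ?t \<circ> \<sigma> i))) = (\<Sum>\<sigma>\<in>block_perms N \<gamma>. - ?f \<sigma>)" by (rule sum.cong[OF refl])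
    then have "sum ?f (block_perms N \<gamma>) = - sum ?f (block_perms N \<gamma>)"
      using sum.reindex_bij_betw[OF bij_betw_block_perms_left[where \<gamma> = \<gamma>, OF il(1) t], of ?f] by (simp add: sum_negf)
    then show ?thesis by simp
  qed
  have "?W \<pi> a * (\<Sum>\<sigma>\<in>block_perms N \<gamma>. (\<Prod>i<N. sign (\<sigma> i)) * antisym_pairing n D ?I \<pi> (\<lambda>p. a (fst p) (\<sigma> (fst p) (snd p)))) = 0"
    if "\<pi> \<in> {\<pi>. \<pi> \<in> ?I \<rightarrow>\<^sub>E D \<and> \<pi> ` ?I = D}" for \<pi> a
    using z[of \<pi> a] that by (cases "?W \<pi> a = 0") simp_all
  then have "polar_form n D (block sign n N \<gamma>) = 0" unfolding polar_form_block[OF D] by simp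
  then show False using nz by simp
qed

section \<open>Orthogonality to Schur functions of other shapes\<close>

text \<open>The easy half of the Gale-Ryser condition.\<close>

lemma block_cells_dominance:
  assumes D: "ydiag D" and inj: "inj_on \<rho> (block_cells N \<gamma>)" and sub: "\<rho> ` block_cells N \<gamma> \<subseteq> D"
    and dist: "\<And>p p'. p \<in> block_cells N \<gamma> \<Longrightarrow> p' \<in> block_cells N \<gamma> \<Longrightarrow> p \<noteq> p' \<Longrightarrow> fst p = fst p' \<Longrightarrow> snd (\<rho> p) \<noteq> snd (\<rho> p')"
    and k: "k \<le> N"
  shows "(\<Sum>i<k. \<gamma> i) \<le> card {p \<in> D. fst p < k}"
proof -
  let ?S = "\<rho> ` block_cells k \<gamma>" and ?C = "snd ` D" and ?R = "{p \<in> D. fst p < k}"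
  have ck: "block_cells k \<gamma> \<subseteq> block_cells N \<gamma>" using k by (auto simp: block_cells_def)
  have fin: "finite D" using D by (rule ydiag_finite)
  have fS: "finite ?S" by simp
  have SD: "?S \<subseteq> D" using sub ck by blast
  \<comment> \<open>A column receives at most one cell from each of the first \<open>k\<close>
    blocks, and no more cells than it has. The minimum of these bounds is its number of cells in the
    first \<open>k\<close> rows.\<close>
  have col: "card {p \<in> ?S. snd p = c} \<le> card {p \<in> ?R. snd p = c}" if c: "c \<in> ?C" for c
  proof -
    have R: "{p \<in> ?R. snd p = c} = (\<lambda>r. (r, c)) ` {..<min k (col_len D c)}"
      by (auto simp: mem_iff_col_len[OF D])
    then have cR: "card {p \<in> ?R. snd p = c} = min k (col_len D c)" by (simp add: card_image inj_on_def)
    have "card {p \<in> ?S. snd p = c} \<le> card ((\<lambda>r. (r, c)) ` {..<col_len D c})"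
    proof (intro card_mono subsetI)
      fix p assume "p \<in> {p \<in> ?S. snd p = c}"
      then have "p \<in> D" "p = (fst p, c)" using SD by auto
      then have "fst p < col_len D c" using mem_iff_col_len[OF D, of "fst p" c] by simp
      then show "p \<in> (\<lambda>r. (r, c)) ` {..<col_len D c}" using \<open>p = (fst p, c)\<close> by (intro image_eqI[of _ _ "fst p"]) auto
    qed simp
    then have 1: "card {p \<in> ?S. snd p = c} \<le> col_len D c" by (simp add: card_image inj_on_def)
    let ?Q = "{q \<in> block_cells k \<gamma>. snd (\<rho> q) = c}"
    have Q: "inj_on fst ?Q"
    proof (rule inj_onI)
      fix p p' assume "p \<in> ?Q" "p' \<in> ?Q" "fst p = fst p'"
      then show "p = p'" using dist[of p p'] subsetD[OF ck, of p] subsetD[OF ck, of p'] by (cases "p = p'") auto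
    qed
    have "card {p \<in> ?S. snd p = c} = card (\<rho> ` ?Q)" by (rule arg_cong[of _ _ card]) auto
    also have "\<dots> \<le> card ?Q" by (rule card_image_le) simp
    also have "\<dots> = card (fst ` ?Q)" using card_image[OF Q] by simp
    also have "\<dots> \<le> card {..<k}" by (intro card_mono) (auto simp: block_cells_def)
    finally show ?thesis using 1 cR by simp
  qed
  have sumcard: "card A = (\<Sum>c\<in>?C. card {p \<in> A. snd p = c})" if "A \<subseteq> D" for A
  proof -
    have "(\<Sum>c\<in>?C. \<Sum>p\<in>{p \<in> A. snd p = c}. 1) = (\<Sum>p\<in>A. (1::nat))"
      using that fin finite_subset[OF that] by (intro sum.group) auto
    then show ?thesis by simp
  qed
  have "(\<Sum>i<k. \<gamma> i) = card (block_cells k \<gamma>)" by (simp add: card_block_cells)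
  also have "\<dots> = card ?S" using inj_on_subset[OF inj ck] by (simp add: card_image)
  also have "\<dots> = (\<Sum>c\<in>?C. card {p \<in> ?S. snd p = c})" by (rule sumcard[OF SD])
  also have "\<dots> \<le> (\<Sum>c\<in>?C. card {p \<in> ?R. snd p = c})" by (rule sum_mono[OF col])
  also have "\<dots> = card ?R" by (rule sumcard[symmetric]) auto
  finally show ?thesis .
qed

lemma ydiag_swap: "ydiag D \<Longrightarrow> ydiag (prod.swap ` D)"
proof -
  assume D: "ydiag D"
  have sw: "(r, c) \<in> prod.swap ` D \<longleftrightarrow> (c, r) \<in> D" for r c
    by (metis image_eqI imageE swap_simp swap_swap)
  show ?thesis unfolding ydiag_def sw using ydiag_finite[OF D] ydiagD[OF D] by simp
qed

lemma polar_form_block_h_dominance: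
  assumes D: "ydiag D" and card: "(\<Sum>i<N. \<gamma> i) = card D" and nz: "polar_form n D (block (\<lambda>_. 1) n N \<gamma>) \<noteq> 0"
    and k: "k \<le> N"
  shows "(\<Sum>i<k. \<gamma> i) \<le> card {p \<in> D. fst p < k}"
proof -
  obtain \<rho> where r: "inj_on \<rho> (block_cells N \<gamma>)" "\<rho> ` block_cells N \<gamma> \<subseteq> D"
    and dist: "\<And>p p'. p \<in> block_cells N \<gamma> \<Longrightarrow> p' \<in> block_cells N \<gamma> \<Longrightarrow> p \<noteq> p' \<Longrightarrow> fst p = fst p' \<Longrightarrow> snd (\<rho> p) \<noteq> snd (\<rho> p')"
    using polar_form_block_h_nonzero[OF ydiag_finite[OF D] card nz] by blast
  show ?thesis by (rule block_cells_dominance[OF D r dist k])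
qed

lemma polar_form_block_e_dominance:
  assumes D: "ydiag D" and card: "(\<Sum>i<N. \<gamma> i) = card D" and nz: "polar_form n D (block sign n N \<gamma>) \<noteq> 0"
    and k: "k \<le> N"
  shows "(\<Sum>i<k. \<gamma> i) \<le> card {p \<in> D. snd p < k}"
proof -
  obtain \<rho> where r: "inj_on \<rho> (block_cells N \<gamma>)" "\<rho> ` block_cells N \<gamma> \<subseteq> D"
    and dist: "\<And>p p'. p \<in> block_cells N \<gamma> \<Longrightarrow> p' \<in> block_cells N \<gamma> \<Longrightarrow> p \<noteq> p' \<Longrightarrow> fst p = fst p' \<Longrightarrow> fst (\<rho> p) \<noteq> fst (\<rho> p')"
    using polar_form_block_e_nonzero[OF ydiag_finite[OF D] card nz] by blast
  have "(\<Sum>i<k. \<gamma> i) \<le> card {p \<in> prod.swap ` D. fst p < k}"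
  proof (rule block_cells_dominance[OF ydiag_swap[OF D] _ _ _ k])
    show "inj_on (prod.swap \<circ> \<rho>) (block_cells N \<gamma>)" using r(1) by (intro comp_inj_on) auto
    show "(prod.swap \<circ> \<rho>) ` block_cells N \<gamma> \<subseteq> prod.swap ` D" using r(2) by (auto simp: image_comp[symmetric])
    show "snd ((prod.swap \<circ> \<rho>) p) \<noteq> snd ((prod.swap \<circ> \<rho>) p')"
      if "p \<in> block_cells N \<gamma>" "p' \<in> block_cells N \<gamma>" "p \<noteq> p'" "fst p = fst p'" for p p'
      using dist[OF that] by simp
  qed
  also have "{p \<in> prod.swap ` D. fst p < k} = prod.swap ` {p \<in> D. snd p < k}" by auto
  also have "card \<dots> = card {p \<in> D. snd p < k}" by (simp add: card_image)
  finally show ?thesis .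
qed

text \<open>In the first row where the shapes differ, row dominance makes \<open>E\<close> the
  shorter one, of length \<open>?k\<close> say. All cells of \<open>E\<close> to the right of its
  first \<open>?k\<close> columns lie in earlier rows, where the shapes agree, so \<open>E\<close>
  has fewer cells there than \<open>D\<close>, hence more in the first \<open>?k\<close> columns,
  against column dominance.\<close>

lemma ydiag_eqI_dominance:
  assumes D: "ydiag D" and E: "ydiag E" and card: "card E = card D"
    and h: "\<And>k. card {p \<in> E. fst p < k} \<le> card {p \<in> D. fst p < k}"
    and e: "\<And>k. card {p \<in> E. snd p < k} \<le> card {p \<in> D. snd p < k}"
  shows "E = D"
proof (rule ccontr)
  assume ne: "E \<noteq> D"
  have fD: "finite D" "finite E" using D E by (auto intro: ydiag_finite)
  have ex: "\<exists>r. row_len D r \<noteq> row_len E r"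
  proof (rule ccontr)
    assume "\<not> ?thesis"
    then have "(r, c) \<in> E \<longleftrightarrow> (r, c) \<in> D" for r c by (simp add: mem_iff_row_len[OF D] mem_iff_row_len[OF E])
    then have "E = D" by auto
    then show False using ne by simp
  qed
  define r where "r = (LEAST r. row_len D r \<noteq> row_len E r)"
  have r: "row_len D r \<noteq> row_len E r" unfolding r_def using ex by (rule LeastI_ex)
  have lt: "row_len D i = row_len E i" if "i < r" for i using not_less_Least[OF that[unfolded r_def]] by simp
  have c: "card {p \<in> A. fst p < Suc r} = card {p \<in> A. fst p < r} + row_len A r" if A: "ydiag A" for A
  proof -
    have "{p \<in> A. fst p < Suc r} = {p \<in> A. fst p < r} \<union> {p \<in> A. fst p = r}" by auto
    then have "card {p \<in> A. fst p < Suc r} = card {p \<in> A. fst p < r} + card {p \<in> A. fst p = r}"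
      using ydiag_finite[OF A] by (simp only:) (rule card_Un_disjoint, auto)
    moreover have "{p \<in> A. fst p = r} = (\<lambda>c. (r, c)) ` {..<row_len A r}" by (auto simp: mem_iff_row_len[OF A])
    then have "card {p \<in> A. fst p = r} = row_len A r" by (simp add: card_image inj_on_def)
    ultimately show ?thesis by simp
  qed
  have same: "{p \<in> D. fst p < r} = {p \<in> E. fst p < r}" using lt by (auto simp: mem_iff_row_len[OF D] mem_iff_row_len[OF E])
  then have "row_len E r < row_len D r" using h[of "Suc r"] c[OF D] c[OF E] r by simp
  let ?k = "row_len E r"
  have "{p \<in> E. \<not> snd p < ?k} \<subseteq> {p \<in> D. \<not> snd p < ?k} - {(r, ?k)}"
  proof
    fix p assume p: "p \<in> {p \<in> E. \<not> snd p < ?k}"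
    obtain a b where [simp]: "p = (a, b)" by (cases p)
    have "a < r"
    proof (rule ccontr)
      assume "\<not> a < r"
      then have "row_len E a \<le> ?k" by (intro row_len_antimono[OF E]) simp
      then show False using p by (auto simp: mem_iff_row_len[OF E])
    qed
    then show "p \<in> {p \<in> D. \<not> snd p < ?k} - {(r, ?k)}" using p lt by (auto simp: mem_iff_row_len[OF E] mem_iff_row_len[OF D])
  qed
  then have "card {p \<in> E. \<not> snd p < ?k} \<le> card ({p \<in> D. \<not> snd p < ?k} - {(r, ?k)})" using fD by (intro card_mono) auto
  also have "\<dots> < card {p \<in> D. \<not> snd p < ?k}"
    using fD \<open>row_len E r < row_len D r\<close> by (intro card_Diff1_less) (auto simp: mem_iff_row_len[OF D])
  finally have "card {p \<in> E. \<not> snd p < ?k} < card {p \<in> D. \<not> snd p < ?k}" .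
  moreover have sp: "card A = card {p \<in> A. snd p < ?k} + card {p \<in> A. \<not> snd p < ?k}" if "finite A" for A :: "(nat \<times> nat) set"
  proof -
    have "A = {p \<in> A. snd p < ?k} \<union> {p \<in> A. \<not> snd p < ?k}" by auto
    then have "card A = card ({p \<in> A. snd p < ?k} \<union> {p \<in> A. \<not> snd p < ?k})" by simp
    also have "\<dots> = card {p \<in> A. snd p < ?k} + card {p \<in> A. \<not> snd p < ?k}"
      using that by (intro card_Un_disjoint) auto
    finally show ?thesis .
  qed
  ultimately show False using e[of ?k] card sp[OF fD(1)] sp[OF fD(2)] by linarith
qed

text \<open>The left side is the least sum of \<open>k\<close> distinct numbers. It follows that the
  degrees \<open>a i + w i - i\<close> of any nonzero Jacobi-Trudi term have initial sums at least
  as large as those of \<open>a\<close>.\<close>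

lemma sum_permutation_ge:
  fixes w :: "nat \<Rightarrow> nat"
  assumes w: "w permutes {..<N}" and k: "k \<le> N"
  shows "(\<Sum>i<k. i) \<le> (\<Sum>i<k. w i)"
proof -
  have gen: "(\<Sum>i<card S. i) \<le> \<Sum>S" if "finite S" for S :: "nat set"
    using that
  proof (induction "card S" arbitrary: S)
    case (Suc n)
    then have "S \<noteq> {}" by auto
    let ?m = "Max S"
    have m: "?m \<in> S" using Suc \<open>S \<noteq> {}\<close> by simp
    have "S \<subseteq> {..?m}" using Suc by auto
    then have "card S \<le> card {..?m}" by (intro card_mono) auto
    then have "n \<le> ?m" using Suc(2) by simp
    moreover have "(\<Sum>i<card (S - {?m}). i) \<le> \<Sum>(S - {?m})" using Suc m by (intro Suc(1)) auto
    moreover have "card (S - {?m}) = n" using Suc m by simp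
    moreover have "\<Sum>S = ?m + \<Sum>(S - {?m})" using Suc m by (intro sum.remove) auto
    moreover have "(\<Sum>i<card S. i) = n + (\<Sum>i<n. i)" unfolding Suc(2)[symmetric] by simp
    ultimately show ?case by simp
  qed simp
  have inj: "inj_on w {..<k}" using permutes_inj[OF w] by (rule inj_on_subset) simp
  have "(\<Sum>i<k. w i) = \<Sum>(w ` {..<k})" using sum.reindex[OF inj, of id] by simp
  then show ?thesis using gen[of "w ` {..<k}"] card_image[OF inj] by simp
qed

section \<open>Schur functions of the eigenvalues\<close>

definition eigs :: "nat \<Rightarrow> (nat \<Rightarrow> nat \<Rightarrow> complex) \<Rightarrow> nat \<Rightarrow> complex" where
  "eigs n A = (SOME x. \<exists>P P' T. tri_form n A P P' T \<and> x = (\<lambda>i. T i i))"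

lemma eigs: "\<exists>P P' T. tri_form n A P P' T \<and> eigs n A = (\<lambda>i. T i i)"
proof -
  obtain P P' T where "tri_form n A P P' T" using tri_form_exists by blast
  then have "\<exists>x P P' T. tri_form n A P P' T \<and> x = (\<lambda>i. T i i)" by blast
  then show ?thesis unfolding eigs_def by (rule someI_ex)
qed

text \<open>The order of the eigenvalues is fixed by choice, but the trace formula holds for every
  triangular form, so symmetric functions do not see the choice.\<close>

lemma block_h: "block (\<lambda>_. 1) n N \<gamma> A = (\<Prod>i<N. fact (\<gamma> i) * hsym n (eigs n A) (\<gamma> i))"
proof -
  obtain P P' T where T: "tri_form n A P P' T" "eigs n A = (\<lambda>i. T i i)" using eigs by blast
  show ?thesis unfolding block_def using hsym_cyc_trace[OF T(1)] T(2) by simp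
qed

lemma block_e: "block sign n N \<gamma> A = (\<Prod>i<N. fact (\<gamma> i) * esym n (eigs n A) (\<gamma> i))"
proof -
  obtain P P' T where T: "tri_form n A P P' T" "eigs n A = (\<lambda>i. T i i)" using eigs by blast
  show ?thesis unfolding block_def using esym_cyc_trace[OF T(1)] T(2) by simp
qed

text \<open>The degree of the \<open>i\<close>-th factor in the Jacobi-Trudi term of
  \<open>w\<close>. The truncated subtraction is faithful if \<open>i \<le> a i + w i\<close>; when
  this fails for some \<open>i\<close>, the whole term is zero.\<close>

definition jt_index :: "(nat \<Rightarrow> nat) \<Rightarrow> (nat \<Rightarrow> nat) \<Rightarrow> nat \<Rightarrow> nat" where
  "jt_index a w i = a i + w i - i"

lemma jt_index_sum:
  assumes "\<forall>i<N. i \<le> a i + w i" "k \<le> N"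
  shows "(\<Sum>i<k. jt_index a w i) + (\<Sum>i<k. i) = (\<Sum>i<k. a i) + (\<Sum>i<k. w i)"
  unfolding jt_index_def sum.distrib[symmetric] using assms by (intro sum.cong) auto

text \<open>Both Jacobi-Trudi expansions at once: \<open>gI\<close> stands for \<open>hsym_int\<close> or \<open>esym_int\<close>, \<open>a\<close> for the row or column lengths.\<close>

lemma polar_form_jacobi_trudi:
  assumes gI: "\<And>A k. gI A k = (if k < 0 then 0 else g A (nat k))"
    and bl: "\<And>\<gamma> A. block \<chi> n N \<gamma> A = (\<Prod>i<N. fact (\<gamma> i) * g A (\<gamma> i))"
  shows "polar_form n D (\<lambda>A. fdet {..<N} (\<lambda>i j. gI A (int (a i) + int j - int i))) =
    (\<Sum>w | w permutes {..<N}. if \<forall>i<N. i \<le> a i + w i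
       then of_int (sign w) / (\<Prod>i<N. fact (jt_index a w i)) * polar_form n D (block \<chi> n N (jt_index a w)) else 0)"
proof -
  have "polar_form n D (\<lambda>A. fdet {..<N} (\<lambda>i j. gI A (int (a i) + int j - int i))) =
     (\<Sum>w | w permutes {..<N}. of_int (sign w) * polar_form n D (\<lambda>A. \<Prod>i<N. gI A (int (a i) + int (w i) - int i)))"
    unfolding fdet_def polar_form_sum polar_form_cmult ..
  also have "\<dots> = (\<Sum>w | w permutes {..<N}. if \<forall>i<N. i \<le> a i + w i
       then of_int (sign w) / (\<Prod>i<N. fact (jt_index a w i)) * polar_form n D (block \<chi> n N (jt_index a w)) else 0)"
  proof (rule sum.cong[OF refl])
    fix w
    show "of_int (sign w) * polar_form n D (\<lambda>A. \<Prod>i<N. gI A (int (a i) + int (w i) - int i)) =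
      (if \<forall>i<N. i \<le> a i + w i
       then of_int (sign w) / (\<Prod>i<N. fact (jt_index a w i)) * polar_form n D (block \<chi> n N (jt_index a w)) else 0)"
    proof (cases "\<forall>i<N. i \<le> a i + w i")
      case True
      have "(\<Prod>i<N. gI A (int (a i) + int (w i) - int i)) = inverse (\<Prod>i<N. fact (jt_index a w i)) * block \<chi> n N (jt_index a w) A" for A
      proof -
        have "gI A (int (a i) + int (w i) - int i) = g A (jt_index a w i)" if "i < N" for i
        proof -
          have "int (a i) + int (w i) - int i = int (jt_index a w i)" using True that by (simp add: jt_index_def of_nat_diff)
          then show ?thesis by (simp add: gI)
        qed
        then show ?thesis by (simp add: bl prod.distrib)
      qed
      then show ?thesis using True by (simp add: polar_form_cmult divide_inverse)
    next
      case False
      then obtain i where "i < N" "a i + w i < i" by (auto simp: not_le)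
      then have z: "(\<Prod>i<N. gI A (int (a i) + int (w i) - int i)) = 0" for A
        by (intro prod_zero) (auto simp: gI intro!: bexI[of _ i])
      show ?thesis unfolding z if_not_P[OF False] by (simp add: polar_form_def)
    qed
  qed
  finally show ?thesis .
qed

lemma jt_index_total:
  assumes w: "w permutes {..<N}" and "\<forall>i<N. i \<le> a i + w i"
  shows "(\<Sum>i<N. jt_index a w i) = (\<Sum>i<N. a i)"
  using jt_index_sum[OF assms(2) order_refl] sum.permute[OF w, of "\<lambda>i. i"] by (simp add: o_def)

lemma ydiag_rows_bounded: "ydiag D \<Longrightarrow> \<exists>N0. \<forall>r\<ge>N0. row_len D r = 0"
proof -
  assume D: "ydiag D"
  have "row_len D r = 0" if "r \<ge> col_len D 0" for r using that mem_iff_row_len[OF D, of r 0] mem_iff_col_len[OF D, of r 0] by auto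
  then show ?thesis by blast
qed

lemma ydiag_cols_bounded: "ydiag D \<Longrightarrow> \<exists>N0. \<forall>c\<ge>N0. col_len D c = 0"
proof -
  assume D: "ydiag D"
  have "col_len D c = 0" if "c \<ge> row_len D 0" for c using that mem_iff_row_len[OF D, of 0 c] mem_iff_col_len[OF D, of 0 c] by auto
  then show ?thesis by blast
qed

lemma card_rows_below:
  assumes D: "ydiag D"
  shows "card {p \<in> D. fst p < k} = (\<Sum>i<k. row_len D i)"
proof -
  have "{p \<in> D. fst p < k} = Sigma {..<k} (\<lambda>r. {..<row_len D r})" by (auto simp: mem_iff_row_len[OF D])
  then show ?thesis by simp
qed

lemma card_cols_below:
  assumes D: "ydiag D"
  shows "card {p \<in> D. snd p < k} = (\<Sum>i<k. col_len D i)"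
proof -
  have "{p \<in> D. snd p < k} = prod.swap ` Sigma {..<k} (\<lambda>r. {..<col_len D r})" by (force simp: mem_iff_col_len[OF D])
  then show ?thesis by (simp add: card_image)
qed

abbreviation schur_eigs :: "nat \<Rightarrow> (nat \<times> nat) set \<Rightarrow> (nat \<Rightarrow> nat \<Rightarrow> complex) \<Rightarrow> complex" where
  "schur_eigs n E A \<equiv> schur_diag n E (eigs n A)"

lemma polar_form_schur_eigs_h:
  assumes E: "ydiag E" and N: "\<forall>r\<ge>N. row_len E r = 0"
  shows "polar_form n D (schur_eigs n E) = (\<Sum>w | w permutes {..<N}. if \<forall>i<N. i \<le> row_len E i + w i
       then of_int (sign w) / (\<Prod>i<N. fact (jt_index (row_len E) w i)) * polar_form n D (block (\<lambda>_. 1) n N (jt_index (row_len E) w)) else 0)"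
proof -
  have "schur_eigs n E = (\<lambda>A. fdet {..<N} (\<lambda>i j. hsym_int n (eigs n A) (int (row_len E i) + int j - int i)))"
    by (rule ext) (rule jacobi_trudi_h[OF E], simp add: N)
  then show ?thesis
    using polar_form_jacobi_trudi[of "\<lambda>A. hsym_int n (eigs n A)" "\<lambda>A. hsym n (eigs n A)" "\<lambda>_. 1" n N D "row_len E"]
    by (simp add: hsym_int_def block_h)
qed

lemma polar_form_schur_eigs_e:
  assumes E: "ydiag E" and N: "\<forall>r\<ge>N. col_len E r = 0"
  shows "polar_form n D (schur_eigs n E) = (\<Sum>w | w permutes {..<N}. if \<forall>i<N. i \<le> col_len E i + w i
       then of_int (sign w) / (\<Prod>i<N. fact (jt_index (col_len E) w i)) * polar_form n D (block sign n N (jt_index (col_len E) w)) else 0)"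
proof -
  have "schur_eigs n E = (\<lambda>A. fdet {..<N} (\<lambda>i j. esym_int n (eigs n A) (int (col_len E i) + int j - int i)))"
    by (rule ext) (rule jacobi_trudi_e[OF E], simp add: N)
  then show ?thesis
    using polar_form_jacobi_trudi[of "\<lambda>A. esym_int n (eigs n A)" "\<lambda>A. esym n (eigs n A)" sign n N D "col_len E"]
    by (simp add: esym_int_def block_e)
qed

lemma polar_form_schur_eigs_small:
  assumes D: "ydiag D" and E: "ydiag E" and card: "card E < card D"
  shows "polar_form n D (schur_eigs n E) = 0"
proof -
  obtain N where N: "\<forall>r\<ge>N. row_len E r = 0" using ydiag_rows_bounded[OF E] by blast
  have "polar_form n D (block (\<lambda>_. 1) n N (jt_index (row_len E) w)) = 0" if "w permutes {..<N}" "\<forall>i<N. i \<le> row_len E i + w i" for w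
    using card jt_index_total[OF that] card_eq_sum_row_len[OF E, of N] N by (intro polar_form_block_small ydiag_finite[OF D]) simp
  then show ?thesis unfolding polar_form_schur_eigs_h[OF E N] by (intro sum.neutral) auto
qed

text \<open>Some term of the determinant pairs nontrivially. Its degrees dominate the rows of
  \<open>E\<close> and are in turn dominated by the rows of \<open>D\<close>.\<close>

lemma polar_form_schur_eigs_h_dominance:
  assumes D: "ydiag D" and E: "ydiag E" and card: "card E = card D" and nz: "polar_form n D (schur_eigs n E) \<noteq> 0"
  shows "card {p \<in> E. fst p < k} \<le> card {p \<in> D. fst p < k}"
proof -
  obtain N0 where N0: "\<And>r. r \<ge> N0 \<Longrightarrow> row_len E r = 0" using ydiag_rows_bounded[OF E] by blast
  \<comment> \<open>Enlarging the determinant by trivial rows leaves it unchanged and makes room for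
    the first \<open>k\<close> blocks.\<close>
  define N where "N = max N0 k"
  have N: "\<forall>r\<ge>N. row_len E r = 0" and k: "k \<le> N" using N0 by (auto simp: N_def)
  have "\<exists>w. w permutes {..<N} \<and> (\<forall>i<N. i \<le> row_len E i + w i) \<and> polar_form n D (block (\<lambda>_. 1) n N (jt_index (row_len E) w)) \<noteq> 0"
  proof (rule ccontr)
    assume no: "\<not> ?thesis"
    have "polar_form n D (block (\<lambda>_. 1) n N (jt_index (row_len E) w)) = 0" if "w permutes {..<N}" "\<forall>i<N. i \<le> row_len E i + w i" for w
      using no that by blast
    then show False using nz unfolding polar_form_schur_eigs_h[OF E N] by (simp add: sum.neutral)
  qed
  then obtain w where w: "w permutes {..<N}" "\<forall>i<N. i \<le> row_len E i + w i" "polar_form n D (block (\<lambda>_. 1) n N (jt_index (row_len E) w)) \<noteq> 0" by blast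
  have "(\<Sum>i<N. jt_index (row_len E) w i) = card D"
    using jt_index_total[OF w(1,2)] card_eq_sum_row_len[OF E, of N] N card by simp
  then have "(\<Sum>i<k. jt_index (row_len E) w i) \<le> card {p \<in> D. fst p < k}"
    by (rule polar_form_block_h_dominance[OF D _ w(3) k])
  then show ?thesis
    using jt_index_sum[OF w(2) k] sum_permutation_ge[OF w(1) k] by (simp add: card_rows_below[OF E])
qed

lemma polar_form_schur_eigs_e_dominance:
  assumes D: "ydiag D" and E: "ydiag E" and card: "card E = card D" and nz: "polar_form n D (schur_eigs n E) \<noteq> 0"
  shows "card {p \<in> E. snd p < k} \<le> card {p \<in> D. snd p < k}"
proof -
  obtain N0 where N0: "\<And>r. r \<ge> N0 \<Longrightarrow> col_len E r = 0" using ydiag_cols_bounded[OF E] by blast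
  define N where "N = max N0 k"
  have N: "\<forall>r\<ge>N. col_len E r = 0" and k: "k \<le> N" using N0 by (auto simp: N_def)
  have "\<exists>w. w permutes {..<N} \<and> (\<forall>i<N. i \<le> col_len E i + w i) \<and> polar_form n D (block sign n N (jt_index (col_len E) w)) \<noteq> 0"
  proof (rule ccontr)
    assume no: "\<not> ?thesis"
    have "polar_form n D (block sign n N (jt_index (col_len E) w)) = 0" if "w permutes {..<N}" "\<forall>i<N. i \<le> col_len E i + w i" for w
      using no that by blast
    then show False using nz unfolding polar_form_schur_eigs_e[OF E N] by (simp add: sum.neutral)
  qed
  then obtain w where w: "w permutes {..<N}" "\<forall>i<N. i \<le> col_len E i + w i" "polar_form n D (block sign n N (jt_index (col_len E) w)) \<noteq> 0" by blast
  have "(\<Sum>i<N. jt_index (col_len E) w i) = card D"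
    using jt_index_total[OF w(1,2)] card_eq_sum_col_len[OF E, of N] N card by simp
  then have "(\<Sum>i<k. jt_index (col_len E) w i) \<le> card {p \<in> D. snd p < k}"
    by (rule polar_form_block_e_dominance[OF D _ w(3) k])
  then show ?thesis
    using jt_index_sum[OF w(2) k] sum_permutation_ge[OF w(1) k] by (simp add: card_cols_below[OF E])
qed

text \<open>A smaller shape has too low a degree, and for equal size the two Jacobi-Trudi expansions
  bound \<open>E\<close> by \<open>D\<close> in both directions. A shape with more cells than
  \<open>D\<close> can pair nontrivially, hence the bound on \<open>card E\<close>.\<close>

theorem polar_form_schur_eigs_orthogonal:
  assumes "ydiag D" "ydiag E" "card E \<le> card D" "E \<noteq> D"
  shows "polar_form n D (schur_eigs n E) = 0"
proof (rule ccontr)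
  assume nz: "polar_form n D (schur_eigs n E) \<noteq> 0"
  then have c: "card E = card D" using polar_form_schur_eigs_small[OF assms(1,2)] assms(3) by fastforce
  have "E = D"
    using ydiag_eqI_dominance[OF assms(1,2) c] polar_form_schur_eigs_h_dominance[OF assms(1,2) c nz]
      polar_form_schur_eigs_e_dominance[OF assms(1,2) c nz] by blast
  then show False using assms(4) by simp
qed

section \<open>Positivity\<close>

text \<open>Polarization is to match rows with cells by permutations of one set, so the rows are
  first renamed. Rows and columns are renamed together, which leaves all signs as they are.\<close>

lemma fdet_reindex:
  fixes M :: "'j \<Rightarrow> 'j \<Rightarrow> 'a :: comm_ring_1"
  assumes A: "finite A" and f: "bij_betw f A B"
  shows "fdet B M = fdet A (\<lambda>i j. M (f i) (f j))"
proof -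
  let ?h = "\<lambda>\<pi> x. if x \<in> B then f (\<pi> (inv_into A f x)) else x"
  have inj: "inj_on f A" and im: "f ` A = B" using f by (auto simp: bij_betw_def)
  have "fdet B M = (\<Sum>\<pi> | \<pi> permutes A. of_int (sign (?h \<pi>)) * (\<Prod>i\<in>B. M i (?h \<pi> i)))"
    unfolding fdet_def by (rule sum.reindex_bij_betw[OF bij_betw_permutations[OF f], symmetric])
  also have "\<dots> = fdet A (\<lambda>i j. M (f i) (f j))"
    unfolding fdet_def
  proof (rule sum.cong[OF refl])
    fix \<pi> assume "\<pi> \<in> {\<pi>. \<pi> permutes A}"
    then have p: "\<pi> permutes A" by simp
    have "?h \<pi> = map_permutation A f \<pi>"
      by (auto simp: map_permutation_def restrict_id_def im fun_eq_iff)
    then have 1: "sign (?h \<pi>) = sign \<pi>" using sign_map_permutation[OF inj p A] by simp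
    have "(\<Prod>i\<in>B. M i (?h \<pi> i)) = (\<Prod>i\<in>A. M (f i) (?h \<pi> (f i)))"
      by (rule prod.reindex_bij_betw[OF f, symmetric])
    also have "\<dots> = (\<Prod>i\<in>A. M (f i) (f (\<pi> i)))"
      using inj im by (intro prod.cong refl) auto
    finally show "of_int (sign (?h \<pi>)) * (\<Prod>i\<in>B. M i (?h \<pi> i)) = of_int (sign \<pi>) * (\<Prod>i\<in>A. M (f i) (f (\<pi> i)))"
      using 1 by simp
  qed
  finally show ?thesis .
qed

text \<open>
  Polarizing the determinant of a Gram-type matrix gives a sum over pairs of permutations
  that factors into squares; this is where positivity comes from.
\<close>

lemma polarized_gram_fdet:
  fixes b b' :: "'c \<Rightarrow> 'q \<Rightarrow> 'c \<Rightarrow> real" and wt :: "'c \<Rightarrow> real"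
  assumes C: "finite C" and Q: "\<And>c. c \<in> C \<Longrightarrow> finite (Q c)"
  shows "(\<Sum>B\<in>Pow C. (-1) ^ card (C - B) * fdet C (\<lambda>i j. \<Sum>c\<in>B. \<Sum>q\<in>Q c. wt c * b i q c * b' j q c)) =
    (\<Sum>q\<in>PiE C Q. (\<Prod>c\<in>C. wt c) *
      (\<Sum>\<tau> | \<tau> permutes C. of_int (sign \<tau>) * (\<Prod>c\<in>C. b (\<tau> c) (q c) c)) *
      (\<Sum>\<tau> | \<tau> permutes C. of_int (sign \<tau>) * (\<Prod>c\<in>C. b' (\<tau> c) (q c) c)))"
proof -
  let ?P = "{\<tau>. \<tau> permutes C}"
  let ?g = "\<lambda>\<sigma> i c. \<Sum>q\<in>Q c. wt c * b i q c * b' (\<sigma> i) q c"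
  let ?f = "\<lambda>q \<tau>. \<Prod>c\<in>C. b (\<tau> c) (q c) c" and ?f' = "\<lambda>q \<tau>. \<Prod>c\<in>C. b' (\<tau> c) (q c) c"
  have perm: "permutation p" if "p permutes C" for p using that C permutation_permutes by blast
  have pol: "(\<Sum>B\<in>Pow C. (-1) ^ card (C - B) * (\<Prod>i\<in>C. \<Sum>c\<in>B. ?g \<sigma> i c)) = (\<Sum>\<tau>\<in>?P. \<Prod>c\<in>C. ?g \<sigma> (\<tau> c) c)" for \<sigma>
  proof -
    have "\<pi> ` C = C \<longleftrightarrow> inj_on \<pi> C" if "\<pi> \<in> C \<rightarrow>\<^sub>E C" for \<pi>
    proof
      show "inj_on \<pi> C" if "\<pi> ` C = C" using C that by (intro eq_card_imp_inj_on) auto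
      have "\<pi> ` C \<subseteq> C" using PiE_mem[OF that] by blast
      then show "\<pi> ` C = C" if "inj_on \<pi> C" using C that by (intro endo_inj_surj)
    qed
    then have "{\<pi>. \<pi> \<in> C \<rightarrow>\<^sub>E C \<and> \<pi> ` C = C} = {\<pi> \<in> C \<rightarrow>\<^sub>E C. inj_on \<pi> C}"
      by blast
    then have "(\<Sum>B\<in>Pow C. (-1) ^ card (C - B) * (\<Prod>i\<in>C. \<Sum>c\<in>B. ?g \<sigma> i c)) =
        (\<Sum>\<pi>\<in>{\<pi> \<in> C \<rightarrow>\<^sub>E C. inj_on \<pi> C}. \<Prod>i\<in>C. ?g \<sigma> i (\<pi> i))"
      using polarization[OF C C, of "?g \<sigma>"] by simp
    also have "\<dots> = (\<Sum>\<pi>\<in>?P. \<Prod>i\<in>C. ?g \<sigma> i (restrict \<pi> C i))"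
      by (rule sum.reindex_bij_betw[OF bij_betw_permutes_PiE[OF C], symmetric])
    also have "\<dots> = (\<Sum>\<pi>\<in>?P. \<Prod>c\<in>C. ?g \<sigma> (inv_into UNIV \<pi> c) c)"
    proof (rule sum.cong[OF refl])
      fix \<pi> assume "\<pi> \<in> ?P"
      then have p: "\<pi> permutes C" by simp
      show "(\<Prod>i\<in>C. ?g \<sigma> i (restrict \<pi> C i)) = (\<Prod>c\<in>C. ?g \<sigma> (inv_into UNIV \<pi> c) c)"
        using prod.permute[OF p, of "\<lambda>c. ?g \<sigma> (inv_into UNIV \<pi> c) c"] permutes_inverses(2)[OF p] by (simp add: o_def)
    qed
    also have "\<dots> = (\<Sum>\<tau>\<in>?P. \<Prod>c\<in>C. ?g \<sigma> (\<tau> c) c)"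
      by (rule sum_permutations_inverse[symmetric])
    finally show ?thesis .
  qed
  have "(\<Sum>B\<in>Pow C. (-1) ^ card (C - B) * fdet C (\<lambda>i j. \<Sum>c\<in>B. \<Sum>q\<in>Q c. wt c * b i q c * b' j q c)) =
    (\<Sum>\<sigma>\<in>?P. of_int (sign \<sigma>) * (\<Sum>B\<in>Pow C. (-1) ^ card (C - B) * (\<Prod>i\<in>C. \<Sum>c\<in>B. ?g \<sigma> i c)))"
    unfolding fdet_def sum_distrib_left by (subst sum.swap) (simp only: mult.left_commute)
  also have "\<dots> = (\<Sum>\<sigma>\<in>?P. of_int (sign \<sigma>) * (\<Sum>\<tau>\<in>?P. \<Prod>c\<in>C. ?g \<sigma> (\<tau> c) c))"
    by (simp only: pol)
  also have "\<dots> = (\<Sum>\<sigma>\<in>?P. of_int (sign \<sigma>) * (\<Sum>\<tau>\<in>?P. \<Sum>q\<in>PiE C Q. (\<Prod>c\<in>C. wt c) * ?f q \<tau> * ?f' q (\<sigma> \<circ> \<tau>)))"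
    using C Q by (simp add: prod_sum_PiE prod.distrib)
  also have "\<dots> = (\<Sum>\<tau>\<in>?P. \<Sum>\<sigma>\<in>?P. \<Sum>q\<in>PiE C Q. of_int (sign \<sigma>) * ((\<Prod>c\<in>C. wt c) * ?f q \<tau> * ?f' q (\<sigma> \<circ> \<tau>)))"
    unfolding sum_distrib_left by (rule sum.swap)
  \<comment> \<open>Here \<open>\<tau>\<close> matches cells with rows and \<open>\<sigma>\<close>
    comes from the determinant. Replacing \<open>\<sigma> \<circ> \<tau>\<close> by
    \<open>\<sigma>\<close> matches cells with columns independently, and the sign splits
    accordingly.\<close>
  also have "\<dots> = (\<Sum>\<tau>\<in>?P. \<Sum>\<sigma>\<in>?P. \<Sum>q\<in>PiE C Q. of_int (sign \<tau>) * of_int (sign \<sigma>) * ((\<Prod>c\<in>C. wt c) * ?f q \<tau> * ?f' q \<sigma>))"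
  proof (rule sum.cong[OF refl])
    fix \<tau> assume "\<tau> \<in> ?P"
    then have t: "\<tau> permutes C" by simp
    let ?h = "\<lambda>\<sigma>. \<Sum>q\<in>PiE C Q. of_int (sign \<tau>) * of_int (sign \<sigma>) * ((\<Prod>c\<in>C. wt c) * ?f q \<tau> * ?f' q \<sigma>)"
    have "sum ?h ?P = (\<Sum>\<sigma>\<in>?P. ?h (\<sigma> \<circ> \<tau>))" by (rule sum_permutations_compose_right[OF t])
    also have "\<dots> = (\<Sum>\<sigma>\<in>?P. \<Sum>q\<in>PiE C Q. of_int (sign \<sigma>) * ((\<Prod>c\<in>C. wt c) * ?f q \<tau> * ?f' q (\<sigma> \<circ> \<tau>)))"
    proof (intro sum.cong refl)
      fix \<sigma> q assume "\<sigma> \<in> ?P"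
      then have s: "\<sigma> permutes C" by simp
      have "sign \<tau> * sign (\<sigma> \<circ> \<tau>) = sign \<sigma>"
        by (simp add: sign_compose[OF perm[OF s] perm[OF t]])
      then have "of_int (sign \<tau>) * of_int (sign (\<sigma> \<circ> \<tau>)) = (of_int (sign \<sigma>) :: real)" by (metis of_int_mult)
      then show "of_int (sign \<tau>) * of_int (sign (\<sigma> \<circ> \<tau>)) * ((\<Prod>c\<in>C. wt c) * ?f q \<tau> * ?f' q (\<sigma> \<circ> \<tau>)) =
        of_int (sign \<sigma>) * ((\<Prod>c\<in>C. wt c) * ?f q \<tau> * ?f' q (\<sigma> \<circ> \<tau>))" by (simp only:)
    qed
    finally show "(\<Sum>\<sigma>\<in>?P. \<Sum>q\<in>PiE C Q. of_int (sign \<sigma>) * ((\<Prod>c\<in>C. wt c) * ?f q \<tau> * ?f' q (\<sigma> \<circ> \<tau>))) = sum ?h ?P" ..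
  qed
  also have "\<dots> = (\<Sum>\<tau>\<in>?P. \<Sum>q\<in>PiE C Q. \<Sum>\<sigma>\<in>?P. of_int (sign \<tau>) * of_int (sign \<sigma>) * ((\<Prod>c\<in>C. wt c) * ?f q \<tau> * ?f' q \<sigma>))"
    by (intro sum.cong refl sum.swap)
  also have "\<dots> = (\<Sum>q\<in>PiE C Q. \<Sum>\<tau>\<in>?P. \<Sum>\<sigma>\<in>?P. of_int (sign \<tau>) * of_int (sign \<sigma>) * ((\<Prod>c\<in>C. wt c) * ?f q \<tau> * ?f' q \<sigma>))"
    by (rule sum.swap)
  also have "\<dots> = (\<Sum>q\<in>PiE C Q. (\<Prod>c\<in>C. wt c) * (\<Sum>\<tau>\<in>?P. of_int (sign \<tau>) * ?f q \<tau>) * (\<Sum>\<sigma>\<in>?P. of_int (sign \<sigma>) * ?f' q \<sigma>))"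
    unfolding mult.assoc sum_product unfolding sum_distrib_left by (intro sum.cong refl) (simp only: mult_ac)
  finally show ?thesis .
qed

text \<open>For each choice \<open>q\<close> the polarized determinant is a function of
  \<open>t\<close> times the same function of \<open>t'\<close>. Weighted by \<open>V\<close> and
  summed over \<open>t\<close> and \<open>t'\<close>, it becomes a square.\<close>

lemma polarized_gram_nonneg:
  fixes b :: "'t \<Rightarrow> 'i \<Rightarrow> 'q \<Rightarrow> 'c \<Rightarrow> real" and wt :: "'c \<Rightarrow> real" and V :: "'t \<Rightarrow> real"
  assumes C: "finite C" and I: "finite I" "card I = card C"
    and Q: "\<And>c. c \<in> C \<Longrightarrow> finite (Q c)" and wt: "\<And>c. c \<in> C \<Longrightarrow> wt c \<ge> 0"
  shows "(\<Sum>t\<in>U. \<Sum>t'\<in>U. V t * V t' * (\<Sum>B\<in>Pow C. (-1) ^ card (C - B) *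
     fdet I (\<lambda>i j. \<Sum>c\<in>B. \<Sum>q\<in>Q c. wt c * b t i q c * b t' j q c))) \<ge> 0"
proof -
  obtain f where f: "bij_betw f C I" using C I by (metis finite_same_card_bij)
  let ?H = "\<lambda>t q. \<Sum>\<tau> | \<tau> permutes C. of_int (sign \<tau>) * (\<Prod>c\<in>C. b t (f (\<tau> c)) (q c) c)"
  have g: "(\<Sum>B\<in>Pow C. (-1) ^ card (C - B) * fdet I (\<lambda>i j. \<Sum>c\<in>B. \<Sum>q\<in>Q c. wt c * b t i q c * b t' j q c)) =
     (\<Sum>q\<in>PiE C Q. (\<Prod>c\<in>C. wt c) * ?H t q * ?H t' q)" for t t'
    unfolding fdet_reindex[OF C f] by (rule polarized_gram_fdet[OF C Q])
  have "(\<Sum>t\<in>U. \<Sum>t'\<in>U. V t * V t' * (\<Sum>q\<in>PiE C Q. (\<Prod>c\<in>C. wt c) * ?H t q * ?H t' q)) =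
     (\<Sum>t\<in>U. \<Sum>t'\<in>U. \<Sum>q\<in>PiE C Q. (\<Prod>c\<in>C. wt c) * ((V t * ?H t q) * (V t' * ?H t' q)))"
  proof (intro sum.cong refl)
    fix t t'
    have "x * y * (\<Sum>q\<in>PiE C Q. (\<Prod>c\<in>C. wt c) * h q * h' q) = (\<Sum>q\<in>PiE C Q. (\<Prod>c\<in>C. wt c) * ((x * h q) * (y * h' q)))"
      for x y :: real and h h' :: "('c \<Rightarrow> 'q) \<Rightarrow> real"
      by (simp add: sum_distrib_left mult_ac)
    then show "V t * V t' * (\<Sum>q\<in>PiE C Q. (\<Prod>c\<in>C. wt c) * ?H t q * ?H t' q) =
      (\<Sum>q\<in>PiE C Q. (\<Prod>c\<in>C. wt c) * ((V t * ?H t q) * (V t' * ?H t' q)))" .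
  qed
  also have "\<dots> = (\<Sum>t\<in>U. \<Sum>q\<in>PiE C Q. \<Sum>t'\<in>U. (\<Prod>c\<in>C. wt c) * ((V t * ?H t q) * (V t' * ?H t' q)))"
    by (intro sum.cong refl sum.swap)
  also have "\<dots> = (\<Sum>q\<in>PiE C Q. \<Sum>t\<in>U. \<Sum>t'\<in>U. (\<Prod>c\<in>C. wt c) * ((V t * ?H t q) * (V t' * ?H t' q)))"
    by (rule sum.swap)
  also have "\<dots> = (\<Sum>q\<in>PiE C Q. (\<Prod>c\<in>C. wt c) * ((\<Sum>t\<in>U. V t * ?H t q) * (\<Sum>t\<in>U. V t * ?H t q)))"
  proof (intro sum.cong refl)
    fix q
    have "(\<Sum>t\<in>U. \<Sum>t'\<in>U. w * (h t * h t')) = w * ((\<Sum>t\<in>U. h t) * (\<Sum>t\<in>U. h t))" for w :: real and h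
      unfolding sum_product by (simp only: sum_distrib_left)
    then show "(\<Sum>t\<in>U. \<Sum>t'\<in>U. (\<Prod>c\<in>C. wt c) * ((V t * ?H t q) * (V t' * ?H t' q))) =
      (\<Prod>c\<in>C. wt c) * ((\<Sum>t\<in>U. V t * ?H t q) * (\<Sum>t\<in>U. V t * ?H t q))" .
  qed
  also have "\<dots> \<ge> 0" using wt by (intro sum_nonneg mult_nonneg_nonneg prod_nonneg zero_le_square)
  finally show ?thesis unfolding g .
qed

section \<open>Positivity of the self-pairing\<close>

definition relabel :: "nat \<Rightarrow> (nat \<Rightarrow> nat) \<Rightarrow> (nat \<Rightarrow> nat \<Rightarrow> nat) \<Rightarrow> (nat \<Rightarrow> nat \<Rightarrow> nat) \<Rightarrow> nat \<Rightarrow> nat \<Rightarrow> nat" where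
  "relabel N \<gamma> a \<sigma> = restrict (\<lambda>i. restrict (\<lambda>l. a i (\<sigma> i l)) {..<\<gamma> i}) {..<N}"

definition block_comp :: "nat \<Rightarrow> (nat \<Rightarrow> nat \<Rightarrow> nat) \<Rightarrow> (nat \<Rightarrow> nat \<Rightarrow> nat) \<Rightarrow> nat \<Rightarrow> nat \<Rightarrow> nat" where
  "block_comp N \<sigma> \<tau> = restrict (\<lambda>i. \<sigma> i \<circ> \<tau> i) {..<N}"

lemma relabel_block_labels:
  assumes a: "a \<in> block_labels n N \<gamma>" and s: "\<sigma> \<in> block_perms N \<gamma>"
  shows "relabel N \<gamma> a \<sigma> \<in> block_labels n N \<gamma>"
proof -
  have "a i (\<sigma> i l) \<in> {1..n}" if "i < N" "l < \<gamma> i" for i l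
  proof -
    have "a i \<in> {..<\<gamma> i} \<rightarrow>\<^sub>E {1..n}" using PiE_mem[OF a[unfolded block_labels_def], of i] that by simp
    moreover have "\<sigma> i l \<in> {..<\<gamma> i}" using permutes_in_image[OF block_permsD[OF s that(1)], of l] that by simp
    ultimately show ?thesis by (rule PiE_mem)
  qed
  then show ?thesis unfolding relabel_def block_labels_def by (simp only: restrict_PiE_iff lessThan_iff) simp
qed

lemma block_comp_block_perms: "\<sigma> \<in> block_perms N \<gamma> \<Longrightarrow> \<tau> \<in> block_perms N \<gamma> \<Longrightarrow> block_comp N \<sigma> \<tau> \<in> block_perms N \<gamma>"
  using block_permsD[of \<sigma> N \<gamma>] block_permsD[of \<tau> N \<gamma>]
  unfolding block_comp_def block_perms_def[of N \<gamma>] by (simp add: permutes_compose)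

text \<open>The product of the permutation groups of the blocks, a Young subgroup, acts on
  labellings from the right.\<close>

lemma relabel_relabel:
  assumes "\<tau> \<in> block_perms N \<gamma>"
  shows "relabel N \<gamma> (relabel N \<gamma> a \<sigma>) \<tau> = relabel N \<gamma> a (block_comp N \<sigma> \<tau>)"
  unfolding relabel_def block_comp_def
  using block_permsD[OF assms] permutes_in_image by (auto simp: fun_eq_iff restrict_def) fastforce+

lemma block_inv_exists:
  assumes "\<sigma> \<in> block_perms N \<gamma>"
  shows "\<exists>\<tau>\<in>block_perms N \<gamma>. block_comp N \<sigma> \<tau> = restrict (\<lambda>_. id) {..<N} \<and> block_comp N \<tau> \<sigma> = restrict (\<lambda>_. id) {..<N}"
proof -
  let ?t = "restrict (\<lambda>i. inv_into UNIV (\<sigma> i)) {..<N}"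
  have "?t \<in> block_perms N \<gamma>" using permutes_inv[OF block_permsD[OF assms]] unfolding block_perms_def by simp
  moreover have "block_comp N \<sigma> ?t = restrict (\<lambda>_. id) {..<N}" "block_comp N ?t \<sigma> = restrict (\<lambda>_. id) {..<N}"
    using permutes_inv_o[OF block_permsD[OF assms]] by (auto simp: block_comp_def fun_eq_iff restrict_def)
  ultimately show ?thesis by blast
qed

lemma relabel_id:
  assumes a: "a \<in> block_labels n N \<gamma>"
  shows "relabel N \<gamma> a (restrict (\<lambda>_. id) {..<N}) = a"
proof
  fix i
  show "relabel N \<gamma> a (restrict (\<lambda>_. id) {..<N}) i = a i"
  proof (cases "i < N")
    case True
    then have "a i \<in> {..<\<gamma> i} \<rightarrow>\<^sub>E {1..n}" using PiE_mem[OF a[unfolded block_labels_def], of i] by simp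
    then have "restrict (a i) {..<\<gamma> i} = a i" by (rule PiE_restrict)
    then show ?thesis using True by (simp add: relabel_def)
  next
    case False
    then have "a i = undefined" using PiE_arb[OF a[unfolded block_labels_def], of i] by simp
    then show ?thesis using False by (simp add: relabel_def)
  qed
qed

lemma bij_betw_relabel:
  assumes s: "\<sigma> \<in> block_perms N \<gamma>"
  shows "bij_betw (\<lambda>a. relabel N \<gamma> a \<sigma>) (block_labels n N \<gamma>) (block_labels n N \<gamma>)"
proof -
  obtain \<tau> where t: "\<tau> \<in> block_perms N \<gamma>" "block_comp N \<sigma> \<tau> = restrict (\<lambda>_. id) {..<N}" "block_comp N \<tau> \<sigma> = restrict (\<lambda>_. id) {..<N}"
    using block_inv_exists[OF s] by blast
  show ?thesis
    by (rule bij_betw_byWitness[where f' = "\<lambda>a. relabel N \<gamma> a \<tau>"])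
      (simp_all add: relabel_relabel[OF s] relabel_relabel[OF t(1)] t relabel_id relabel_block_labels[OF _ s] relabel_block_labels[OF _ t(1)] image_subsetI)
qed

lemma bij_betw_block_comp:
  assumes s: "\<sigma> \<in> block_perms N \<gamma>"
  shows "bij_betw (block_comp N \<sigma>) (block_perms N \<gamma>) (block_perms N \<gamma>)"
proof (rule bij_betw_imageI)
  obtain \<tau> where t: "\<tau> \<in> block_perms N \<gamma>" "block_comp N \<sigma> \<tau> = restrict (\<lambda>_. id) {..<N}" "block_comp N \<tau> \<sigma> = restrict (\<lambda>_. id) {..<N}"
    using block_inv_exists[OF s] by blast
  have c: "block_comp N \<tau> (block_comp N \<sigma> \<rho>) = \<rho>" if r: "\<rho> \<in> block_perms N \<gamma>" for \<rho>
  proof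
    fix i
    show "block_comp N \<tau> (block_comp N \<sigma> \<rho>) i = \<rho> i"
    proof (cases "i < N")
      case True
      then have "\<tau> i \<circ> \<sigma> i = id" using fun_cong[OF t(3), of i] by (simp add: block_comp_def)
      then show ?thesis using True by (simp add: block_comp_def o_assoc)
    next
      case False
      then have "\<rho> i = undefined" using PiE_arb[OF r[unfolded block_perms_def], of i] by simp
      then show ?thesis using False by (simp add: block_comp_def)
    qed
  qed
  show inj: "inj_on (block_comp N \<sigma>) (block_perms N \<gamma>)" by (rule inj_on_inverseI[of _ "block_comp N \<tau>"]) (rule c)
  show "block_comp N \<sigma> ` block_perms N \<gamma> = block_perms N \<gamma>"
    using block_comp_block_perms[OF s] by (intro endo_inj_surj[OF finite_block_perms _ inj]) auto
qed

text \<open>Summation over a finite group is a multiple of an orthogonal projection: the group sum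
  is invariant under relabelling, so averaging the other factor turns the quadratic form into a sum
  of squares.\<close>

lemma polar_form_block_h_nonneg_term:
  fixes W :: "(nat \<Rightarrow> nat \<Rightarrow> nat) \<Rightarrow> int"
  shows "int (card (block_perms N \<gamma>)) * (\<Sum>a\<in>block_labels n N \<gamma>. W a * (\<Sum>\<sigma>\<in>block_perms N \<gamma>. W (relabel N \<gamma> a \<sigma>))) =
    (\<Sum>a\<in>block_labels n N \<gamma>. (\<Sum>\<sigma>\<in>block_perms N \<gamma>. W (relabel N \<gamma> a \<sigma>)) * (\<Sum>\<sigma>\<in>block_perms N \<gamma>. W (relabel N \<gamma> a \<sigma>)))"
proof -
  let ?Z = "\<lambda>a. \<Sum>\<sigma>\<in>block_perms N \<gamma>. W (relabel N \<gamma> a \<sigma>)"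
  have Z: "?Z (relabel N \<gamma> a \<sigma>) = ?Z a" if s: "\<sigma> \<in> block_perms N \<gamma>" for a \<sigma>
  proof -
    have "?Z (relabel N \<gamma> a \<sigma>) = (\<Sum>\<tau>\<in>block_perms N \<gamma>. W (relabel N \<gamma> a (block_comp N \<sigma> \<tau>)))"
      by (intro sum.cong refl arg_cong[of _ _ W] relabel_relabel)
    also have "\<dots> = ?Z a" by (rule sum.reindex_bij_betw[OF bij_betw_block_comp[OF s], where g = "\<lambda>\<tau>. W (relabel N \<gamma> a \<tau>)"])
    finally show ?thesis .
  qed
  have "int (card (block_perms N \<gamma>)) * (\<Sum>a\<in>block_labels n N \<gamma>. W a * ?Z a) = (\<Sum>\<sigma>\<in>block_perms N \<gamma>. \<Sum>a\<in>block_labels n N \<gamma>. W a * ?Z a)"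
    by simp
  also have "\<dots> = (\<Sum>\<sigma>\<in>block_perms N \<gamma>. \<Sum>a\<in>block_labels n N \<gamma>. W (relabel N \<gamma> a \<sigma>) * ?Z a)"
  proof (rule sum.cong[OF refl])
    fix \<sigma> assume s: "\<sigma> \<in> block_perms N \<gamma>"
    have "(\<Sum>a\<in>block_labels n N \<gamma>. W a * ?Z a) = (\<Sum>a\<in>block_labels n N \<gamma>. W (relabel N \<gamma> a \<sigma>) * ?Z (relabel N \<gamma> a \<sigma>))"
      by (rule sum.reindex_bij_betw[OF bij_betw_relabel[OF s], where g = "\<lambda>a. W a * ?Z a", symmetric])
    then show "(\<Sum>a\<in>block_labels n N \<gamma>. W a * ?Z a) = (\<Sum>a\<in>block_labels n N \<gamma>. W (relabel N \<gamma> a \<sigma>) * ?Z a)"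
      by (simp only: Z[OF s])
  qed
  also have "\<dots> = (\<Sum>a\<in>block_labels n N \<gamma>. ?Z a * ?Z a)"
    by (subst sum.swap) (simp only: sum_distrib_right)
  finally show ?thesis .
qed

text \<open>With the rows of \<open>D\<close> as blocks, the value times the order of the Young
  subgroup is a sum of squares, so a single nonzero square suffices.\<close>

lemma polar_form_block_h_pos:
  assumes D: "ydiag D" and n: "\<forall>r\<ge>n. row_len D r = 0"
  shows "\<exists>p>0. polar_form n D (block (\<lambda>_. 1) n n (row_len D)) = of_int p"
proof -
  have fD: "finite D" using D by (rule ydiag_finite)
  let ?\<gamma> = "row_len D"
  have cD: "block_cells n ?\<gamma> = D" using ydiag_eq_rows[OF D, of n] n by (auto simp: block_cells_def)
  let ?G = "block_perms n ?\<gamma>" and ?A = "block_labels n n ?\<gamma>"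
  let ?S = "{\<pi>. \<pi> \<in> D \<rightarrow>\<^sub>E D \<and> \<pi> ` D = D}"
  let ?W = "\<lambda>\<pi> a. antisym_pairing n D D \<pi> (\<lambda>p. a (fst p) (snd p))"
  let ?Z = "\<lambda>\<pi> a. \<Sum>\<sigma>\<in>?G. ?W \<pi> (relabel n ?\<gamma> a \<sigma>)"
  have mD: "fst p < n \<and> snd p < ?\<gamma> (fst p)" if "p \<in> D" for p
  proof -
    have "p \<in> block_cells n ?\<gamma>" using that by (simp only: cD)
    then show ?thesis by (auto simp: block_cells_def)
  qed
  have W': "antisym_pairing n D D \<pi> (\<lambda>p. a (fst p) (\<sigma> (fst p) (snd p))) = ?W \<pi> (relabel n ?\<gamma> a \<sigma>)" for \<pi> a \<sigma>
    by (rule antisym_pairing_cong) (simp add: relabel_def mD)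
  define K where "K = (\<Sum>\<pi>\<in>?S. \<Sum>a\<in>?A. ?W \<pi> a * ?Z \<pi> a)"
  have polar_form: "polar_form n D (block (\<lambda>_. 1) n n ?\<gamma>) = of_int K"
    unfolding polar_form_block[OF fD] cD W' K_def by simp
  have fS: "finite ?S" by (rule finite_subset[of _ "D \<rightarrow>\<^sub>E D"]) (use fD in \<open>auto intro: finite_PiE\<close>)
  have sq: "int (card ?G) * K = (\<Sum>\<pi>\<in>?S. \<Sum>a\<in>?A. ?Z \<pi> a * ?Z \<pi> a)"
    unfolding K_def sum_distrib_left[of _ _ ?S] by (intro sum.cong refl polar_form_block_h_nonneg_term)
  \<comment> \<open>The witness matches every cell with itself and labels each row by its number.
    The labels are constant on blocks, so relabelling has no effect and every group element
    contributes 1.\<close>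
  let ?\<pi> = "restrict id D" and ?a = "restrict (\<lambda>i. restrict (\<lambda>l. Suc i) {..<?\<gamma> i}) {..<n}"
  have p0: "?\<pi> \<in> ?S" by auto
  have a0: "?a \<in> ?A" unfolding block_labels_def by (simp only: restrict_PiE_iff) auto
  have idG: "restrict (\<lambda>_. id) {..<n} \<in> ?G" unfolding block_perms_def by (simp add: permutes_id)
  then have cG: "card ?G > 0" using finite_block_perms card_gt_0_iff by blast
  have "?W ?\<pi> (relabel n ?\<gamma> ?a \<sigma>) = 1" if s: "\<sigma> \<in> ?G" for \<sigma>
  proof -
    have "\<sigma> (fst p) (snd p) < ?\<gamma> (fst p)" if "p \<in> D" for p
      using permutes_in_image[OF block_permsD[OF s, of "fst p"], of "snd p"] mD[OF that] by simp
    then have "?W ?\<pi> (relabel n ?\<gamma> ?a \<sigma>) = antisym_pairing n D D ?\<pi> (\<lambda>c. Suc (fst c))"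
      by (intro antisym_pairing_cong) (simp add: relabel_def mD)
    then show ?thesis using antisym_pairing_fst[OF fD] mD by simp
  qed
  then have Z0: "?Z ?\<pi> ?a = int (card ?G)" by simp
  have "0 < ?Z ?\<pi> ?a * ?Z ?\<pi> ?a" unfolding Z0 using cG by simp
  also have "\<dots> \<le> (\<Sum>a\<in>?A. ?Z ?\<pi> a * ?Z ?\<pi> a)"
    by (rule member_le_sum[OF a0 _ finite_block_labels]) (rule zero_le_square)
  also have "\<dots> \<le> (\<Sum>\<pi>\<in>?S. \<Sum>a\<in>?A. ?Z \<pi> a * ?Z \<pi> a)"
    by (rule member_le_sum[OF p0 _ fS]) (intro sum_nonneg zero_le_square)
  finally have "K > 0" using sq cG by (metis zero_less_mult_pos of_nat_0_less_iff)
  then show ?thesis using polar_form by blast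
qed

text \<open>Only the identity survives in the Jacobi-Trudi sum: any other \<open>w\<close> moves its
  first non-fixed point \<open>i0\<close> upwards, so the degrees up to \<open>i0\<close> exceed
  what row dominance by \<open>D\<close> permits. Dividing by the factorials of the row lengths
  keeps the sign.\<close>

theorem polar_form_schur_eigs_self:
  assumes D: "ydiag D" and n: "\<forall>r\<ge>n. row_len D r = 0"
  shows "\<exists>p>0. polar_form n D (schur_eigs n D) = of_real p"
proof -
  let ?t = "\<lambda>w. if \<forall>i<n. i \<le> row_len D i + w i
       then of_int (sign w) / (\<Prod>i<n. fact (jt_index (row_len D) w i)) * polar_form n D (block (\<lambda>_. 1) n n (jt_index (row_len D) w)) else 0"
  have "?t w = 0" if w: "w permutes {..<n}" "w \<noteq> id" for w
  proof (rule ccontr)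
    assume nz: "?t w \<noteq> 0"
    then have a: "\<forall>i<n. i \<le> row_len D i + w i" and nz': "polar_form n D (block (\<lambda>_. 1) n n (jt_index (row_len D) w)) \<noteq> 0"
      by (auto split: if_splits)
    have ex: "\<exists>i. w i \<noteq> i" using w(2) by (auto simp: fun_eq_iff)
    define i0 where "i0 = (LEAST i. w i \<noteq> i)"
    have i0: "w i0 \<noteq> i0" unfolding i0_def using ex by (rule LeastI_ex)
    have lt: "w i = i" if "i < i0" for i using not_less_Least[OF that[unfolded i0_def]] by simp
    have "i0 < n" using i0 w(1) by (metis lessThan_iff permutes_not_in)
    have "w i0 > i0"
    proof (rule ccontr)
      assume "\<not> w i0 > i0"
      then have "w i0 < i0" using i0 by simp
      then have "w (w i0) = w i0" by (rule lt)
      then have "w i0 = i0" using permutes_inj[OF w(1)] by (simp add: inj_eq)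
      then show False using i0 by simp
    qed
    then have "(\<Sum>i<Suc i0. w i) > (\<Sum>i<Suc i0. i)" using lt by simp
    moreover have "(\<Sum>i<n. jt_index (row_len D) w i) = card D"
      using jt_index_total[OF w(1) a] card_eq_sum_row_len[OF D, of n] n by simp
    then have "(\<Sum>i<Suc i0. jt_index (row_len D) w i) \<le> card {p \<in> D. fst p < Suc i0}"
      by (rule polar_form_block_h_dominance[OF D _ nz']) (use \<open>i0 < n\<close> in simp)
    moreover have "(\<Sum>i<Suc i0. jt_index (row_len D) w i) + (\<Sum>i<Suc i0. i) = (\<Sum>i<Suc i0. row_len D i) + (\<Sum>i<Suc i0. w i)"
      by (rule jt_index_sum[OF a]) (use \<open>i0 < n\<close> in simp)
    ultimately show False unfolding card_rows_below[OF D] by linarith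
  qed
  then have "polar_form n D (schur_eigs n D) = ?t id"
    unfolding polar_form_schur_eigs_h[OF D n]
    by (subst sum.remove[of _ id]) (auto simp: finite_permutations permutes_id intro!: sum.neutral)
  moreover have "jt_index (row_len D) id = row_len D" by (simp add: jt_index_def fun_eq_iff)
  moreover obtain p :: int where p: "p > 0" "polar_form n D (block (\<lambda>_. 1) n n (row_len D)) = of_int p"
    using polar_form_block_h_pos[OF D n] by blast
  ultimately have "polar_form n D (schur_eigs n D) = of_real (of_int p / (\<Prod>i<n. fact (row_len D i)))"
    by (simp add: of_real_prod)
  then show ?thesis using p(1) by (intro exI[of _ "of_int p / (\<Prod>i<n. fact (row_len D i))"]) (auto intro!: divide_pos_pos prod_pos)
qed

section \<open>The Kronecker sum as a Gram matrix\<close>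

definition ext_index :: "nat \<Rightarrow> nat set \<Rightarrow> (nat \<times> (nat \<Rightarrow> nat)) set" where
  "ext_index j X = Sigma {..<j} (\<lambda>l. ({..<j} - {l}) \<rightarrow>\<^sub>E X)"

text \<open>The index \<open>q\<close> records a slot and the basis vectors in all other slots; the
  missing slot is filled with \<open>a\<close>.\<close>

definition ext_coeff :: "nat \<Rightarrow> nat \<times> (nat \<Rightarrow> nat) \<Rightarrow> nat \<Rightarrow> nat set \<Rightarrow> real" where
  "ext_coeff j q a S = of_int (wedge_sign j ((snd q)(fst q := a)) S)"

lemma finite_ext_index: "finite X \<Longrightarrow> finite (ext_index j X)"
  unfolding ext_index_def by (intro finite_SigmaI finite_PiE) auto

text \<open>A unit matrix selects one \<open>a\<close> and one \<open>b\<close> in the definition,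
  so each term separates into a factor with \<open>S\<close> and \<open>t\<close> and the same
  factor with \<open>R\<close> and \<open>t'\<close>.\<close>

lemma deriv_ext_unitsum:
  assumes X: "finite X" and B: "finite B" "\<And>c. c \<in> B \<Longrightarrow> t c \<in> X" "\<And>c. c \<in> B \<Longrightarrow> t' c \<in> X"
  shows "deriv_ext j X (unitsum B t t') S R =
    (\<Sum>c\<in>B. \<Sum>q\<in>ext_index j X. 1 / fact j * ext_coeff j q (t c) S * ext_coeff j q (t' c) R)"
proof -
  let ?g = "\<lambda>a b. \<Sum>l<j. \<Sum>k\<in>({..<j} - {l}) \<rightarrow>\<^sub>E X. of_int (wedge_sign j (k(l := a)) S) * of_int (wedge_sign j (k(l := b)) R) :: real"
  have g: "?g a b = (\<Sum>q\<in>ext_index j X. ext_coeff j q a S * ext_coeff j q b R)" for a b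
    unfolding ext_index_def ext_coeff_def using X
    by (subst sum.Sigma) (auto simp: case_prod_unfold intro: finite_PiE)
  have "(\<Sum>a\<in>X. \<Sum>b\<in>X. unitsum B t t' a b * h a b) = (\<Sum>c\<in>B. h (t c) (t' c))" for h :: "nat \<Rightarrow> nat \<Rightarrow> real"
  proof -
    have "(\<Sum>a\<in>X. \<Sum>b\<in>X. unitsum B t t' a b * h a b) = (\<Sum>a\<in>X. \<Sum>b\<in>X. \<Sum>c\<in>B. if t c = a then if t' c = b then h a b else 0 else 0)"
      unfolding unitsum_def sum_distrib_right by (intro sum.cong refl) auto
    also have "\<dots> = (\<Sum>a\<in>X. \<Sum>c\<in>B. \<Sum>b\<in>X. if t c = a then if t' c = b then h a b else 0 else 0)"
      by (intro sum.cong refl sum.swap)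
    also have "\<dots> = (\<Sum>c\<in>B. \<Sum>a\<in>X. \<Sum>b\<in>X. if t c = a then if t' c = b then h a b else 0 else 0)"
      by (rule sum.swap)
    also have "\<dots> = (\<Sum>c\<in>B. h (t c) (t' c))"
    proof (rule sum.cong[OF refl])
      fix c assume c: "c \<in> B"
      have "(\<Sum>b\<in>X. if t c = a then if t' c = b then h a b else 0 else 0) = (if t c = a then h a (t' c) else 0)" for a
        using B(3)[OF c] X by (cases "t c = a") (simp_all add: sum.delta')
      then show "(\<Sum>a\<in>X. \<Sum>b\<in>X. if t c = a then if t' c = b then h a b else 0 else 0) = h (t c) (t' c)"
        using B(2)[OF c] X by (simp add: sum.delta')
    qed
    finally show ?thesis .
  qed
  from this[of ?g] show ?thesis
    unfolding deriv_ext_def g by (simp add: sum_divide_distrib sum_distrib_left)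
qed

lemma deriv_ext_of_real: "deriv_ext j X (\<lambda>a b. complex_of_real (A a b)) S R = of_real (deriv_ext j X A S R)"
  by (simp add: deriv_ext_def)

lemma fdet_of_real: "fdet I (\<lambda>i j. complex_of_real (M i j)) = of_real (fdet I M)"
  by (simp add: fdet_def)

lemma unitsum_of_real: "(unitsum B t t' :: nat \<Rightarrow> nat \<Rightarrow> complex) = (\<lambda>a b. of_real (unitsum B t t' a b))"
  by (intro ext) (simp add: unitsum_def of_real_sum if_distrib[of of_real] cong: if_cong)

text \<open>Triangularization requires complex numbers, while the squares are to be real. At sums of
  unit matrices the Kronecker sum has real entries, which reconciles the two.\<close>

lemma kronsum_of_real:
  "kronsum j k X Y (\<lambda>a b. complex_of_real (A a b)) (\<lambda>a b. complex_of_real (B a b)) I J = of_real (kronsum j k X Y A B I J)"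
  by (simp add: kronsum_def deriv_ext_of_real)

lemma bij_betw_Plus_Pow:
  "bij_betw (\<lambda>(B1, B2). B1 <+> B2) (Pow D1 \<times> Pow D2) (Pow (D1 <+> D2))"
proof (rule bij_betw_byWitness[where f' = "\<lambda>B. (Inl -` B, Inr -` B)"])
  show "\<forall>B\<in>Pow D1 \<times> Pow D2. (Inl -` (case B of (B1, B2) \<Rightarrow> B1 <+> B2), Inr -` (case B of (B1, B2) \<Rightarrow> B1 <+> B2)) = B"
    by auto
  show "\<forall>B\<in>Pow (D1 <+> D2). (case (Inl -` B, Inr -` B) of (B1, B2) \<Rightarrow> B1 <+> B2) = B"
    by (auto simp: Plus_def)
  show "(\<lambda>(B1, B2). B1 <+> B2) ` (Pow D1 \<times> Pow D2) \<subseteq> Pow (D1 <+> D2)" by auto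
  show "(\<lambda>B. (Inl -` B, Inr -` B)) ` Pow (D1 <+> D2) \<subseteq> Pow D1 \<times> Pow D2" by auto
qed

text \<open>The two polarizations merge into one over the disjoint union of the cells, whose number
  equals the size of the determinant, so that the Gram argument applies to both alphabets at
  once.\<close>

theorem polar_form_kronsum_nonneg:
  assumes D: "finite D1" "finite D2"
    and card: "card (Sub j {1..n} \<times> Sub k {1..m}) = card D1 + card D2"
  shows "\<exists>p\<ge>0. polar_form n D1 (\<lambda>A. polar_form m D2 (\<lambda>B.
    fdet (Sub j {1..n} \<times> Sub k {1..m}) (kronsum j k {1..n} {1..m} A B))) = of_real p"
proof -
  let ?X = "{1..n}" and ?Y = "{1..m}"
  let ?I = "Sub j ?X \<times> Sub k ?Y"
  let ?C = "D1 <+> D2"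
  let ?U1 = "D1 \<rightarrow>\<^sub>E ?X" and ?U2 = "D2 \<rightarrow>\<^sub>E ?Y"
  \<comment> \<open>The second component of an index handles the identity factor of the Kronecker
    sum: equality of two subsets is the sum over \<open>U\<close> of the product of their indicators
    at \<open>U\<close>, hence of Gram type too.\<close>
  define Q where "Q = (\<lambda>c :: (nat \<times> nat) + (nat \<times> nat). case c of
      Inl _ \<Rightarrow> ext_index j ?X \<times> Sub k ?Y | Inr _ \<Rightarrow> ext_index k ?Y \<times> Sub j ?X)"
  define wt where "wt = (\<lambda>c :: (nat \<times> nat) + (nat \<times> nat). case c of
      Inl _ \<Rightarrow> 1 / fact j | Inr _ \<Rightarrow> 1 / (fact k :: real))"
  define b where "b = (\<lambda>(t :: (nat \<times> nat \<Rightarrow> nat) \<times> (nat \<times> nat \<Rightarrow> nat)) (I :: nat set \<times> nat set) (q :: (nat \<times> (nat \<Rightarrow> nat)) \<times> nat set) c. case c of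
      Inl c \<Rightarrow> ext_coeff j (fst q) (fst t c) (fst I) * (if snd I = snd q then 1 else 0)
    | Inr c \<Rightarrow> ext_coeff k (fst q) (snd t c) (snd I) * (if fst I = snd q then 1 else 0))"
  define M where "M = (\<lambda>t t' B I J. \<Sum>c\<in>B. \<Sum>q\<in>Q c. wt c * b t I q c * b t' J q c)"
  have fQ: "finite (Q c)" for c by (cases c) (auto simp: Q_def finite_ext_index finite_Sub)
  have fI: "finite ?I" by (simp add: finite_Sub)
  have gram: "kronsum j k ?X ?Y (unitsum B1 t1 t1') (unitsum B2 t2 t2') I J = M (t1, t2) (t1', t2') (B1 <+> B2) I J"
    if B: "B1 \<subseteq> D1" "B2 \<subseteq> D2" and t: "t1 \<in> ?U1" "t1' \<in> ?U1" "t2 \<in> ?U2" "t2' \<in> ?U2" and I: "I \<in> ?I" and J: "J \<in> ?I"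
    for B1 B2 t1 t1' t2 t2' I J
  proof -
    have fB: "finite B1" "finite B2" using B D by (auto intro: finite_subset)
    have delta: "(\<Sum>U\<in>S. (if a = U then 1 else 0) * (if a' = U then 1 else 0)) = (if a = a' then 1 else (0::real))"
      if "finite S" "a \<in> S" for a a' and S :: "nat set set"
      using sum_delta_mult[OF that, of "\<lambda>U. if a' = U then 1 else 0"] by (cases "a = a'") simp_all
    have m1: "t1 c \<in> ?X" "t1' c \<in> ?X" if "c \<in> B1" for c using that B(1) PiE_mem[OF t(1)] PiE_mem[OF t(2)] by blast+
    have m2: "t2 c \<in> ?Y" "t2' c \<in> ?Y" if "c \<in> B2" for c using that B(2) PiE_mem[OF t(3)] PiE_mem[OF t(4)] by blast+
    have 1: "(\<Sum>q\<in>Q (Inl c). wt (Inl c) * b (t1, t2) I q (Inl c) * b (t1', t2') J q (Inl c)) =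
        (\<Sum>q\<in>ext_index j ?X. 1 / fact j * ext_coeff j q (t1 c) (fst I) * ext_coeff j q (t1' c) (fst J)) * (if snd I = snd J then 1 else 0)" for c
    proof -
      have "(\<Sum>q\<in>Q (Inl c). wt (Inl c) * b (t1, t2) I q (Inl c) * b (t1', t2') J q (Inl c)) =
        (\<Sum>q\<in>ext_index j ?X. \<Sum>U\<in>Sub k ?Y. (1 / fact j * ext_coeff j q (t1 c) (fst I) * ext_coeff j q (t1' c) (fst J)) *
          ((if snd I = U then 1 else 0) * (if snd J = U then 1 else 0)))"
        unfolding sum.cartesian_product by (simp add: Q_def wt_def b_def case_prod_unfold mult_ac)
      also have "\<dots> = (\<Sum>q\<in>ext_index j ?X. 1 / fact j * ext_coeff j q (t1 c) (fst I) * ext_coeff j q (t1' c) (fst J)) *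
         (\<Sum>U\<in>Sub k ?Y. (if snd I = U then 1 else 0) * (if snd J = U then 1 else 0))"
        by (rule sum_product[symmetric])
      finally show ?thesis using I delta[of "Sub k ?Y" "snd I" "snd J"] by (simp add: finite_Sub mem_Times_iff)
    qed
    have 2: "(\<Sum>q\<in>Q (Inr c). wt (Inr c) * b (t1, t2) I q (Inr c) * b (t1', t2') J q (Inr c)) =
        (\<Sum>q\<in>ext_index k ?Y. 1 / fact k * ext_coeff k q (t2 c) (snd I) * ext_coeff k q (t2' c) (snd J)) * (if fst I = fst J then 1 else 0)" for c
    proof -
      have "(\<Sum>q\<in>Q (Inr c). wt (Inr c) * b (t1, t2) I q (Inr c) * b (t1', t2') J q (Inr c)) =
        (\<Sum>q\<in>ext_index k ?Y. \<Sum>U\<in>Sub j ?X. (1 / fact k * ext_coeff k q (t2 c) (snd I) * ext_coeff k q (t2' c) (snd J)) *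
          ((if fst I = U then 1 else 0) * (if fst J = U then 1 else 0)))"
        unfolding sum.cartesian_product by (simp add: Q_def wt_def b_def case_prod_unfold mult_ac)
      also have "\<dots> = (\<Sum>q\<in>ext_index k ?Y. 1 / fact k * ext_coeff k q (t2 c) (snd I) * ext_coeff k q (t2' c) (snd J)) *
         (\<Sum>U\<in>Sub j ?X. (if fst I = U then 1 else 0) * (if fst J = U then 1 else 0))"
        by (rule sum_product[symmetric])
      finally show ?thesis using I delta[of "Sub j ?X" "fst I" "fst J"] by (simp add: finite_Sub mem_Times_iff)
    qed
    have "M (t1, t2) (t1', t2') (B1 <+> B2) I J =
        deriv_ext j ?X (unitsum B1 t1 t1') (fst I) (fst J) * (if snd I = snd J then 1 else 0) +
        deriv_ext k ?Y (unitsum B2 t2 t2') (snd I) (snd J) * (if fst I = fst J then 1 else 0)"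
    proof -
      have P: "(\<Sum>c\<in>B1 <+> B2. h c) = (\<Sum>c\<in>B1. h (Inl c)) + (\<Sum>c\<in>B2. h (Inr c))" for h :: "_ \<Rightarrow> real"
        using sum.Plus[OF fB, of h] by (simp add: o_def)
      have d1: "deriv_ext j ?X (unitsum B1 t1 t1') S R =
          (\<Sum>c\<in>B1. \<Sum>q\<in>ext_index j ?X. 1 / fact j * ext_coeff j q (t1 c) S * ext_coeff j q (t1' c) R)" for S R
        by (rule deriv_ext_unitsum[OF _ fB(1) m1]) auto
      have d2: "deriv_ext k ?Y (unitsum B2 t2 t2') S R =
          (\<Sum>c\<in>B2. \<Sum>q\<in>ext_index k ?Y. 1 / fact k * ext_coeff k q (t2 c) S * ext_coeff k q (t2' c) R)" for S R
        by (rule deriv_ext_unitsum[OF _ fB(2) m2]) auto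
      show ?thesis unfolding M_def P 1 2 d1 d2 sum_distrib_right ..
    qed
    then show ?thesis by (simp add: kronsum_def)
  qed
  let ?V = "\<lambda>t. of_int (antisym_coeff D1 (fst t)) * of_int (antisym_coeff D2 (snd t)) :: real"
  let ?F = "\<lambda>t t' B. fdet ?I (M t t' B)"
  define p where "p = (\<Sum>t\<in>?U1 \<times> ?U2. \<Sum>t'\<in>?U1 \<times> ?U2. ?V t * ?V t' * (\<Sum>B\<in>Pow ?C. (-1) ^ card (?C - B) * ?F t t' B))"
  have "p \<ge> 0"
    unfolding p_def M_def using D fI card fQ
    by (intro polarized_gram_nonneg) (auto simp: card_Plus wt_def split: sum.split)
  moreover have "polar_form n D1 (\<lambda>A. polar_form m D2 (\<lambda>B. fdet ?I (kronsum j k ?X ?Y A B))) = of_real p"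
  proof -
    have sg: "(-1) ^ card (?C - (B1 <+> B2)) = ((-1) ^ card (D1 - B1) * (-1) ^ card (D2 - B2) :: real)" for B1 B2
    proof -
      have "?C - (B1 <+> B2) = (D1 - B1) <+> (D2 - B2)" by auto
      then show ?thesis using D by (simp add: card_Plus power_add)
    qed
    have F: "fdet ?I (kronsum j k ?X ?Y (unitsum B1 t1 t1') (unitsum B2 t2 t2')) = complex_of_real (?F (t1, t2) (t1', t2') (B1 <+> B2))"
      if "B1 \<in> Pow D1" "B2 \<in> Pow D2" "t1 \<in> ?U1" "t1' \<in> ?U1" "t2 \<in> ?U2" "t2' \<in> ?U2" for B1 B2 t1 t1' t2 t2'
    proof -
      have "fdet ?I (kronsum j k ?X ?Y (unitsum B1 t1 t1') (unitsum B2 t2 t2')) =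
          fdet ?I (\<lambda>I J. complex_of_real (kronsum j k ?X ?Y (unitsum B1 t1 t1') (unitsum B2 t2 t2') I J))"
        unfolding unitsum_of_real by (rule fdet_cong) (rule kronsum_of_real)
      also have "\<dots> = complex_of_real (fdet ?I (kronsum j k ?X ?Y (unitsum B1 t1 t1') (unitsum B2 t2 t2')))"
        by (rule fdet_of_real)
      also have "fdet ?I (kronsum j k ?X ?Y (unitsum B1 t1 t1') (unitsum B2 t2 t2')) = ?F (t1, t2) (t1', t2') (B1 <+> B2)"
        using that by (intro fdet_cong gram) auto
      finally show ?thesis .
    qed
    let ?G = "\<lambda>t1 t1' t2 t2' B1 B2. of_int (antisym_coeff D1 t1) * of_int (antisym_coeff D2 t2) * (of_int (antisym_coeff D1 t1') * of_int (antisym_coeff D2 t2')) *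
       ((-1) ^ card (D1 - B1) * (-1) ^ card (D2 - B2) * ?F (t1, t2) (t1', t2') (B1 <+> B2)) :: real"
    have "p = (\<Sum>(t1, t2)\<in>?U1 \<times> ?U2. \<Sum>(t1', t2')\<in>?U1 \<times> ?U2. \<Sum>(B1, B2)\<in>Pow D1 \<times> Pow D2. ?G t1 t1' t2 t2' B1 B2)"
      unfolding p_def case_prod_unfold
    proof (intro sum.cong refl)
      fix t t'
      have "(\<Sum>B\<in>Pow ?C. (-1) ^ card (?C - B) * ?F t t' B) =
         (\<Sum>Bs\<in>Pow D1 \<times> Pow D2. (-1) ^ card (?C - (case Bs of (B1, B2) \<Rightarrow> B1 <+> B2)) * ?F t t' (case Bs of (B1, B2) \<Rightarrow> B1 <+> B2))"
        by (rule sum.reindex_bij_betw[OF bij_betw_Plus_Pow, symmetric])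
      then show "?V t * ?V t' * (\<Sum>B\<in>Pow ?C. (-1) ^ card (?C - B) * ?F t t' B) =
        (\<Sum>Bs\<in>Pow D1 \<times> Pow D2. ?G (fst t) (fst t') (snd t) (snd t') (fst Bs) (snd Bs))"
        by (simp add: case_prod_unfold sg sum_distrib_left)
    qed
    also have "\<dots> = (\<Sum>t1\<in>?U1. \<Sum>t2\<in>?U2. \<Sum>t1'\<in>?U1. \<Sum>t2'\<in>?U2. \<Sum>B1\<in>Pow D1. \<Sum>B2\<in>Pow D2. ?G t1 t1' t2 t2' B1 B2)"
      by (simp only: sum.cartesian_product[symmetric])
    \<comment> \<open>The nested pairing sums over everything belonging to the first alphabet before
      the second.\<close>
    also have "\<dots> = (\<Sum>t1\<in>?U1. \<Sum>t1'\<in>?U1. \<Sum>B1\<in>Pow D1. \<Sum>t2\<in>?U2. \<Sum>t2'\<in>?U2. \<Sum>B2\<in>Pow D2. ?G t1 t1' t2 t2' B1 B2)"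
    proof (rule sum.cong[OF refl])
      fix t1
      have "(\<Sum>t2\<in>?U2. \<Sum>t1'\<in>?U1. \<Sum>t2'\<in>?U2. \<Sum>B1\<in>Pow D1. \<Sum>B2\<in>Pow D2. ?G t1 t1' t2 t2' B1 B2) =
         (\<Sum>t2\<in>?U2. \<Sum>t1'\<in>?U1. \<Sum>B1\<in>Pow D1. \<Sum>t2'\<in>?U2. \<Sum>B2\<in>Pow D2. ?G t1 t1' t2 t2' B1 B2)"
        by (intro sum.cong refl sum.swap)
      also have "\<dots> = (\<Sum>t1'\<in>?U1. \<Sum>t2\<in>?U2. \<Sum>B1\<in>Pow D1. \<Sum>t2'\<in>?U2. \<Sum>B2\<in>Pow D2. ?G t1 t1' t2 t2' B1 B2)"
        by (rule sum.swap)
      also have "\<dots> = (\<Sum>t1'\<in>?U1. \<Sum>B1\<in>Pow D1. \<Sum>t2\<in>?U2. \<Sum>t2'\<in>?U2. \<Sum>B2\<in>Pow D2. ?G t1 t1' t2 t2' B1 B2)"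
        by (intro sum.cong refl sum.swap)
      finally show "(\<Sum>t2\<in>?U2. \<Sum>t1'\<in>?U1. \<Sum>t2'\<in>?U2. \<Sum>B1\<in>Pow D1. \<Sum>B2\<in>Pow D2. ?G t1 t1' t2 t2' B1 B2) =
        (\<Sum>t1'\<in>?U1. \<Sum>B1\<in>Pow D1. \<Sum>t2\<in>?U2. \<Sum>t2'\<in>?U2. \<Sum>B2\<in>Pow D2. ?G t1 t1' t2 t2' B1 B2)" .
    qed
    finally have "complex_of_real p = (\<Sum>t1\<in>?U1. \<Sum>t1'\<in>?U1. \<Sum>B1\<in>Pow D1. \<Sum>t2\<in>?U2. \<Sum>t2'\<in>?U2. \<Sum>B2\<in>Pow D2. of_real (?G t1 t1' t2 t2' B1 B2))"
      by (simp only: of_real_sum)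
    also have "\<dots> = (\<Sum>t1\<in>?U1. \<Sum>t1'\<in>?U1. \<Sum>B1\<in>Pow D1. \<Sum>t2\<in>?U2. \<Sum>t2'\<in>?U2. \<Sum>B2\<in>Pow D2.
        of_int (antisym_coeff D1 t1) * of_int (antisym_coeff D1 t1') * ((-1) ^ card (D1 - B1) * (of_int (antisym_coeff D2 t2) * of_int (antisym_coeff D2 t2') * ((-1) ^ card (D2 - B2) *
          fdet ?I (kronsum j k ?X ?Y (unitsum B1 t1 t1') (unitsum B2 t2 t2'))))))"
    proof (intro sum.cong refl)
      fix t1 t1' B1 t2 t2' B2
      assume a: "t1 \<in> ?U1" "t1' \<in> ?U1" "B1 \<in> Pow D1" "t2 \<in> ?U2" "t2' \<in> ?U2" "B2 \<in> Pow D2"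
      show "complex_of_real (?G t1 t1' t2 t2' B1 B2) =
        of_int (antisym_coeff D1 t1) * of_int (antisym_coeff D1 t1') * ((-1) ^ card (D1 - B1) * (of_int (antisym_coeff D2 t2) * of_int (antisym_coeff D2 t2') * ((-1) ^ card (D2 - B2) *
          fdet ?I (kronsum j k ?X ?Y (unitsum B1 t1 t1') (unitsum B2 t2 t2')))))"
        unfolding F[OF a(3,6,1,2,4,5)] by (simp add: mult_ac)
    qed
    also have "\<dots> = polar_form n D1 (\<lambda>A. polar_form m D2 (\<lambda>B. fdet ?I (kronsum j k ?X ?Y A B)))"
      unfolding polar_form_def by (simp only: sum_distrib_left)
    finally show ?thesis ..
  qed
  ultimately show ?thesis by blast
qed

section \<open>Schur expansion of symmetric polynomials\<close>

type_synonym expo = "(nat + nat) \<Rightarrow>\<^sub>0 nat"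

definition mono_eval :: "(nat + nat \<Rightarrow> 'b) \<Rightarrow> expo \<Rightarrow> 'b::comm_ring_1" where
  "mono_eval \<phi> e = (\<Prod>v\<in>Poly_Mapping.keys e. \<phi> v ^ Poly_Mapping.lookup e v)"

text \<open>The target ring is left open because the map serves twice: to insert eigenvalues, and to
  permute variables within the polynomial ring itself.\<close>

definition peval :: "(nat + nat \<Rightarrow> 'b) \<Rightarrow> xy_poly \<Rightarrow> 'b::comm_ring_1" where
  "peval \<phi> f = (\<Sum>e\<in>Poly_Mapping.keys f. of_int (Poly_Mapping.lookup f e) * mono_eval \<phi> e)"

lemma mono_eval_superset: "finite A \<Longrightarrow> Poly_Mapping.keys e \<subseteq> A \<Longrightarrow> mono_eval \<phi> e = (\<Prod>v\<in>A. \<phi> v ^ Poly_Mapping.lookup e v)"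
  unfolding mono_eval_def by (rule prod.mono_neutral_left) (auto simp: in_keys_iff)

lemma mono_eval_add: "mono_eval \<phi> (e + e') = mono_eval \<phi> e * mono_eval \<phi> e'"
proof -
  let ?A = "Poly_Mapping.keys e \<union> Poly_Mapping.keys e'"
  have "mono_eval \<phi> (e + e') = (\<Prod>v\<in>?A. \<phi> v ^ Poly_Mapping.lookup (e + e') v)"
    by (rule mono_eval_superset) (auto dest: subsetD[OF keys_add])
  also have "\<dots> = (\<Prod>v\<in>?A. \<phi> v ^ Poly_Mapping.lookup e v) * (\<Prod>v\<in>?A. \<phi> v ^ Poly_Mapping.lookup e' v)"
    by (simp add: lookup_add power_add prod.distrib)
  also have "\<dots> = mono_eval \<phi> e * mono_eval \<phi> e'"
    by (subst (1 2) mono_eval_superset[of ?A]) auto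
  finally show ?thesis .
qed

lemma peval_superset: "finite A \<Longrightarrow> Poly_Mapping.keys f \<subseteq> A \<Longrightarrow> peval \<phi> f = (\<Sum>e\<in>A. of_int (Poly_Mapping.lookup f e) * mono_eval \<phi> e)"
  unfolding peval_def by (rule sum.mono_neutral_left) (auto simp: in_keys_iff)

lemma peval_add: "peval \<phi> (f + g) = peval \<phi> f + peval \<phi> g"
proof -
  let ?A = "Poly_Mapping.keys f \<union> Poly_Mapping.keys g"
  have "peval \<phi> (f + g) = (\<Sum>e\<in>?A. of_int (Poly_Mapping.lookup (f + g) e) * mono_eval \<phi> e)"
    by (rule peval_superset) (auto dest: subsetD[OF keys_add])
  also have "\<dots> = (\<Sum>e\<in>?A. of_int (Poly_Mapping.lookup f e) * mono_eval \<phi> e) + (\<Sum>e\<in>?A. of_int (Poly_Mapping.lookup g e) * mono_eval \<phi> e)"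
    by (simp add: lookup_add algebra_simps sum.distrib)
  also have "\<dots> = peval \<phi> f + peval \<phi> g"
    by (subst (1 2) peval_superset[of ?A]) auto
  finally show ?thesis .
qed

lemma peval_0 [simp]: "peval \<phi> 0 = 0"
  by (simp add: peval_def)

lemma peval_sum: "peval \<phi> (sum F S) = (\<Sum>s\<in>S. peval \<phi> (F s))"
  by (induction S rule: infinite_finite_induct) (auto simp: peval_add)

lemma peval_single: "peval \<phi> (Poly_Mapping.single e c) = of_int c * mono_eval \<phi> e"
  by (simp add: peval_def)

lemma sum_single_keys: "f = (\<Sum>e\<in>Poly_Mapping.keys f. Poly_Mapping.single e (Poly_Mapping.lookup f e))"
proof (rule poly_mapping_eqI)
  fix e
  have "Poly_Mapping.lookup (\<Sum>e\<in>Poly_Mapping.keys f. Poly_Mapping.single e (Poly_Mapping.lookup f e)) e = (\<Sum>e'\<in>Poly_Mapping.keys f. if e' = e then Poly_Mapping.lookup f e else 0)"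
    unfolding lookup_sum by (intro sum.cong refl) (auto simp: lookup_single when_def)
  also have "\<dots> = Poly_Mapping.lookup f e" by (simp add: in_keys_iff)
  finally show "Poly_Mapping.lookup f e = Poly_Mapping.lookup (\<Sum>e\<in>Poly_Mapping.keys f. Poly_Mapping.single e (Poly_Mapping.lookup f e)) e" ..
qed

lemma peval_mult: "peval \<phi> (f * g) = peval \<phi> f * peval \<phi> g"
proof -
  have "f * g = (\<Sum>e\<in>Poly_Mapping.keys f. Poly_Mapping.single e (Poly_Mapping.lookup f e)) * (\<Sum>e\<in>Poly_Mapping.keys g. Poly_Mapping.single e (Poly_Mapping.lookup g e))"
    using sum_single_keys[of f] sum_single_keys[of g] by simp
  also have "\<dots> = (\<Sum>e\<in>Poly_Mapping.keys f. \<Sum>e'\<in>Poly_Mapping.keys g. Poly_Mapping.single (e + e') (Poly_Mapping.lookup f e * Poly_Mapping.lookup g e'))"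
    by (simp add: sum_product mult_single)
  finally have "peval \<phi> (f * g) = (\<Sum>e\<in>Poly_Mapping.keys f. \<Sum>e'\<in>Poly_Mapping.keys g. (of_int (Poly_Mapping.lookup f e) * mono_eval \<phi> e) * (of_int (Poly_Mapping.lookup g e') * mono_eval \<phi> e'))"
    by (simp add: peval_sum peval_single mono_eval_add mult_ac)
  then show ?thesis by (simp add: peval_def sum_product)
qed

lemma peval_1 [simp]: "peval \<phi> 1 = 1"
  using peval_single[of \<phi> 0 1] by (simp add: mono_eval_def)

lemma peval_prod: "peval \<phi> (prod F S) = (\<Prod>s\<in>S. peval \<phi> (F s))"
  by (induction S rule: infinite_finite_induct) (auto simp: peval_mult)

lemma peval_of_int [simp]: "peval \<phi> (of_int c) = of_int c"
  by (simp only: single_of_int[symmetric] peval_single) (simp add: mono_eval_def)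

lemma peval_X_var [simp]: "peval \<phi> (X_var i) = \<phi> (Inl i)"
  by (simp add: X_var_def peval_single mono_eval_def)

lemma peval_Y_var [simp]: "peval \<phi> (Y_var i) = \<phi> (Inr i)"
  by (simp add: Y_var_def peval_single mono_eval_def)

lemma peval_schur_diag: "peval \<phi> (schur_diag n D z) = schur_diag n D (\<lambda>i. peval \<phi> (z i))"
  by (simp add: schur_diag_def peval_sum peval_prod)

definition var_of :: "nat + nat \<Rightarrow> xy_poly" where
  "var_of v = (case v of Inl i \<Rightarrow> X_var i | Inr i \<Rightarrow> Y_var i)"

lemma var_of_eq: "var_of v = Poly_Mapping.single (Poly_Mapping.single v 1) 1"
  by (simp add: var_of_def X_var_def Y_var_def split: sum.split)

definition permute_expo :: "(nat + nat \<Rightarrow> nat + nat) \<Rightarrow> expo \<Rightarrow> expo" where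
  "permute_expo \<sigma> e = (\<Sum>v\<in>Poly_Mapping.keys e. Poly_Mapping.single (\<sigma> v) (Poly_Mapping.lookup e v))"

lemma mono_eval_var_of: "mono_eval (\<lambda>v. var_of (\<sigma> v)) e = Poly_Mapping.single (permute_expo \<sigma> e) 1"
proof -
  have 1: "var_of (\<sigma> v) ^ k = Poly_Mapping.single (Poly_Mapping.single (\<sigma> v) k) 1" for v k
    by (induction k) (auto simp: var_of_eq mult_single single_add[symmetric])
  have 2: "(\<Prod>v\<in>A. Poly_Mapping.single (g v) (1::int)) = Poly_Mapping.single (sum g A) 1" for A and g :: "nat + nat \<Rightarrow> expo"
    by (induction A rule: infinite_finite_induct) (auto simp: mult_single)
  show ?thesis by (simp add: mono_eval_def 1 2 permute_expo_def)
qed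

lemma lookup_permute_expo:
  assumes "inj \<sigma>"
  shows "Poly_Mapping.lookup (permute_expo \<sigma> e) (\<sigma> v) = Poly_Mapping.lookup e v"
proof -
  have "Poly_Mapping.lookup (permute_expo \<sigma> e) (\<sigma> v) = (\<Sum>w\<in>Poly_Mapping.keys e. if w = v then Poly_Mapping.lookup e v else 0)"
    unfolding permute_expo_def lookup_sum using assms by (intro sum.cong refl) (auto simp: lookup_single when_def inj_eq)
  also have "\<dots> = Poly_Mapping.lookup e v" by (simp add: in_keys_iff)
  finally show ?thesis .
qed

lemma inj_permute_expo:
  assumes "inj \<sigma>"
  shows "inj (permute_expo \<sigma>)"
  by (rule injI, rule poly_mapping_eqI) (metis lookup_permute_expo[OF assms])

text \<open>An injective renaming of the variables acts injectively on exponent vectors, so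
  invariance under the substitution becomes equality of coefficients.\<close>

lemma lookup_symmetric:
  assumes \<sigma>: "inj \<sigma>" and f: "peval (\<lambda>v. var_of (\<sigma> v)) f = f"
  shows "Poly_Mapping.lookup f (permute_expo \<sigma> e) = Poly_Mapping.lookup f e"
proof -
  have "Poly_Mapping.lookup f (permute_expo \<sigma> e) = Poly_Mapping.lookup (peval (\<lambda>v. var_of (\<sigma> v)) f) (permute_expo \<sigma> e)" by (simp only: f)
  also have "\<dots> = (\<Sum>e'\<in>Poly_Mapping.keys f. Poly_Mapping.lookup (of_int (Poly_Mapping.lookup f e') * Poly_Mapping.single (permute_expo \<sigma> e') 1) (permute_expo \<sigma> e))"
    by (simp add: peval_def mono_eval_var_of lookup_sum)
  also have "\<dots> = (\<Sum>e'\<in>Poly_Mapping.keys f. if e' = e then Poly_Mapping.lookup f e else 0)"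
  proof (intro sum.cong refl)
    fix e'
    have "of_int (Poly_Mapping.lookup f e') * Poly_Mapping.single (permute_expo \<sigma> e') (1::int) = Poly_Mapping.single (permute_expo \<sigma> e') (Poly_Mapping.lookup f e')"
      unfolding single_of_int[symmetric] mult_single by simp
    then show "Poly_Mapping.lookup (of_int (Poly_Mapping.lookup f e') * Poly_Mapping.single (permute_expo \<sigma> e') 1) (permute_expo \<sigma> e) = (if e' = e then Poly_Mapping.lookup f e else 0)"
      using inj_permute_expo[OF \<sigma>] by (simp add: lookup_single when_def inj_eq)
  qed
  also have "\<dots> = Poly_Mapping.lookup f e" by (simp add: in_keys_iff)
  finally show ?thesis .
qed

lemma lookup_of_int_mult: "Poly_Mapping.lookup (of_int c * g) e = c * Poly_Mapping.lookup g e" for g :: xy_poly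
proof -
  have "of_int c * g = (\<Sum>a\<in>Poly_Mapping.keys g. Poly_Mapping.single a (c * Poly_Mapping.lookup g a))"
  proof -
    have "of_int c * g = of_int c * (\<Sum>a\<in>Poly_Mapping.keys g. Poly_Mapping.single a (Poly_Mapping.lookup g a))" using sum_single_keys[of g] by simp
    then show ?thesis by (simp add: sum_distrib_left single_of_int[symmetric] mult_single del: single_of_int)
  qed
  then have "Poly_Mapping.lookup (of_int c * g) e = Poly_Mapping.lookup (\<Sum>a\<in>Poly_Mapping.keys g. Poly_Mapping.single a (c * Poly_Mapping.lookup g a)) e"
    by (simp only:)
  also have "\<dots> = (\<Sum>a\<in>Poly_Mapping.keys g. if a = e then c * Poly_Mapping.lookup g e else 0)"
    unfolding lookup_sum by (intro sum.cong refl) (auto simp: lookup_single when_def)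
  finally show ?thesis by (simp add: in_keys_iff)
qed

definition homog_expos :: "nat \<Rightarrow> nat \<Rightarrow> nat \<Rightarrow> expo set" where
  "homog_expos n m d = {e. Poly_Mapping.keys e \<subseteq> Inl ` {1..n} \<union> Inr ` {1..m} \<and>
     (\<Sum>i\<in>{1..n}. Poly_Mapping.lookup e (Inl i)) + (\<Sum>i\<in>{1..m}. Poly_Mapping.lookup e (Inr i)) = d}"

text \<open>
  On the exponent vector of a tableau \<open>F\<close> this is \<open>\<Sum>p. n - F p\<close>, which is maximal only when every row is
  filled with its own number.
\<close>

definition lead_key :: "nat \<Rightarrow> nat \<Rightarrow> expo \<Rightarrow> nat" where
  "lead_key n m e = (\<Sum>i\<in>{1..n}. (n - i) * Poly_Mapping.lookup e (Inl i)) + (\<Sum>i\<in>{1..m}. (m - i) * Poly_Mapping.lookup e (Inr i))"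

lemma homog_expos_eqI:
  assumes "e \<in> homog_expos n m d" "e' \<in> homog_expos n m d'"
    and "\<And>i. i \<in> {1..n} \<Longrightarrow> Poly_Mapping.lookup e (Inl i) = Poly_Mapping.lookup e' (Inl i)"
    and "\<And>i. i \<in> {1..m} \<Longrightarrow> Poly_Mapping.lookup e (Inr i) = Poly_Mapping.lookup e' (Inr i)"
  shows "e = e'"
proof (rule poly_mapping_eqI)
  fix v
  show "Poly_Mapping.lookup e v = Poly_Mapping.lookup e' v"
  proof (cases "v \<in> Inl ` {1..n} \<union> Inr ` {1..m}")
    case True
    then show ?thesis using assms(3,4) by auto
  next
    case False
    then have "v \<notin> Poly_Mapping.keys e" "v \<notin> Poly_Mapping.keys e'" using assms(1,2) by (auto simp: homog_expos_def)
    then show ?thesis by (simp add: in_keys_iff)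
  qed
qed

lemma finite_homog_expos: "finite (homog_expos n m d)"
proof -
  let ?V = "Inl ` {1..n} \<union> Inr ` {1..m} :: (nat + nat) set"
  have "(\<lambda>e. restrict (Poly_Mapping.lookup e) ?V) ` homog_expos n m d \<subseteq> ?V \<rightarrow>\<^sub>E {0..d}"
  proof (rule image_subsetI)
    fix e assume e: "e \<in> homog_expos n m d"
    have 1: "Poly_Mapping.lookup e (Inl i) \<le> d" if "i \<in> {1..n}" for i
    proof -
      have "Poly_Mapping.lookup e (Inl i) \<le> (\<Sum>i\<in>{1..n}. Poly_Mapping.lookup e (Inl i))" using that by (intro member_le_sum) auto
      then show ?thesis using e unfolding homog_expos_def by auto
    qed
    have 2: "Poly_Mapping.lookup e (Inr i) \<le> d" if "i \<in> {1..m}" for i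
    proof -
      have "Poly_Mapping.lookup e (Inr i) \<le> (\<Sum>i\<in>{1..m}. Poly_Mapping.lookup e (Inr i))" using that by (intro member_le_sum) auto
      then show ?thesis using e unfolding homog_expos_def by auto
    qed
    show "restrict (Poly_Mapping.lookup e) ?V \<in> ?V \<rightarrow>\<^sub>E {0..d}" unfolding restrict_PiE_iff using 1 2 by auto
  qed
  moreover have "finite (?V \<rightarrow>\<^sub>E {0..d})" by (intro finite_PiE) auto
  ultimately have "finite ((\<lambda>e. restrict (Poly_Mapping.lookup e) ?V) ` homog_expos n m d)" by (rule finite_subset)
  moreover have "inj_on (\<lambda>e. restrict (Poly_Mapping.lookup e) ?V) (homog_expos n m d)"
  proof (rule inj_onI)
    fix e e' assume e: "e \<in> homog_expos n m d" "e' \<in> homog_expos n m d" and eq: "restrict (Poly_Mapping.lookup e) ?V = restrict (Poly_Mapping.lookup e') ?V"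
    show "e = e'"
    proof (rule homog_expos_eqI[OF e])
      show "Poly_Mapping.lookup e (Inl i) = Poly_Mapping.lookup e' (Inl i)" if "i \<in> {1..n}" for i using fun_cong[OF eq, of "Inl i"] that by simp
      show "Poly_Mapping.lookup e (Inr i) = Poly_Mapping.lookup e' (Inr i)" if "i \<in> {1..m}" for i using fun_cong[OF eq, of "Inr i"] that by simp
    qed
  qed
  ultimately show ?thesis by (rule finite_imageD)
qed

section \<open>Exponent vectors of tableaux and their leading terms\<close>

definition filling_expo :: "(nat \<Rightarrow> nat + nat) \<Rightarrow> 'c set \<Rightarrow> ('c \<Rightarrow> nat) \<Rightarrow> expo" where
  "filling_expo v D F = (\<Sum>p\<in>D. Poly_Mapping.single (v (F p)) 1)"

lemma lookup_filling_expo: "finite D \<Longrightarrow> Poly_Mapping.lookup (filling_expo v D F) w = card {p \<in> D. v (F p) = w}"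
  unfolding filling_expo_def lookup_sum by (simp add: lookup_single when_def sum.If_cases Int_def)

lemma schur_diag_filling_expo:
  assumes "\<And>i. z i = Poly_Mapping.single (Poly_Mapping.single (v i) 1) (1::int)"
  shows "schur_diag n D z = (\<Sum>F\<in>tableaux n D. Poly_Mapping.single (filling_expo v D F) 1)"
proof -
  have "(\<Prod>p\<in>A. Poly_Mapping.single (g p) (1::int)) = Poly_Mapping.single (sum g A) 1" for A and g :: "nat \<times> nat \<Rightarrow> expo"
    by (induction A rule: infinite_finite_induct) (auto simp: mult_single)
  then show ?thesis by (simp add: schur_diag_def assms filling_expo_def)
qed

abbreviation schur2 :: "nat \<Rightarrow> nat \<Rightarrow> (nat \<times> nat) set \<times> (nat \<times> nat) set \<Rightarrow> xy_poly" where
  "schur2 n m p \<equiv> schur_diag n (fst p) X_var * schur_diag m (snd p) Y_var"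

lemma schur2_filling_expo: "schur2 n m (D, E) =
  (\<Sum>(F, G)\<in>tableaux n D \<times> tableaux m E. Poly_Mapping.single (filling_expo Inl D F + filling_expo Inr E G) 1)"
proof -
  have "schur_diag n D X_var = (\<Sum>F\<in>tableaux n D. Poly_Mapping.single (filling_expo Inl D F) (1::int))"
    by (rule schur_diag_filling_expo) (simp add: X_var_def)
  moreover have "schur_diag m E Y_var = (\<Sum>F\<in>tableaux m E. Poly_Mapping.single (filling_expo Inr E F) (1::int))"
    by (rule schur_diag_filling_expo) (simp add: Y_var_def)
  ultimately show ?thesis by (simp add: sum_product mult_single sum.cartesian_product)
qed

lemma lookup_schur2:
  assumes "finite D" "finite E"
  shows "Poly_Mapping.lookup (schur2 n m (D, E)) e = int (card {(F, G) \<in> tableaux n D \<times> tableaux m E. filling_expo Inl D F + filling_expo Inr E G = e})"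
proof -
  let ?P = "\<lambda>(F, G). filling_expo Inl D F + filling_expo Inr E G = e"
  have "finite (tableaux n D \<times> tableaux m E)"
    using finite_tableaux[OF assms(1)] finite_tableaux[OF assms(2)] by simp
  note filter = sum.inter_filter[OF this, of "\<lambda>_. 1 :: int" ?P]
  have "Poly_Mapping.lookup (schur2 n m (D, E)) e = (\<Sum>q\<in>tableaux n D \<times> tableaux m E. if ?P q then 1 else 0)"
    unfolding schur2_filling_expo lookup_sum by (intro sum.cong refl) (auto simp: lookup_single when_def)
  also have "\<dots> = int (card {q \<in> tableaux n D \<times> tableaux m E. ?P q})" unfolding filter[symmetric] by simp
  also have "{q \<in> tableaux n D \<times> tableaux m E. ?P q} = {(F, G) \<in> tableaux n D \<times> tableaux m E. filling_expo Inl D F + filling_expo Inr E G = e}"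
    by auto
  finally show ?thesis .
qed

lemma lookup_filling_expo_pair:
  assumes "finite D" "finite E"
  shows "Poly_Mapping.lookup (filling_expo Inl D F + filling_expo Inr E G) (Inl i) = card {p \<in> D. F p = i}"
    "Poly_Mapping.lookup (filling_expo Inl D F + filling_expo Inr E G) (Inr i) = card {p \<in> E. G p = i}"
  using assms by (simp_all add: lookup_add lookup_filling_expo)

lemma sum_card_fiber:
  fixes F :: "'c \<Rightarrow> nat" and h :: "nat \<Rightarrow> nat"
  assumes "finite D" "\<And>p. p \<in> D \<Longrightarrow> F p \<in> {1..n}"
  shows "(\<Sum>i\<in>{1..n}. h i * card {p \<in> D. F p = i}) = (\<Sum>p\<in>D. h (F p))"
proof -
  have "(\<Sum>i\<in>{1..n}. h i * card {p \<in> D. F p = i}) = (\<Sum>i\<in>{1..n}. \<Sum>p\<in>{p \<in> D. F p = i}. h (F p))"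
    by (intro sum.cong refl) simp
  also have "\<dots> = (\<Sum>p\<in>D. h (F p))" using assms by (intro sum.group) auto
  finally show ?thesis .
qed

lemma tableaux_range: "F \<in> tableaux n D \<Longrightarrow> p \<in> D \<Longrightarrow> F p \<in> {1..n}"
  unfolding tableaux_def using PiE_mem[of F D "\<lambda>_. {1..n}" p] by simp

lemma filling_expo_homog_expos:
  assumes "finite D" "finite E" and F: "\<And>p. p \<in> D \<Longrightarrow> F p \<in> {1..n}" and G: "\<And>p. p \<in> E \<Longrightarrow> G p \<in> {1..m}"
  shows "filling_expo Inl D F + filling_expo Inr E G \<in> homog_expos n m (card D + card E)"
proof -
  have "Poly_Mapping.keys (filling_expo Inl D F + filling_expo Inr E G) \<subseteq> Inl ` {1..n} \<union> Inr ` {1..m}"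
  proof
    fix v assume v: "v \<in> Poly_Mapping.keys (filling_expo Inl D F + filling_expo Inr E G)"
    show "v \<in> Inl ` {1..n} \<union> Inr ` {1..m}"
    proof (cases v)
      case (Inl i)
      then have "card {p \<in> D. F p = i} \<noteq> 0" using v by (simp add: in_keys_iff lookup_filling_expo_pair[OF assms(1,2)])
      then have "{p \<in> D. F p = i} \<noteq> {}" by (metis card.empty)
      then show ?thesis using F Inl by auto
    next
      case (Inr i)
      then have "card {p \<in> E. G p = i} \<noteq> 0" using v by (simp add: in_keys_iff lookup_filling_expo_pair[OF assms(1,2)])
      then have "{p \<in> E. G p = i} \<noteq> {}" by (metis card.empty)
      then show ?thesis using G Inr by auto
    qed
  qed
  moreover have "(\<Sum>i\<in>{1..n}. 1 * card {p \<in> D. F p = i}) = (\<Sum>p\<in>D. 1)"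
    by (rule sum_card_fiber[OF assms(1) F])
  moreover have "(\<Sum>i\<in>{1..m}. 1 * card {p \<in> E. G p = i}) = (\<Sum>p\<in>E. 1)"
    by (rule sum_card_fiber[OF assms(2) G])
  ultimately show ?thesis
    by (simp add: homog_expos_def lookup_filling_expo_pair[OF assms(1,2)])
qed

lemma lead_key_filling_expo:
  assumes "finite D" "finite E" and F: "\<And>p. p \<in> D \<Longrightarrow> F p \<in> {1..n}" and G: "\<And>p. p \<in> E \<Longrightarrow> G p \<in> {1..m}"
  shows "lead_key n m (filling_expo Inl D F + filling_expo Inr E G) = (\<Sum>p\<in>D. n - F p) + (\<Sum>p\<in>E. m - G p)"
proof -
  have "(\<Sum>i\<in>{1..n}. (n - i) * card {p \<in> D. F p = i}) = (\<Sum>p\<in>D. n - F p)"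
    by (rule sum_card_fiber[OF assms(1) F])
  moreover have "(\<Sum>i\<in>{1..m}. (m - i) * card {p \<in> E. G p = i}) = (\<Sum>p\<in>E. m - G p)"
    by (rule sum_card_fiber[OF assms(2) G])
  ultimately show ?thesis unfolding lead_key_def lookup_filling_expo_pair[OF assms(1,2)] by (simp only:)
qed

abbreviation rowfill :: "nat \<times> nat \<Rightarrow> nat" where
  "rowfill p \<equiv> Suc (fst p)"

lemma tableaux_ge: "F \<in> tableaux n D \<Longrightarrow> ydiag D \<Longrightarrow> p \<in> D \<Longrightarrow> rowfill p \<le> F p"
proof -
  assume F: "F \<in> tableaux n D" and D: "ydiag D" and p: "p \<in> D"
  obtain r c where [simp]: "p = (r, c)" by (cases p)
  have "F (0, c) + r \<le> F (r, c)" using tableaux_mono_col[OF F D, of r c 0] p by simp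
  moreover have "(0, c) \<in> D" using ydiagD[OF D, of r c 0 c] p by simp
  then have "1 \<le> F (0, c)" using tableaux_range[OF F] by fastforce
  ultimately show ?thesis by simp
qed

lemma rowfill_tableaux:
  assumes D: "ydiag D" and n: "\<forall>r\<ge>n. row_len D r = 0"
  shows "restrict rowfill D \<in> tableaux n D"
proof -
  have lt: "r < n" if "(r, c) \<in> D" for r c
    using that n mem_iff_row_len[OF D, of r c] by (metis not_less not_less_zero)
  have up: "(r, c) \<in> D" if "(r, Suc c) \<in> D \<or> (Suc r, c) \<in> D" for r c
    using that ydiagD[OF D] by (meson le_SucI le_refl)
  have "restrict rowfill D \<in> D \<rightarrow>\<^sub>E {1..n}" unfolding restrict_PiE_iff using lt by (auto simp: Suc_le_eq)
  moreover have "restrict rowfill D (r, c) \<le> restrict rowfill D (r, Suc c)" if "(r, Suc c) \<in> D" for r c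
    using that up[of r c] by simp
  moreover have "restrict rowfill D (r, c) < restrict rowfill D (Suc r, c)" if "(Suc r, c) \<in> D" for r c
    using that up[of r c] by simp
  ultimately show ?thesis unfolding tableaux_def by blast
qed

lemma lead_key_le:
  assumes D: "ydiag D" "ydiag E" and F: "F \<in> tableaux n D" and G: "G \<in> tableaux m E"
    and n: "\<forall>r\<ge>n. row_len D r = 0" and m: "\<forall>r\<ge>m. row_len E r = 0"
  shows "lead_key n m (filling_expo Inl D F + filling_expo Inr E G) \<le> lead_key n m (filling_expo Inl D rowfill + filling_expo Inr E rowfill)"
    "lead_key n m (filling_expo Inl D F + filling_expo Inr E G) = lead_key n m (filling_expo Inl D rowfill + filling_expo Inr E rowfill) \<Longrightarrow>
      F = restrict rowfill D \<and> G = restrict rowfill E"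
proof -
  have f: "finite D" "finite E" using D by (auto intro: ydiag_finite)
  have rD: "rowfill p \<in> {1..n}" if "p \<in> D" for p using tableaux_range[OF rowfill_tableaux[OF D(1) n] that] that by simp
  have rE: "rowfill p \<in> {1..m}" if "p \<in> E" for p using tableaux_range[OF rowfill_tableaux[OF D(2) m] that] that by simp
  have k1: "lead_key n m (filling_expo Inl D F + filling_expo Inr E G) = (\<Sum>p\<in>D. n - F p) + (\<Sum>p\<in>E. m - G p)"
    by (rule lead_key_filling_expo[OF f tableaux_range[OF F] tableaux_range[OF G]])
  have k2: "lead_key n m (filling_expo Inl D rowfill + filling_expo Inr E rowfill) = (\<Sum>p\<in>D. n - rowfill p) + (\<Sum>p\<in>E. m - rowfill p)"
    by (rule lead_key_filling_expo[OF f rD rE])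
  have a: "(\<Sum>p\<in>D. n - F p) \<le> (\<Sum>p\<in>D. n - rowfill p)" by (intro sum_mono diff_le_mono2 tableaux_ge[OF F D(1)])
  have b: "(\<Sum>p\<in>E. m - G p) \<le> (\<Sum>p\<in>E. m - rowfill p)" by (intro sum_mono diff_le_mono2 tableaux_ge[OF G D(2)])
  show "lead_key n m (filling_expo Inl D F + filling_expo Inr E G) \<le> lead_key n m (filling_expo Inl D rowfill + filling_expo Inr E rowfill)"
    unfolding k1 k2 using a b by linarith
  assume eq: "lead_key n m (filling_expo Inl D F + filling_expo Inr E G) = lead_key n m (filling_expo Inl D rowfill + filling_expo Inr E rowfill)"
  then have e: "(\<Sum>p\<in>D. n - F p) = (\<Sum>p\<in>D. n - rowfill p)" "(\<Sum>p\<in>E. m - G p) = (\<Sum>p\<in>E. m - rowfill p)"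
    unfolding k1 k2 using a b by linarith+
  have "F p = rowfill p" if p: "p \<in> D" for p
  proof (rule ccontr)
    assume "F p \<noteq> rowfill p"
    then have "n - F p < n - rowfill p" using tableaux_ge[OF F D(1) p] tableaux_range[OF F p] by auto
    then have "(\<Sum>p\<in>D. n - F p) < (\<Sum>p\<in>D. n - rowfill p)"
      using p f tableaux_ge[OF F D(1)] by (intro sum_strict_mono_ex1) (auto intro!: diff_le_mono2)
    then show False using e by simp
  qed
  moreover have "G p = rowfill p" if p: "p \<in> E" for p
  proof (rule ccontr)
    assume "G p \<noteq> rowfill p"
    then have "m - G p < m - rowfill p" using tableaux_ge[OF G D(2) p] tableaux_range[OF G p] by auto
    then have "(\<Sum>p\<in>E. m - G p) < (\<Sum>p\<in>E. m - rowfill p)"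
      using p f tableaux_ge[OF G D(2)] by (intro sum_strict_mono_ex1) (auto intro!: diff_le_mono2)
    then show False using e by simp
  qed
  moreover have "F \<in> D \<rightarrow>\<^sub>E {1..n}" "G \<in> E \<rightarrow>\<^sub>E {1..m}" using F G by (auto simp: tableaux_def)
  ultimately show "F = restrict rowfill D \<and> G = restrict rowfill E"
    by (auto simp: fun_eq_iff PiE_def extensional_def)
qed

lemma filling_expo_restrict: "filling_expo v D (restrict F D) = filling_expo v D F"
  unfolding filling_expo_def by (intro sum.cong) auto

text \<open>Products of Schur polynomials are unitriangular for \<open>lead_key\<close>. The leading
  coefficient 1 is what keeps the later expansion over the integers.\<close>

lemma schur2_leading:
  assumes D: "ydiag D" "ydiag E" and n: "\<forall>r\<ge>n. row_len D r = 0" and m: "\<forall>r\<ge>m. row_len E r = 0"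
  defines "u \<equiv> filling_expo Inl D rowfill + filling_expo Inr E rowfill"
  shows "Poly_Mapping.lookup (schur2 n m (D, E)) u = 1"
    and "e \<in> Poly_Mapping.keys (schur2 n m (D, E)) \<Longrightarrow> e \<noteq> u \<Longrightarrow> lead_key n m e < lead_key n m u"
    and "e \<in> Poly_Mapping.keys (schur2 n m (D, E)) \<Longrightarrow> e \<in> homog_expos n m (card D + card E)"
proof -
  have f: "finite D" "finite E" using D by (auto intro: ydiag_finite)
  have "{(F, G) \<in> tableaux n D \<times> tableaux m E. filling_expo Inl D F + filling_expo Inr E G = u} = {(restrict rowfill D, restrict rowfill E)}"
  proof (intro equalityI subsetI)
    fix q assume "q \<in> {(F, G) \<in> tableaux n D \<times> tableaux m E. filling_expo Inl D F + filling_expo Inr E G = u}"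
    then obtain F G where q: "q = (F, G)" "F \<in> tableaux n D" "G \<in> tableaux m E" "filling_expo Inl D F + filling_expo Inr E G = u"
      by auto
    then have "F = restrict rowfill D \<and> G = restrict rowfill E"
      by (intro lead_key_le(2)[OF D q(2,3) n m]) (simp add: u_def)
    then show "q \<in> {(restrict rowfill D, restrict rowfill E)}" using q by simp
  next
    fix q assume "q \<in> {(restrict rowfill D, restrict rowfill E)}"
    then show "q \<in> {(F, G) \<in> tableaux n D \<times> tableaux m E. filling_expo Inl D F + filling_expo Inr E G = u}"
      using rowfill_tableaux[OF D(1) n] rowfill_tableaux[OF D(2) m] by (simp add: u_def filling_expo_restrict)
  qed
  then show "Poly_Mapping.lookup (schur2 n m (D, E)) u = 1" by (simp only: lookup_schur2[OF f]) simp
  assume e: "e \<in> Poly_Mapping.keys (schur2 n m (D, E))"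
  then have "{(F, G) \<in> tableaux n D \<times> tableaux m E. filling_expo Inl D F + filling_expo Inr E G = e} \<noteq> {}"
    unfolding in_keys_iff lookup_schur2[OF f] by (metis card.empty of_nat_0)
  then obtain F G where FG: "F \<in> tableaux n D" "G \<in> tableaux m E" "filling_expo Inl D F + filling_expo Inr E G = e" by auto
  show "lead_key n m e < lead_key n m u" if "e \<noteq> u"
  proof -
    have "lead_key n m e \<noteq> lead_key n m u"
    proof
      assume "lead_key n m e = lead_key n m u"
      then have "F = restrict rowfill D" "G = restrict rowfill E"
        using lead_key_le(2)[OF D FG(1,2) n m] FG(3) by (auto simp: u_def)
      then show False using that FG(3) by (simp add: u_def filling_expo_restrict)
    qed
    then show ?thesis using lead_key_le(1)[OF D FG(1,2) n m] FG(3) by (simp add: u_def)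
  qed
  show "e \<in> homog_expos n m (card D + card E)"
    unfolding FG(3)[symmetric] by (rule filling_expo_homog_expos[OF f tableaux_range[OF FG(1)] tableaux_range[OF FG(2)]])
qed


section \<open>Elimination of leading terms\<close>

definition bisymmetric :: "nat \<Rightarrow> nat \<Rightarrow> xy_poly \<Rightarrow> bool" where
  "bisymmetric n m f \<longleftrightarrow>
    (\<forall>i\<in>{1..<n}. peval (\<lambda>v. var_of (transpose (Inl i) (Inl (Suc i)) v)) f = f) \<and>
    (\<forall>i\<in>{1..<m}. peval (\<lambda>v. var_of (transpose (Inr i) (Inr (Suc i)) v)) f = f)"

lemma transpose_Inl: "transpose (Inl i) (Inl j) (Inl a) = Inl (transpose i j a)" "transpose (Inl i) (Inl j) (Inr b) = Inr b"
  by (simp_all add: transpose_def)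

lemma transpose_Inr: "transpose (Inr i) (Inr j) (Inr a) = Inr (transpose i j a)" "transpose (Inr i) (Inr j) (Inl b) = Inl b"
  by (simp_all add: transpose_def)

lemma var_of_simps [simp]: "var_of (Inl i) = X_var i" "var_of (Inr i) = Y_var i"
  by (simp_all add: var_of_def)

lemma bisymmetric_add_mult:
  assumes "bisymmetric n m f" "bisymmetric n m g"
  shows "bisymmetric n m (f + of_int c * g)"
  using assms by (simp add: bisymmetric_def peval_add peval_mult)

lemma bisymmetric_schur2:
  assumes D: "ydiag D" "ydiag E"
  shows "bisymmetric n m (schur2 n m (D, E))"
  unfolding bisymmetric_def
proof (intro conjI ballI)
  fix i assume "i \<in> {1..<n}"
  then have "transpose i (Suc i) permutes {1..n}" by (intro permutes_swap_id) auto
  from schur_diag_permute[OF D(1) this, of X_var]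
  show "peval (\<lambda>v. var_of (transpose (Inl i) (Inl (Suc i)) v)) (schur2 n m (D, E)) = schur2 n m (D, E)"
    by (simp add: peval_mult peval_schur_diag transpose_Inl)
next
  fix i assume "i \<in> {1..<m}"
  then have "transpose i (Suc i) permutes {1..m}" by (intro permutes_swap_id) auto
  from schur_diag_permute[OF D(2) this, of Y_var]
  show "peval (\<lambda>v. var_of (transpose (Inr i) (Inr (Suc i)) v)) (schur2 n m (D, E)) = schur2 n m (D, E)"
    by (simp add: peval_mult peval_schur_diag transpose_Inr)
qed

text \<open>The weight \<open>n - l\<close> drops by one from \<open>i\<close> to
  \<open>Suc i\<close>, so moving the larger exponent to the earlier place raises the key.\<close>

lemma sum_transpose_key:
  fixes a :: "nat \<Rightarrow> nat"
  assumes i: "i \<in> {1..<n}" and lt: "a i < a (Suc i)"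
  shows "(\<Sum>l\<in>{1..n}. (n - l) * a l) < (\<Sum>l\<in>{1..n}. (n - l) * a (transpose i (Suc i) l))"
proof -
  let ?R = "{1..n} - {i} - {Suc i}"
  have split: "(\<Sum>l\<in>{1..n}. g l) = g i + (g (Suc i) + (\<Sum>l\<in>?R. g l))" for g :: "nat \<Rightarrow> nat"
    using i by (subst sum.remove[of _ i], simp, simp, subst sum.remove[of _ "Suc i"]) auto
  have R: "(\<Sum>l\<in>?R. (n - l) * a (transpose i (Suc i) l)) = (\<Sum>l\<in>?R. (n - l) * a l)"
    by (intro sum.cong refl) (auto simp: transpose_def)
  obtain k where k: "n - i = Suc k" "n - Suc i = k" using i by (metis Suc_diff_Suc atLeastLessThan_iff)
  show ?thesis unfolding split R by (simp only: k transpose_apply_first transpose_apply_second) (use lt in simp)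
qed

text \<open>By symmetry the exponent vector with two neighbours exchanged also occurs in
  \<open>f\<close>; at an ascent its key would exceed the maximum.\<close>

lemma leading_dominant:
  assumes f: "bisymmetric n m f" "Poly_Mapping.keys f \<subseteq> homog_expos n m d"
    and u: "u \<in> Poly_Mapping.keys f" and max: "\<And>e. e \<in> Poly_Mapping.keys f \<Longrightarrow> lead_key n m e \<le> lead_key n m u"
  shows "i \<in> {1..<n} \<Longrightarrow> Poly_Mapping.lookup u (Inl (Suc i)) \<le> Poly_Mapping.lookup u (Inl i)"
    and "i \<in> {1..<m} \<Longrightarrow> Poly_Mapping.lookup u (Inr (Suc i)) \<le> Poly_Mapping.lookup u (Inr i)"
proof -
  let ?l = "Poly_Mapping.lookup"
  have inj: "inj (transpose v w)" for v w :: "nat + nat" by simp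
  have lk: "?l (permute_expo (transpose v w) u) x = ?l u (transpose v w x)" for v w x
    using lookup_permute_expo[OF inj, of v w u "transpose v w x"] by simp
  show "?l u (Inl (Suc i)) \<le> ?l u (Inl i)" if i: "i \<in> {1..<n}"
  proof (rule ccontr)
    assume "\<not> ?l u (Inl (Suc i)) \<le> ?l u (Inl i)"
    then have lt: "?l u (Inl i) < ?l u (Inl (Suc i))" by simp
    let ?e = "permute_expo (transpose (Inl i) (Inl (Suc i))) u"
    have "?l f ?e = ?l f u"
      using f(1) i by (intro lookup_symmetric inj) (auto simp: bisymmetric_def)
    then have "?e \<in> Poly_Mapping.keys f" using u by (simp add: in_keys_iff)
    from max[OF this] show False
      using sum_transpose_key[OF i, of "\<lambda>a. ?l u (Inl a)"] lt
      by (simp add: lead_key_def lk transpose_Inl)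
  qed
  show "?l u (Inr (Suc i)) \<le> ?l u (Inr i)" if i: "i \<in> {1..<m}"
  proof (rule ccontr)
    assume "\<not> ?l u (Inr (Suc i)) \<le> ?l u (Inr i)"
    then have lt: "?l u (Inr i) < ?l u (Inr (Suc i))" by simp
    let ?e = "permute_expo (transpose (Inr i) (Inr (Suc i))) u"
    have "?l f ?e = ?l f u"
      using f(1) i by (intro lookup_symmetric inj) (auto simp: bisymmetric_def)
    then have "?e \<in> Poly_Mapping.keys f" using u by (simp add: in_keys_iff)
    from max[OF this] show False
      using sum_transpose_key[OF i, of "\<lambda>a. ?l u (Inr a)"] lt
      by (simp add: lead_key_def lk transpose_Inr)
  qed
qed

definition diag_pairs :: "nat \<Rightarrow> nat \<Rightarrow> nat \<Rightarrow> ((nat \<times> nat) set \<times> (nat \<times> nat) set) set" where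
  "diag_pairs n m d = {(D, E). ydiag D \<and> ydiag E \<and> (\<forall>r\<ge>n. row_len D r = 0) \<and> (\<forall>r\<ge>m. row_len E r = 0) \<and> card D + card E = d}"

lemma ydiag_subset_box:
  assumes D: "ydiag D" and "card D \<le> d"
  shows "D \<subseteq> {..<d} \<times> {..<d}"
proof
  fix p assume p: "p \<in> D"
  obtain r c where [simp]: "p = (r, c)" by (cases p)
  have fin: "finite D" using D by (rule ydiag_finite)
  have "(\<lambda>c'. (r, c')) ` {..c} \<subseteq> D" "(\<lambda>r'. (r', c)) ` {..r} \<subseteq> D" using p ydiagD[OF D] by auto
  then have "card ((\<lambda>c'. (r, c')) ` {..c}) \<le> card D" "card ((\<lambda>r'. (r', c)) ` {..r}) \<le> card D"
    using fin by (auto intro: card_mono)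
  then show "p \<in> {..<d} \<times> {..<d}" using assms(2) by (auto simp: card_image inj_on_def)
qed

lemma finite_diag_pairs: "finite (diag_pairs n m d)"
proof (rule finite_subset)
  show "diag_pairs n m d \<subseteq> Pow ({..<d} \<times> {..<d}) \<times> Pow ({..<d} \<times> {..<d})"
    using ydiag_subset_box[of _ d] by (auto simp: diag_pairs_def dest!: ydiag_subset_box[where d = d])
qed simp

lemma antimono_on_lessThan:
  fixes a :: "nat \<Rightarrow> nat"
  assumes "\<And>i. Suc i < n \<Longrightarrow> a (Suc i) \<le> a i" "i \<le> j" "j < n"
  shows "a j \<le> a i"
  using assms(2,3)
proof (induction rule: dec_induct)
  case (step k)
  then show ?case using assms(1)[of k] by simp
qed simp

text \<open>The two decreasing exponent sequences are read as row lengths: under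
  \<open>rowfill\<close>, the number \<open>Suc r\<close> occurs exactly as often as row
  \<open>r\<close> is long.\<close>

lemma dominant_is_filling_expo:
  assumes u: "u \<in> homog_expos n m d"
    and dec: "\<And>i. i \<in> {1..<n} \<Longrightarrow> Poly_Mapping.lookup u (Inl (Suc i)) \<le> Poly_Mapping.lookup u (Inl i)"
      "\<And>i. i \<in> {1..<m} \<Longrightarrow> Poly_Mapping.lookup u (Inr (Suc i)) \<le> Poly_Mapping.lookup u (Inr i)"
  shows "\<exists>D E. (D, E) \<in> diag_pairs n m d \<and> filling_expo Inl D rowfill + filling_expo Inr E rowfill = u"
proof -
  let ?l = "Poly_Mapping.lookup"
  let ?a = "\<lambda>r. ?l u (Inl (Suc r))" and ?b = "\<lambda>r. ?l u (Inr (Suc r))"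
  define D where "D = {(r, c). r < n \<and> c < ?a r}"
  define E where "E = {(r, c). r < m \<and> c < ?b r}"
  have yD: "ydiag D" unfolding D_def
  proof (rule ydiag_rows)
    show "?a j \<le> ?a i" if "i \<le> j" "j < n" for i j
      using that by (rule antimono_on_lessThan[of n ?a, rotated]) (rule dec(1), simp)
  qed
  have yE: "ydiag E" unfolding E_def
  proof (rule ydiag_rows)
    show "?b j \<le> ?b i" if "i \<le> j" "j < m" for i j
      using that by (rule antimono_on_lessThan[of m ?b, rotated]) (rule dec(2), simp)
  qed
  have rD: "row_len D r = (if r < n then ?a r else 0)" for r unfolding D_def by (rule row_len_rows)
  have rE: "row_len E r = (if r < m then ?b r else 0)" for r unfolding E_def by (rule row_len_rows)
  have fin: "finite D" "finite E" using yD yE by (auto intro: ydiag_finite)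
  have cr: "card {p \<in> A. rowfill p = Suc r} = row_len A r" if A: "ydiag A" for A r
  proof -
    have "{p \<in> A. rowfill p = Suc r} = (\<lambda>c. (r, c)) ` {..<row_len A r}" by (auto simp: mem_iff_row_len[OF A])
    then show ?thesis by (simp add: card_image inj_on_def)
  qed
  have "card D = (\<Sum>i<n. ?a i)" using card_eq_sum_row_len[OF yD, of n] rD by simp
  moreover have "card E = (\<Sum>i<m. ?b i)" using card_eq_sum_row_len[OF yE, of m] rE by simp
  ultimately have "card D + card E = d" using u unfolding homog_expos_def sum_shift_1 by simp
  then have "(D, E) \<in> diag_pairs n m d" using yD yE rD rE by (simp add: diag_pairs_def)
  moreover have "filling_expo Inl D rowfill + filling_expo Inr E rowfill = u"
  proof (rule homog_expos_eqI[OF _ u])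
    show "filling_expo Inl D rowfill + filling_expo Inr E rowfill \<in> homog_expos n m (card D + card E)"
      by (rule filling_expo_homog_expos[OF fin]) (auto simp: D_def E_def)
    show "?l (filling_expo Inl D rowfill + filling_expo Inr E rowfill) (Inl i) = ?l u (Inl i)" if i: "i \<in> {1..n}" for i
    proof -
      obtain r where "i = Suc r" "r < n" using i by (cases i) auto
      then show ?thesis using cr[OF yD, of r] rD[of r] by (simp add: lookup_filling_expo_pair[OF fin])
    qed
    show "?l (filling_expo Inl D rowfill + filling_expo Inr E rowfill) (Inr i) = ?l u (Inr i)" if i: "i \<in> {1..m}" for i
    proof -
      obtain r where "i = Suc r" "r < m" using i by (cases i) auto
      then show ?thesis using cr[OF yE, of r] rE[of r] by (simp add: lookup_filling_expo_pair[OF fin])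
    qed
  qed
  ultimately show ?thesis by blast
qed

text \<open>An exponent of maximal key in \<open>f\<close> is the leading exponent of some
  \<open>schur2\<close> with coefficient 1, so subtracting an integer multiple removes it without
  leaving the homogeneous bisymmetric polynomials.\<close>

theorem schur_expansion:
  assumes "bisymmetric n m f" "Poly_Mapping.keys f \<subseteq> homog_expos n m d"
  shows "\<exists>c. f = (\<Sum>p\<in>diag_pairs n m d. of_int (c p) * schur2 n m p)"
proof -
  \<comment> \<open>The termination measure. A subtraction may create new exponents, but only with
    keys below that of the leading exponent \<open>u\<close>; since these are already counted, the
    set can only shrink, and it loses \<open>u\<close>. Fixed degree makes it finite.\<close>
  define down where "down = (\<lambda>f :: xy_poly. {e \<in> homog_expos n m d. e \<in> Poly_Mapping.keys f \<or> (\<exists>e'\<in>Poly_Mapping.keys f. lead_key n m e < lead_key n m e')})"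
  have fdown: "finite (down f)" for f unfolding down_def using finite_homog_expos[of n m d] by simp
  show ?thesis using assms
  proof (induction "card (down f)" arbitrary: f rule: less_induct)
    case less
    show ?case
    proof (cases "f = 0")
      case True
      then show ?thesis by (intro exI[of _ "\<lambda>_. 0"]) simp
    next
      case False
      then have ne: "Poly_Mapping.keys f \<noteq> {}" by simp
      have "Max (lead_key n m ` Poly_Mapping.keys f) \<in> lead_key n m ` Poly_Mapping.keys f"
        using ne by (intro Max_in) auto
      then obtain u where uk: "u \<in> Poly_Mapping.keys f" and "lead_key n m u = Max (lead_key n m ` Poly_Mapping.keys f)" by auto
      then have max: "lead_key n m e \<le> lead_key n m u" if "e \<in> Poly_Mapping.keys f" for e using that by simp
      have "\<exists>D E. (D, E) \<in> diag_pairs n m d \<and> filling_expo Inl D rowfill + filling_expo Inr E rowfill = u"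
      proof (rule dominant_is_filling_expo)
        show "u \<in> homog_expos n m d" using less.prems(2) uk by blast
        show "Poly_Mapping.lookup u (Inl (Suc i)) \<le> Poly_Mapping.lookup u (Inl i)" if "i \<in> {1..<n}" for i
          by (rule leading_dominant(1)[OF less.prems uk max that])
        show "Poly_Mapping.lookup u (Inr (Suc i)) \<le> Poly_Mapping.lookup u (Inr i)" if "i \<in> {1..<m}" for i
          by (rule leading_dominant(2)[OF less.prems uk max that])
      qed
      then obtain D E where DE: "(D, E) \<in> diag_pairs n m d" and cu: "filling_expo Inl D rowfill + filling_expo Inr E rowfill = u" by blast
      then have D: "ydiag D" "ydiag E" "\<forall>r\<ge>n. row_len D r = 0" "\<forall>r\<ge>m. row_len E r = 0" and cd: "card D + card E = d"
        by (auto simp: diag_pairs_def)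
      note lead = schur2_leading[OF D, unfolded cu cd]
      define a where "a = Poly_Mapping.lookup f u"
      define f' where "f' = f + of_int (- a) * schur2 n m (D, E)"
      have lf': "Poly_Mapping.lookup f' e = Poly_Mapping.lookup f e - a * Poly_Mapping.lookup (schur2 n m (D, E)) e" for e
        unfolding f'_def lookup_add lookup_of_int_mult by simp
      have nu: "u \<notin> Poly_Mapping.keys f'" unfolding in_keys_iff lf' lead(1) by (simp add: a_def)
      have kf': "e \<in> Poly_Mapping.keys f \<or> e \<in> Poly_Mapping.keys (schur2 n m (D, E))" if "e \<in> Poly_Mapping.keys f'" for e
        using that by (auto simp: in_keys_iff lf')
      have le: "lead_key n m e \<le> lead_key n m u \<and> (e \<in> Poly_Mapping.keys f \<or> lead_key n m e < lead_key n m u)" if "e \<in> Poly_Mapping.keys f'" for e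
      proof -
        have "e \<noteq> u" using that nu by auto
        then show ?thesis using kf'[OF that] max lead(2)[of e] by (auto intro: less_imp_le)
      qed
      have b': "bisymmetric n m f'" unfolding f'_def by (rule bisymmetric_add_mult[OF less.prems(1) bisymmetric_schur2[OF D(1,2)]])
      have h': "Poly_Mapping.keys f' \<subseteq> homog_expos n m d" using kf' less.prems(2) lead(3) by blast
      have "u \<in> down f" using uk less.prems(2) by (auto simp: down_def)
      moreover have "u \<notin> down f'"
      proof
        assume "u \<in> down f'"
        then obtain e' where "e' \<in> Poly_Mapping.keys f'" "lead_key n m u < lead_key n m e'" using nu by (auto simp: down_def)
        then show False using le by fastforce
      qed
      moreover have "down f' \<subseteq> down f"
      proof
        fix e assume e: "e \<in> down f'"
        then have eh: "e \<in> homog_expos n m d" by (simp add: down_def)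
        from e consider "e \<in> Poly_Mapping.keys f'" | e' where "e' \<in> Poly_Mapping.keys f'" "lead_key n m e < lead_key n m e'" by (auto simp: down_def)
        then show "e \<in> down f"
        proof cases
          case 1
          then show ?thesis using le[of e] uk eh by (auto simp: down_def)
        next
          case 2
          then have "lead_key n m e < lead_key n m u" using le[of e'] by simp
          then show ?thesis using uk eh by (auto simp: down_def)
        qed
      qed
      ultimately have "down f' \<subset> down f" by blast
      then have "card (down f') < card (down f)" using fdown by (intro psubset_card_mono)
      from less.hyps[OF this b' h'] obtain c where c: "f' = (\<Sum>p\<in>diag_pairs n m d. of_int (c p) * schur2 n m p)" by blast
      have "f = f' + of_int a * schur2 n m (D, E)" by (simp add: f'_def)
      also have "of_int a * schur2 n m (D, E) = (\<Sum>p\<in>diag_pairs n m d. if p = (D, E) then of_int a * schur2 n m (D, E) else 0)"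
        using DE finite_diag_pairs by simp
      also have "f' + \<dots> = (\<Sum>p\<in>diag_pairs n m d. of_int (c p + (if p = (D, E) then a else 0)) * schur2 n m p)"
        unfolding c sum.distrib[symmetric] by (intro sum.cong refl) (auto simp: algebra_simps)
      finally show ?thesis by (intro exI[of _ "\<lambda>p. c p + (if p = (D, E) then a else 0)"])
    qed
  qed
qed

section \<open>Schur positivity\<close>

lemma peval_boolean_product:
  "peval \<phi> (boolean_product_poly n m j k) =
    (\<Prod>S\<in>Sub j {1..n}. \<Prod>T\<in>Sub k {1..m}. (\<Sum>i\<in>S. \<phi> (Inl i)) + (\<Sum>i\<in>T. \<phi> (Inr i)))"
  unfolding boolean_product_poly_def Sub_def
  by (simp add: peval_prod peval_add peval_sum)

lemma boolean_product_Sub: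
  "boolean_product_poly n m j k = (\<Prod>S\<in>Sub j {1..n}. \<Prod>T\<in>Sub k {1..m}. (\<Sum>i\<in>S. X_var i) + (\<Sum>i\<in>T. Y_var i))"
  unfolding boolean_product_poly_def Sub_def ..

lemma bij_betw_image_Sub:
  assumes "\<pi> permutes X"
  shows "bij_betw (image \<pi>) (Sub j X) (Sub j X)"
proof (rule bij_betw_byWitness[where f' = "image (inv_into UNIV \<pi>)"])
  have inv: "inv_into UNIV \<pi> permutes X" using assms by (rule permutes_inv)
  show "\<forall>S\<in>Sub j X. inv_into UNIV \<pi> ` \<pi> ` S = S" "\<forall>S\<in>Sub j X. \<pi> ` inv_into UNIV \<pi> ` S = S"
    using permutes_inv_o[OF assms] by (auto simp: image_comp)
  show "image \<pi> ` Sub j X \<subseteq> Sub j X" "image (inv_into UNIV \<pi>) ` Sub j X \<subseteq> Sub j X"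
    using permutes_inj_on[OF inv] permutes_inj_on[OF assms] permutes_in_image[OF inv] permutes_in_image[OF assms]
    by (auto simp: Sub_def card_image)
qed

lemma prod_Sub_permute:
  assumes "\<pi> permutes X"
  shows "(\<Prod>S\<in>Sub j X. G (\<Sum>i\<in>S. z (\<pi> i))) = (\<Prod>S\<in>Sub j X. G (\<Sum>i\<in>S. z i))"
proof -
  have "(\<Prod>S\<in>Sub j X. G (\<Sum>i\<in>S. z i)) = (\<Prod>S\<in>Sub j X. G (\<Sum>i\<in>\<pi> ` S. z i))"
    by (rule prod.reindex_bij_betw[OF bij_betw_image_Sub[OF assms], symmetric])
  also have "\<dots> = (\<Prod>S\<in>Sub j X. G (\<Sum>i\<in>S. z (\<pi> i)))"
    using permutes_inj_on[OF assms] by (simp add: sum.reindex)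
  finally show ?thesis ..
qed

lemma bisymmetric_boolean_product: "bisymmetric n m (boolean_product_poly n m j k)"
  unfolding bisymmetric_def
proof (intro conjI ballI)
  fix i assume "i \<in> {1..<n}"
  then have p: "transpose i (Suc i) permutes {1..n}" by (intro permutes_swap_id) auto
  show "peval (\<lambda>v. var_of (transpose (Inl i) (Inl (Suc i)) v)) (boolean_product_poly n m j k) = boolean_product_poly n m j k"
    unfolding peval_boolean_product unfolding boolean_product_Sub transpose_Inl var_of_simps
    by (rule prod_Sub_permute[OF p])
next
  fix i assume "i \<in> {1..<m}"
  then have p: "transpose i (Suc i) permutes {1..m}" by (intro permutes_swap_id) auto
  show "peval (\<lambda>v. var_of (transpose (Inr i) (Inr (Suc i)) v)) (boolean_product_poly n m j k) = boolean_product_poly n m j k"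
    unfolding peval_boolean_product unfolding boolean_product_Sub transpose_Inr var_of_simps
    by (intro prod.cong refl prod_Sub_permute[OF p])
qed

lemma homog_expos_add: "e \<in> homog_expos n m d \<Longrightarrow> e' \<in> homog_expos n m d' \<Longrightarrow> e + e' \<in> homog_expos n m (d + d')"
  unfolding homog_expos_def using keys_add[of e e'] by (auto simp: lookup_add sum.distrib)

lemma keys_mult_homog_expos:
  assumes "Poly_Mapping.keys f \<subseteq> homog_expos n m d" "Poly_Mapping.keys g \<subseteq> homog_expos n m d'"
  shows "Poly_Mapping.keys (f * g) \<subseteq> homog_expos n m (d + d')"
  using keys_mult[of f g] homog_expos_add assms by blast

lemma keys_prod_homog_expos:
  assumes "\<And>s. s \<in> A \<Longrightarrow> Poly_Mapping.keys (F s :: xy_poly) \<subseteq> homog_expos n m d" "finite A"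
  shows "Poly_Mapping.keys (prod F A) \<subseteq> homog_expos n m (card A * d)"
  using assms(2,1)
proof (induction A rule: finite_induct)
  case empty
  have "(0 :: expo) \<in> homog_expos n m 0" by (simp add: homog_expos_def)
  then show ?case by (simp add: one_poly_mapping.abs_eq[symmetric] flip: single_one)
next
  case (insert a A)
  then show ?case using keys_mult_homog_expos[of "F a" n m d "prod F A" "card A * d"] by simp
qed

lemma keys_var_homog_expos:
  shows "i \<in> {1..n} \<Longrightarrow> Poly_Mapping.keys (X_var i) \<subseteq> homog_expos n m 1"
    and "i \<in> {1..m} \<Longrightarrow> Poly_Mapping.keys (Y_var i) \<subseteq> homog_expos n m 1"
  by (auto simp: X_var_def Y_var_def homog_expos_def lookup_single when_def)

lemma keys_boolean_product:
  "Poly_Mapping.keys (boolean_product_poly n m j k) \<subseteq> homog_expos n m (card (Sub j {1..n} \<times> Sub k {1..m}))"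
proof -
  have f: "finite (Sub j {1..n})" "finite (Sub k {1..m})" by (simp_all add: finite_Sub)
  have factor: "Poly_Mapping.keys ((\<Sum>i\<in>S. X_var i) + (\<Sum>i\<in>T. Y_var i)) \<subseteq> homog_expos n m 1"
    if ST: "S \<in> Sub j {1..n}" "T \<in> Sub k {1..m}" for S T
  proof -
    have "Poly_Mapping.keys (\<Sum>i\<in>S. X_var i) \<subseteq> homog_expos n m 1"
    proof (rule order_trans[OF keys_sum UN_least])
      show "Poly_Mapping.keys (X_var i) \<subseteq> homog_expos n m 1" if "i \<in> S" for i
        using that ST(1) by (intro keys_var_homog_expos(1)) (auto simp: Sub_def)
    qed
    moreover have "Poly_Mapping.keys (\<Sum>i\<in>T. Y_var i) \<subseteq> homog_expos n m 1"
    proof (rule order_trans[OF keys_sum UN_least])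
      show "Poly_Mapping.keys (Y_var i) \<subseteq> homog_expos n m 1" if "i \<in> T" for i
        using that ST(2) by (intro keys_var_homog_expos(2)) (auto simp: Sub_def)
    qed
    ultimately show ?thesis using keys_add[of "\<Sum>i\<in>S. X_var i" "\<Sum>i\<in>T. Y_var i"] by blast
  qed
  have inner: "Poly_Mapping.keys (\<Prod>T\<in>Sub k {1..m}. (\<Sum>i\<in>S. X_var i) + (\<Sum>i\<in>T. Y_var i)) \<subseteq> homog_expos n m (card (Sub k {1..m}) * 1)"
    if "S \<in> Sub j {1..n}" for S
    by (rule keys_prod_homog_expos[OF factor[OF that] f(2)])
  have "Poly_Mapping.keys (boolean_product_poly n m j k) \<subseteq> homog_expos n m (card (Sub j {1..n}) * (card (Sub k {1..m}) * 1))"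
    unfolding boolean_product_Sub by (rule keys_prod_homog_expos[OF inner f(1)])
  then show ?thesis by (simp add: card_cartesian_product)
qed

text \<open>Inserting eigenvalues and applying both pairings to the expansion leaves only the term
  of \<open>(D, E)\<close>. There the coefficient is multiplied by two positive numbers, and the
  result is nonnegative by the Gram argument.\<close>

lemma schur_coefficient_nonneg:
  assumes c: "boolean_product_poly n m j k = (\<Sum>p\<in>diag_pairs n m d. of_int (c p) * schur2 n m p)"
    and d: "d = card (Sub j {1..n} \<times> Sub k {1..m})"
    and DE: "(D, E) \<in> diag_pairs n m d"
  shows "c (D, E) \<ge> 0"
proof -
  let ?I = "Sub j {1..n} \<times> Sub k {1..m}"
  have D: "ydiag D" "ydiag E" "\<forall>r\<ge>n. row_len D r = 0" "\<forall>r\<ge>m. row_len E r = 0" "card D + card E = d"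
    using DE by (auto simp: diag_pairs_def)
  have eval: "fdet ?I (kronsum j k {1..n} {1..m} A B) = (\<Sum>p\<in>diag_pairs n m d. of_int (c p) * (schur_eigs n (fst p) A * schur_eigs m (snd p) B))" for A B
  proof -
    obtain P P' TA where TA: "tri_form n A P P' TA" "eigs n A = (\<lambda>i. TA i i)" using eigs by blast
    obtain Q Q' TB where TB: "tri_form m B Q Q' TB" "eigs m B = (\<lambda>i. TB i i)" using eigs by blast
    let ?\<phi> = "\<lambda>v. case v of Inl i \<Rightarrow> eigs n A i | Inr i \<Rightarrow> eigs m B i"
    have "fdet ?I (kronsum j k {1..n} {1..m} A B) = peval ?\<phi> (boolean_product_poly n m j k)"
      unfolding fdet_kronsum_tri_form[OF TA(1) TB(1)] peval_boolean_product TA(2) TB(2) by simp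
    also have "\<dots> = (\<Sum>p\<in>diag_pairs n m d. of_int (c p) * (schur_eigs n (fst p) A * schur_eigs m (snd p) B))"
      unfolding c by (simp add: peval_sum peval_mult peval_schur_diag)
    finally show ?thesis .
  qed
  obtain p where p: "p \<ge> 0" "polar_form n D (\<lambda>A. polar_form m E (\<lambda>B. fdet ?I (kronsum j k {1..n} {1..m} A B))) = of_real p"
    using polar_form_kronsum_nonneg[of D E j n k m] D d by (auto intro: ydiag_finite)
  have "polar_form n D (\<lambda>A. polar_form m E (\<lambda>B. fdet ?I (kronsum j k {1..n} {1..m} A B))) =
      (\<Sum>p\<in>diag_pairs n m d. of_int (c p) * (polar_form n D (schur_eigs n (fst p)) * polar_form m E (schur_eigs m (snd p))))"
  proof -
    have "polar_form m E (\<lambda>B. fdet ?I (kronsum j k {1..n} {1..m} A B)) =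
       (\<Sum>p\<in>diag_pairs n m d. (of_int (c p) * polar_form m E (schur_eigs m (snd p))) * schur_eigs n (fst p) A)" for A
      unfolding eval polar_form_sum polar_form_cmult by (intro sum.cong refl) (simp add: mult_ac)
    then have "polar_form n D (\<lambda>A. polar_form m E (\<lambda>B. fdet ?I (kronsum j k {1..n} {1..m} A B))) =
       polar_form n D (\<lambda>A. \<Sum>p\<in>diag_pairs n m d. (of_int (c p) * polar_form m E (schur_eigs m (snd p))) * schur_eigs n (fst p) A)"
      by (intro arg_cong[of _ _ "polar_form n D"] ext)
    also have "\<dots> = (\<Sum>p\<in>diag_pairs n m d. of_int (c p) * polar_form m E (schur_eigs m (snd p)) * polar_form n D (schur_eigs n (fst p)))"
      unfolding polar_form_sum polar_form_cmult ..
    finally show ?thesis by (simp only: mult.assoc mult.commute[of "polar_form m E _"])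
  qed
  also have "\<dots> = (\<Sum>p\<in>diag_pairs n m d. if p = (D, E) then of_int (c p) * (polar_form n D (schur_eigs n D) * polar_form m E (schur_eigs m E)) else 0)"
  proof (rule sum.cong[OF refl])
    fix p assume p: "p \<in> diag_pairs n m d"
    obtain D' E' where [simp]: "p = (D', E')" by (cases p)
    have D': "ydiag D'" "ydiag E'" "card D' + card E' = d" using p by (auto simp: diag_pairs_def)
    \<comment> \<open>Both pairs have \<open>d\<close> cells. If \<open>D'\<close> equals
      \<open>D\<close> or has more cells, then \<open>E'\<close> differs from \<open>E\<close> and
      has at most as many cells, so one of the two pairings always vanishes.\<close>
    have "polar_form n D (schur_eigs n D') = 0 \<or> polar_form m E (schur_eigs m E') = 0" if "D' \<noteq> D \<or> E' \<noteq> E"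
    proof (cases "D' \<noteq> D \<and> card D' \<le> card D")
      case True
      then show ?thesis using polar_form_schur_eigs_orthogonal[OF D(1) D'(1)] by blast
    next
      case False
      then have "card E' \<le> card E" "E' \<noteq> E" using that D' D(5) by (auto simp: not_le)
      then show ?thesis using polar_form_schur_eigs_orthogonal[OF D(2) D'(2)] by blast
    qed
    then show "of_int (c p) * (polar_form n D (schur_eigs n (fst p)) * polar_form m E (schur_eigs m (snd p))) =
      (if p = (D, E) then of_int (c p) * (polar_form n D (schur_eigs n D) * polar_form m E (schur_eigs m E)) else 0)" by auto
  qed
  also have "\<dots> = of_int (c (D, E)) * (polar_form n D (schur_eigs n D) * polar_form m E (schur_eigs m E))"
    using DE finite_diag_pairs by simp
  finally have *: "of_real p = of_int (c (D, E)) * (polar_form n D (schur_eigs n D) * polar_form m E (schur_eigs m E))" using p(2) by simp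
  obtain r s where r: "r > 0" "polar_form n D (schur_eigs n D) = of_real r" and s: "s > 0" "polar_form m E (schur_eigs m E) = of_real s"
    using polar_form_schur_eigs_self[OF D(1,3)] polar_form_schur_eigs_self[OF D(2,4)] by blast
  have "complex_of_real p = complex_of_real (of_int (c (D, E)) * (r * s))" using * r(2) s(2) by simp
  then have "p = of_int (c (D, E)) * (r * s)" by (simp only: of_real_eq_iff)
  then have "0 \<le> of_int (c (D, E)) * (r * s)" using p(1) by simp
  then have "(0 :: real) \<le> of_int (c (D, E))"
    using mult_neg_pos[OF _ mult_pos_pos[OF r(1) s(1)], of "of_int (c (D, E))"] by linarith
  then show ?thesis by simp
qed

section \<open>From diagrams back to partitions\<close>

lemma schur_poly_eq: "schur_poly n lam z = schur_diag n (young_diagram lam) z"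
  unfolding schur_poly_def schur_diag_def ssyt_def tableaux_def ..

lemma row_len_young_diagram: "row_len (young_diagram lam) r = (if r < length lam then lam ! r else 0)"
  unfolding young_diagram_def by (rule row_len_rows)

text \<open>As partitions have no zero parts, the number of nonempty rows of the diagram recovers
  the length of the list.\<close>

lemma inj_young_diagram: "inj_on young_diagram {lam. is_partition lam}"
proof (rule inj_onI)
  fix lam mu assume l: "lam \<in> {lam. is_partition lam}" "mu \<in> {lam. is_partition lam}" and eq: "young_diagram lam = young_diagram mu"
  have r: "(if r < length lam then lam ! r else 0) = (if r < length mu then mu ! r else 0)" for r
    using row_len_young_diagram[of lam r] row_len_young_diagram[of mu r] eq by simp
  have pos: "nu ! i \<noteq> 0" if "is_partition nu" "i < length nu" for nu i
    using that by (metis is_partition_def nth_mem)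
  have "r < length lam \<longleftrightarrow> r < length mu" for r
    using r[of r] pos[of lam r] pos[of mu r] l by (auto split: if_splits)
  then have len: "length lam = length mu" by (metis linorder_neqE_nat order_less_irrefl)
  show "lam = mu" using len r by (intro nth_equalityI) (auto split: if_splits, metis)
qed

lemma young_diagram_surj:
  assumes D: "ydiag D"
  shows "\<exists>lam. is_partition lam \<and> young_diagram lam = D"
proof -
  define N where "N = col_len D 0"
  have N: "row_len D r = 0 \<longleftrightarrow> r \<ge> N" for r
    using mem_iff_row_len[OF D, of r 0] mem_iff_col_len[OF D, of r 0] by (auto simp: N_def)
  let ?lam = "map (row_len D) [0..<N]"
  have "is_partition ?lam"
    unfolding is_partition_def using row_len_antimono[OF D] N by (auto simp: sorted_wrt_iff_nth_less)
  moreover have "young_diagram ?lam = D"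
  proof -
    have "D = {(r, c). r < N \<and> c < row_len D r}" by (rule ydiag_eq_rows[OF D]) (simp add: N)
    moreover have "young_diagram ?lam = {(r, c). r < N \<and> c < row_len D r}" by (auto simp: young_diagram_def)
    ultimately show ?thesis by (rule trans[OF _ sym, rotated])
  qed
  ultimately show ?thesis by blast
qed

theorem theorem3p2:
  fixes n m j k :: nat
  assumes "j \<ge> 1" and "k \<ge> 1"
  shows "\<exists>a :: nat list \<Rightarrow> nat list \<Rightarrow> nat.
    finite {(lam, mu). is_partition lam \<and> is_partition mu \<and> a lam mu \<noteq> 0} \<and>
    boolean_product_poly n m j k =
      (\<Sum>(lam, mu) | is_partition lam \<and> is_partition mu \<and> a lam mu \<noteq> 0.
         of_nat (a lam mu) * schur_poly n lam X_var * schur_poly m mu Y_var)"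
proof -
  define d where "d = card (Sub j {1..n} \<times> Sub k {1..m})"
  obtain c where c: "boolean_product_poly n m j k = (\<Sum>p\<in>diag_pairs n m d. of_int (c p) * schur2 n m p)"
    using schur_expansion[OF bisymmetric_boolean_product keys_boolean_product] unfolding d_def by blast
  have c0: "c p \<ge> 0" if "p \<in> diag_pairs n m d" for p
    using schur_coefficient_nonneg[OF c d_def, of "fst p" "snd p"] that by simp
  let ?y = "\<lambda>(lam, mu). (young_diagram lam, young_diagram mu)"
  \<comment> \<open>Coefficient 0 off \<open>diag_pairs\<close> keeps the support finite, and
    \<open>nat\<close> loses nothing because \<open>c\<close> is nonnegative on
    \<open>diag_pairs\<close>.\<close>
  define a where "a = (\<lambda>lam mu. if ?y (lam, mu) \<in> diag_pairs n m d then nat (c (?y (lam, mu))) else 0)"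
  let ?A = "{(lam, mu). is_partition lam \<and> is_partition mu \<and> a lam mu \<noteq> 0}"
  let ?P = "{p \<in> diag_pairs n m d. c p \<noteq> 0}"
  have inj: "inj_on ?y ?A"
    using inj_young_diagram by (auto simp: inj_on_def)
  have im: "?y ` ?A = ?P"
  proof (intro equalityI subsetI)
    fix p assume "p \<in> ?y ` ?A"
    then show "p \<in> ?P" by (auto simp: a_def split: if_splits)
  next
    fix p assume p: "p \<in> ?P"
    then have "ydiag (fst p)" "ydiag (snd p)" by (auto simp: diag_pairs_def)
    then obtain lam mu where lm: "is_partition lam" "young_diagram lam = fst p" "is_partition mu" "young_diagram mu = snd p"
      using young_diagram_surj by meson
    then have "a lam mu \<noteq> 0" using p c0[of p] by (simp add: a_def)
    then show "p \<in> ?y ` ?A" using lm by (intro image_eqI[of _ _ "(lam, mu)"]) auto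
  qed
  have "finite ?P" using finite_diag_pairs by simp
  then have "finite (?y ` ?A)" by (simp only: im)
  then have fin: "finite ?A" using inj by (rule finite_imageD)
  have "boolean_product_poly n m j k = (\<Sum>p\<in>?P. of_int (c p) * schur2 n m p)"
    unfolding c by (rule sum.mono_neutral_right) (auto simp: finite_diag_pairs)
  also have "\<dots> = (\<Sum>q\<in>?A. of_int (c (?y q)) * schur2 n m (?y q))"
    unfolding im[symmetric] by (rule sum.reindex_cong[OF inj refl]) simp
  also have "\<dots> = (\<Sum>(lam, mu)\<in>?A. of_nat (a lam mu) * schur_poly n lam X_var * schur_poly m mu Y_var)"
  proof (rule sum.cong[OF refl])
    fix q assume q: "q \<in> ?A"
    obtain lam mu where [simp]: "q = (lam, mu)" by (cases q)
    have mem: "?y q \<in> diag_pairs n m d" using q by (auto simp: a_def split: if_splits)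
    then have "int (a lam mu) = c (?y q)" using c0[OF mem] by (simp add: a_def)
    then have "of_int (c (?y q)) = (of_nat (a lam mu) :: xy_poly)" by (metis of_int_of_nat_eq)
    then show "of_int (c (?y q)) * schur2 n m (?y q) = (case q of (lam, mu) \<Rightarrow> of_nat (a lam mu) * schur_poly n lam X_var * schur_poly m mu Y_var)"
      by (simp add: schur_poly_eq mult.assoc)
  qed
  finally show ?thesis using fin by blast
qed

end
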